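(* Let $a>0$ and let $F=F^{1,a}\colon[0,\infty)\to[0,\infty)$ be the convex Orlicz function with $F(0)=0$, $F(t)=e^{-a}\,t\,(-\log t)^{-a}$ for $0<t<1/e$, and $F(t)=t^{1+a}$ for $t\ge 1/e$. Then the Orlicz sequence space $\ell_F$ has a unique greedy basis.
   Context: Orlicz sequence space: for a convex function $F\colon[0,\infty)\to[0,\infty)$ with $F(0)=0$, $F(1)=1$, $\ell_F$ is the Banach space of real sequences $\alpha=(a_n)$ with $\sum_n F(|a_n|/t)<\infty$ for some $t>0$, normed by $\|\alpha\|_F=\inf\{t>0:\sum_nF(|a_n|/t)\le1\}$. (For the function $F$ of the statement the canonical unit vectors form a symmetric, hence greedy, basis of $\ell_F$.) Bases: a basis is a Schauder basis $(x_n)_{n=1}^\infty$, and all bases are assumed semi-normalized, i.e. $0<\inf_n\|x_n\|\le\sup_n\|x_n\|<\infty$. A basis $(x_n)$ of $X$ with biorthogonal functionals $(x_n^* )$ is greedy if there is a constant $C$ such that for every $x\in X$, every $N\in\mathbb{N}$, and every set $\Lambda\subseteq\mathbb{N}$ with $|\Lambda|=N$ and $\min_{n\in\Lambda}|x_n^*(x)|\ge\max_{n\notin\Lambda}|x_n^*(x)|$, one has $\|x-\sum_{n\in\Lambda}x_n^*(x)x_n\|\le C\inf\{\|x-\sum_{n\in A}\alpha_n x_n\| : |A|=N,\ \alpha_n\in\mathbb{R}\}$. Two bases $(x_n)$, $(y_n)$ are equivalent if there is $C\ge1$ with $C^{-1}\|\sum a_nx_n\|\le\|\sum a_ny_n\|\le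 C\|\sum a_nx_n\|$ for all finitely supported real sequences $(a_n)$. A Banach space has a unique greedy basis if it has a semi-normalized greedy basis $(e_n)$ and every semi-normalized greedy basis of the space is equivalent to $(e_n)$. *)

theory Defs
  imports "HOL-Analysis.Analysis" "HOL-Library.Function_Algebras"
begin

instantiation "fun" :: (type, real_vector) real_vector
begin

definition scaleR_fun_def: "scaleR r f = (\<lambda>x. r *\<^sub>R f x)"

instance
  by standard
    (simp_all add: scaleR_fun_def fun_eq_iff scaleR_add_right scaleR_add_left)

end

lemma scaleR_fun_apply [simp]: "(r *\<^sub>R f) x = r *\<^sub>R f x"
  by (simp add: scaleR_fun_def)


section \<open>Bases of a normed space\<close>

text \<open>
  The sequence space of the theorem depends on a real parameter, so it cannot be a type. A normed
  space is therefore given by a carrier \<open>V\<close> (a linear subspace of a real vector space) and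
  its norm \<open>N\<close>, of which only the values on \<open>V\<close> matter.
\<close>

definition basis_expansion ::
    "('a::real_vector \<Rightarrow> real) \<Rightarrow> (nat \<Rightarrow> 'a) \<Rightarrow> 'a \<Rightarrow> (nat \<Rightarrow> real) \<Rightarrow> bool" where
  "basis_expansion N x v c \<longleftrightarrow> (\<lambda>m. N (v - (\<Sum>n<m. c n *\<^sub>R x n))) \<longlonglongrightarrow> 0"

definition schauder_basis ::
    "'a::real_vector set \<Rightarrow> ('a \<Rightarrow> real) \<Rightarrow> (nat \<Rightarrow> 'a) \<Rightarrow> bool" where
  "schauder_basis V N x \<longleftrightarrow>
     (\<forall>n. x n \<in> V) \<and> (\<forall>v\<in>V. \<exists>!c. basis_expansion N x v c)"

definition semi_normalized :: "('a::real_vector \<Rightarrow> real) \<Rightarrow> (nat \<Rightarrow> 'a) \<Rightarrow> bool" where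
  "semi_normalized N x \<longleftrightarrow> 0 < (INF n. N (x n)) \<and> bdd_above (range (\<lambda>n. N (x n)))"

text \<open>The value at \<open>v\<close> of the \<open>n\<close>-th biorthogonal functional of the basis \<open>x\<close>.\<close>

definition basis_coeff ::
    "('a::real_vector \<Rightarrow> real) \<Rightarrow> (nat \<Rightarrow> 'a) \<Rightarrow> nat \<Rightarrow> 'a \<Rightarrow> real" where
  "basis_coeff N x n v = (THE c. basis_expansion N x v c) n"

definition best_approx_error ::
    "('a::real_vector \<Rightarrow> real) \<Rightarrow> (nat \<Rightarrow> 'a) \<Rightarrow> nat \<Rightarrow> 'a \<Rightarrow> real" where
  "best_approx_error N x k v =
     Inf {N (v - (\<Sum>n\<in>A. \<alpha> n *\<^sub>R x n)) | A \<alpha>. finite A \<and> card A = k}"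

definition greedy_basis ::
    "'a::real_vector set \<Rightarrow> ('a \<Rightarrow> real) \<Rightarrow> (nat \<Rightarrow> 'a) \<Rightarrow> bool" where
  "greedy_basis V N x \<longleftrightarrow> schauder_basis V N x \<and>
     (\<exists>C. \<forall>v\<in>V. \<forall>k. \<forall>\<Lambda>. finite \<Lambda> \<and> card \<Lambda> = k \<and>
        (\<forall>n\<in>\<Lambda>. \<forall>m. m \<notin> \<Lambda> \<longrightarrow> \<bar>basis_coeff N x m v\<bar> \<le> \<bar>basis_coeff N x n v\<bar>) \<longrightarrow>
        N (v - (\<Sum>n\<in>\<Lambda>. basis_coeff N x n v *\<^sub>R x n)) \<le> C * best_approx_error N x k v)"

definition equivalent_bases ::
    "('a::real_vector \<Rightarrow> real) \<Rightarrow> (nat \<Rightarrow> 'a) \<Rightarrow> (nat \<Rightarrow> 'a) \<Rightarrow> bool" where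
  "equivalent_bases N x y \<longleftrightarrow>
     (\<exists>C\<ge>1. \<forall>a::nat \<Rightarrow> real. finite {n. a n \<noteq> 0} \<longrightarrow>
        inverse C * N (\<Sum>n | a n \<noteq> 0. a n *\<^sub>R x n) \<le> N (\<Sum>n | a n \<noteq> 0. a n *\<^sub>R y n) \<and>
        N (\<Sum>n | a n \<noteq> 0. a n *\<^sub>R y n) \<le> C * N (\<Sum>n | a n \<noteq> 0. a n *\<^sub>R x n))"

definition has_unique_greedy_basis :: "'a::real_vector set \<Rightarrow> ('a \<Rightarrow> real) \<Rightarrow> bool" where
  "has_unique_greedy_basis V N \<longleftrightarrow>
     (\<exists>e. greedy_basis V N e \<and> semi_normalized N e \<and>
        (\<forall>y. greedy_basis V N y \<and> semi_normalized N y \<longrightarrow> equivalent_bases N e y))"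


section \<open>Orlicz sequence spaces\<close>

definition orlicz_space :: "(real \<Rightarrow> real) \<Rightarrow> (nat \<Rightarrow> real) set" where
  "orlicz_space F = {\<alpha>. \<exists>t>0. summable (\<lambda>n. F (\<bar>\<alpha> n\<bar> / t))}"

text \<open>Summability is explicit because \<open>suminf\<close> is unspecified on divergent series.\<close>

definition orlicz_norm :: "(real \<Rightarrow> real) \<Rightarrow> (nat \<Rightarrow> real) \<Rightarrow> real" where
  "orlicz_norm F \<alpha> =
     Inf {t. 0 < t \<and> summable (\<lambda>n. F (\<bar>\<alpha> n\<bar> / t)) \<and> (\<Sum>n. F (\<bar>\<alpha> n\<bar> / t)) \<le> 1}"

text \<open>The Orlicz function \<open>F\<^sup>1\<^sup>,\<^sup>a\<close>, extended by \<open>0\<close> to negative arguments.\<close>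

definition orlicz_F1 :: "real \<Rightarrow> real \<Rightarrow> real" where
  "orlicz_F1 a t =
     (if t \<le> 0 then 0
      else if t < 1 / exp 1 then exp (- a) * t * (- ln t) powr (- a)
      else t powr (1 + a))"

end

theory Submission
  imports Defs
begin

text \<open>
  The unit vectors \<open>unit_vec j\<close> form a symmetric basis of the Orlicz space, hence a greedy one. Let
  \<open>y\<close> be another semi-normalized greedy basis, with coefficient functionals \<open>f n\<close>. Testing the greedy
  inequality on suitable vectors shows that \<open>y\<close> is unconditional and democratic
  (\<open>unconditional_democratic\<close>). What decides about equivalence are the products
  \<open>y n j * f n (unit_vec j)\<close>, whose sum over \<open>j\<close> is \<open>f n (y n) = 1\<close>.

  Suppose that each \<open>n\<close> has some \<open>j = J n\<close> for which this product is bounded below. Unconditionality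
  bounds the number of \<open>n\<close> sharing a \<open>j\<close>. The operators \<open>y n \<mapsto> y n (J n) *\<^sub>R unit_vec (J n)\<close> and
  \<open>unit_vec (J n) \<mapsto> f n (unit_vec (J n)) *\<^sub>R y n\<close> are diagonals of the matrices that express one basis
  in the other; averaging over signs on both sides shows that such diagonals are bounded, as both bases
  are unconditional. So \<open>y\<close> is equivalent to the unit vectors (\<open>equivalent_if_peaks\<close>).

  The other case is impossible, because the Orlicz function \<open>F\<close> is close to linear and yet not linear.
  Close to linear means that \<open>F (s / h)\<close> is at least a fixed multiple of \<open>F s / h\<close> when \<open>s\<close> is small
  depending on \<open>h\<close>. Consequently disjoint normalized vectors with sufficiently small coordinates
  behave like the basis of \<open>\<ell>\<^sub>1\<close> (\<open>flat_pieces_lower_bound\<close>). If the products above are not bounded below,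
  then some \<open>y n\<close> have large pieces with arbitrarily small coordinates, and these pieces can be found
  disjoint; by democracy, all sums of \<open>k\<close> vectors \<open>y n\<close> have norm of order \<open>k\<close>
  (\<open>linear_growth_if_no_peaks\<close>). Sums of \<open>k\<close> unit vectors are of smaller order, since
  \<open>F t / t\<close> tends to \<open>0\<close> at \<open>0\<close>. Comparing the two by the same diagonal argument,
  \<open>f n (unit_vec j)\<close> tends to \<open>0\<close> uniformly in \<open>n\<close> as \<open>j\<close> grows (\<open>finite_large_coefficients\<close>).

  Then, however, the expansion of \<open>unit_vec j\<close> in \<open>y\<close> has only tiny coefficients, and a random change
  of their signs makes all coordinates of the resulting vector small without changing its norm by more
  than a constant factor (\<open>signed_expansion_with_flat_piece\<close>). Doing this for \<open>k\<close> unit vectors with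
  disjoint blocks of \<open>y\<close> and disjoint pieces gives a vector of norm of order \<open>k\<close> that
  unconditionality compares with a sum of \<open>k\<close> unit vectors, whose norm is of smaller order
  (\<open>large_coefficients_exist\<close>).
\<close>

section \<open>Seminorms and choices of signs\<close>

text \<open>The values of \<open>N\<close> outside the carrier \<open>V\<close> are arbitrary, so every law is restricted to \<open>V\<close>.\<close>

locale seminormed_space =
  fixes V :: "'a::real_vector set" and N :: "'a \<Rightarrow> real"
  assumes V_subspace: "subspace V"
    and N_nonneg: "v \<in> V \<Longrightarrow> 0 \<le> N v"
    and N_triangle: "v \<in> V \<Longrightarrow> w \<in> V \<Longrightarrow> N (v + w) \<le> N v + N w"
    and N_scale: "v \<in> V \<Longrightarrow> N (r *\<^sub>R v) = \<bar>r\<bar> * N v"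
begin

lemma V_add [simp]: "v \<in> V \<Longrightarrow> w \<in> V \<Longrightarrow> v + w \<in> V"
  and V_diff [simp]: "v \<in> V \<Longrightarrow> w \<in> V \<Longrightarrow> v - w \<in> V"
  and V_scale [simp]: "v \<in> V \<Longrightarrow> r *\<^sub>R v \<in> V"
  and V_zero [simp]: "0 \<in> V"
  using V_subspace by (auto intro: subspace_add subspace_diff subspace_scale subspace_0)

lemma V_sum: "(\<And>i. i \<in> I \<Longrightarrow> x i \<in> V) \<Longrightarrow> (\<Sum>i\<in>I. x i) \<in> V"
  using V_subspace by (rule subspace_sum)

lemma N_zero [simp]: "N 0 = 0"
  using N_scale[of 0 0] by simp

lemma N_minus: "v \<in> V \<Longrightarrow> N (- v) = N v"
  using N_scale[of v "-1"] by simp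

lemma N_commute: "v \<in> V \<Longrightarrow> w \<in> V \<Longrightarrow> N (v - w) = N (w - v)"
  using N_minus[of "v - w"] by simp

lemma N_triangle_diff: "v \<in> V \<Longrightarrow> w \<in> V \<Longrightarrow> N (v - w) \<le> N v + N w"
  using N_triangle[of v "- w"] N_minus[of w] V_scale[of w "-1"] by simp

lemma N_triangle_rev: "v \<in> V \<Longrightarrow> w \<in> V \<Longrightarrow> N v \<le> N w + N (v - w)"
  using N_triangle[of w "v - w"] by simp

lemma N_sum: "(\<And>i. i \<in> I \<Longrightarrow> x i \<in> V) \<Longrightarrow> N (\<Sum>i\<in>I. x i) \<le> (\<Sum>i\<in>I. N (x i))"
proof (induction I rule: infinite_finite_induct)
  case (insert i I)
  then have "N (x i + (\<Sum>i\<in>I. x i)) \<le> N (x i) + N (\<Sum>i\<in>I. x i)"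
    by (intro N_triangle V_sum) auto
  moreover have "N (\<Sum>i\<in>I. x i) \<le> (\<Sum>i\<in>I. N (x i))"
    using insert by simp
  ultimately show ?case using insert.hyps by simp
qed auto

text \<open>
  Averaging over signs removes the off-diagonal part of a square array of vectors, so some choice
  of signs makes the signed array at least as large as its diagonal. The offset \<open>v\<close> carries
  the induction.
\<close>

lemma sign_diagonal:
  assumes "finite S" "\<And>k l. k \<in> S \<Longrightarrow> l \<in> S \<Longrightarrow> x k l \<in> V" "v \<in> V"
  shows "\<exists>\<theta>::'i \<Rightarrow> real. (\<forall>k. \<bar>\<theta> k\<bar> = 1) \<and>
    N (v + (\<Sum>k\<in>S. x k k)) \<le> N (v + (\<Sum>k\<in>S. \<Sum>l\<in>S. (\<theta> k * \<theta> l) *\<^sub>R x k l))"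
  using assms
proof (induction S arbitrary: v rule: finite_induct)
  case empty
  show ?case by (rule exI[of _ "\<lambda>_. 1"]) simp
next
  case (insert s S)
  have "v + x s s \<in> V" using insert by simp
  then obtain \<theta> where th: "\<forall>k. \<bar>\<theta> k\<bar> = (1::real)"
    and le: "N (v + x s s + (\<Sum>k\<in>S. x k k))
      \<le> N (v + x s s + (\<Sum>k\<in>S. \<Sum>l\<in>S. (\<theta> k * \<theta> l) *\<^sub>R x k l))"
    using insert.IH[of "v + x s s"] insert.prems by auto
  define A where "A = v + x s s + (\<Sum>k\<in>S. \<Sum>l\<in>S. (\<theta> k * \<theta> l) *\<^sub>R x k l)"
  define C where "C = (\<Sum>k\<in>S. \<theta> k *\<^sub>R (x k s + x s k))"
  have AV: "A \<in> V" and CV: "C \<in> V"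
    unfolding A_def C_def using insert.prems by (auto intro!: V_sum V_add V_scale)
  have upd: "v + (\<Sum>k\<in>insert s S. \<Sum>l\<in>insert s S. ((\<theta>(s:=r)) k * (\<theta>(s:=r)) l) *\<^sub>R x k l) = A + r *\<^sub>R C"
    if "r * r = 1" for r
  proof -
    have *: "(\<Sum>k\<in>S. f ((\<theta>(s:=r)) k) k) = (\<Sum>k\<in>S. f (\<theta> k) k)" for f :: "real \<Rightarrow> 'i \<Rightarrow> 'a"
      using insert.hyps by (intro sum.cong) auto
    have "(\<Sum>k\<in>insert s S. \<Sum>l\<in>insert s S. ((\<theta>(s:=r)) k * (\<theta>(s:=r)) l) *\<^sub>R x k l)
      = (r * r) *\<^sub>R x s s + (\<Sum>l\<in>S. (r * \<theta> l) *\<^sub>R x s l)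
        + (\<Sum>k\<in>S. (\<theta> k * r) *\<^sub>R x k s + (\<Sum>l\<in>S. (\<theta> k * \<theta> l) *\<^sub>R x k l))"
    proof -
      have "(\<Sum>l\<in>S. (a * (\<theta>(s:=r)) l) *\<^sub>R x k l) = (\<Sum>l\<in>S. (a * \<theta> l) *\<^sub>R x k l)" for a k
        using *[of "\<lambda>t l. (a * t) *\<^sub>R x k l"] .
      moreover have "(\<Sum>k\<in>S. ((\<theta>(s:=r)) k * r) *\<^sub>R x k s + (\<Sum>l\<in>S. ((\<theta>(s:=r)) k * \<theta> l) *\<^sub>R x k l))
         = (\<Sum>k\<in>S. (\<theta> k * r) *\<^sub>R x k s + (\<Sum>l\<in>S. (\<theta> k * \<theta> l) *\<^sub>R x k l))"
        using *[of "\<lambda>t k. (t * r) *\<^sub>R x k s + (\<Sum>l\<in>S. (t * \<theta> l) *\<^sub>R x k l)"] .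
      ultimately show ?thesis
        using insert.hyps by (simp del: fun_upd_apply) (simp add: add.assoc)
    qed
    also have "\<dots> = x s s + (\<Sum>k\<in>S. \<Sum>l\<in>S. (\<theta> k * \<theta> l) *\<^sub>R x k l) + r *\<^sub>R C"
      using that by (simp add: C_def sum.distrib scaleR_add_right scaleR_sum_right mult.commute)
    finally show ?thesis by (simp add: A_def)
  qed
  \<comment> \<open>The two choices of the new sign give \<open>A + C\<close> and \<open>A - C\<close>, whose mean is \<open>A\<close>.\<close>
  have "2 *\<^sub>R A = (A + C) + (A - C)" by (simp add: scaleR_2)
  then have "2 * N A \<le> N (A + C) + N (A - C)"
    using N_triangle[of "A + C" "A - C"] AV CV N_scale[OF AV, of 2] by simp
  then have "N A \<le> N (A + C) \<or> N A \<le> N (A - C)" by linarith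
  then obtain r :: real where r: "\<bar>r\<bar> = 1" "N A \<le> N (A + r *\<^sub>R C)"
    by (metis abs_1 abs_minus diff_conv_add_uminus scaleR_minus1_left scaleR_one)
  have rr: "r * r = 1" using r(1) by (metis abs_mult_self_eq mult_1)
  have "v + (\<Sum>k\<in>insert s S. x k k) = v + x s s + (\<Sum>k\<in>S. x k k)"
    using insert.hyps by (simp add: add.assoc)
  then have "N (v + (\<Sum>k\<in>insert s S. x k k)) \<le> N (A + r *\<^sub>R C)"
    using order.trans[OF le[folded A_def] r(2)] by (simp only:)
  moreover have "\<forall>k. \<bar>(\<theta>(s:=r)) k\<bar> = 1" using th r(1) by simp
  ultimately show ?case using upd[OF rr] by (intro exI[of _ "\<theta>(s:=r)"]) (simp only: simp_thms)
qed

text \<open>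
  A seminorm is convex in each multiplier, so over the cube \<open>\<bar>\<mu> k\<bar> \<le> 1\<close> it is largest at a vertex.
\<close>

lemma multipliers_dominated_by_signs:
  assumes "finite S" "\<And>k. k \<in> S \<Longrightarrow> x k \<in> V" "v \<in> V" "\<And>k. k \<in> S \<Longrightarrow> \<bar>\<mu> k\<bar> \<le> 1"
  shows "\<exists>\<theta>::'i \<Rightarrow> real. (\<forall>k. \<bar>\<theta> k\<bar> = 1) \<and>
    N (v + (\<Sum>k\<in>S. \<mu> k *\<^sub>R x k)) \<le> N (v + (\<Sum>k\<in>S. \<theta> k *\<^sub>R x k))"
  using assms
proof (induction S arbitrary: v rule: finite_induct)
  case empty
  show ?case by (rule exI[of _ "\<lambda>_. 1"]) simp
next
  case (insert s S)
  define A where "A = v + (\<Sum>k\<in>S. \<mu> k *\<^sub>R x k)"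
  have AV: "A \<in> V" and xV: "x s \<in> V"
    unfolding A_def using insert.prems by (auto intro!: V_sum V_add)
  have mu: "\<bar>\<mu> s\<bar> \<le> 1" using insert.prems by simp
  have "((1 + \<mu> s) / 2) *\<^sub>R (A + x s) + ((1 - \<mu> s) / 2) *\<^sub>R (A - x s)
      = ((1 + \<mu> s) / 2 + (1 - \<mu> s) / 2) *\<^sub>R A + ((1 + \<mu> s) / 2 - (1 - \<mu> s) / 2) *\<^sub>R x s"
    by (simp only: scaleR_add_right scaleR_diff_right scaleR_left_distrib scaleR_left_diff_distrib) simp
  also have "\<dots> = A + \<mu> s *\<^sub>R x s"
    by (simp add: field_simps)
  finally have "A + \<mu> s *\<^sub>R x s = ((1 + \<mu> s) / 2) *\<^sub>R (A + x s) + ((1 - \<mu> s) / 2) *\<^sub>R (A - x s)"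
    by simp
  then have "N (A + \<mu> s *\<^sub>R x s) \<le> (1 + \<mu> s) / 2 * N (A + x s) + (1 - \<mu> s) / 2 * N (A - x s)"
    using N_triangle[of "((1 + \<mu> s) / 2) *\<^sub>R (A + x s)" "((1 - \<mu> s) / 2) *\<^sub>R (A - x s)"] AV xV mu
    by (simp add: N_scale)
  also have "\<dots> \<le> (1 + \<mu> s) / 2 * max (N (A + x s)) (N (A - x s))
      + (1 - \<mu> s) / 2 * max (N (A + x s)) (N (A - x s))"
    using mu by (intro add_mono mult_left_mono) auto
  also have "\<dots> = max (N (A + x s)) (N (A - x s))" by (simp add: field_simps)
  finally obtain r :: real where r: "\<bar>r\<bar> = 1" "N (A + \<mu> s *\<^sub>R x s) \<le> N (A + r *\<^sub>R x s)"
    by (metis abs_1 abs_minus diff_conv_add_uminus max_def scaleR_minus1_left scaleR_one)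
  have "v + r *\<^sub>R x s \<in> V" using insert.prems by simp
  then obtain \<theta> where th: "\<forall>k. \<bar>\<theta> k\<bar> = (1::real)"
    and le: "N (v + r *\<^sub>R x s + (\<Sum>k\<in>S. \<mu> k *\<^sub>R x k)) \<le> N (v + r *\<^sub>R x s + (\<Sum>k\<in>S. \<theta> k *\<^sub>R x k))"
    using insert.IH[of "v + r *\<^sub>R x s"] insert.prems by auto
  have "(\<Sum>k\<in>S. (\<theta>(s:=r)) k *\<^sub>R x k) = (\<Sum>k\<in>S. \<theta> k *\<^sub>R x k)"
    using insert.hyps by (intro sum.cong) auto
  then have "v + (\<Sum>k\<in>insert s S. (\<theta>(s:=r)) k *\<^sub>R x k) = v + r *\<^sub>R x s + (\<Sum>k\<in>S. \<theta> k *\<^sub>R x k)"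
    using insert.hyps by (simp add: add.assoc)
  moreover have "N (v + (\<Sum>k\<in>insert s S. \<mu> k *\<^sub>R x k)) \<le> N (v + r *\<^sub>R x s + (\<Sum>k\<in>S. \<theta> k *\<^sub>R x k))"
    using le r(2) insert.hyps by (simp add: A_def add_ac)
  moreover have "\<forall>k. \<bar>(\<theta>(s:=r)) k\<bar> = 1" using th r(1) by simp
  ultimately show ?case by (intro exI[of _ "\<theta>(s:=r)"]) (simp only: simp_thms)
qed

end

section \<open>Greedy bases are unconditional and democratic\<close>

lemma signed_sum_eq_diff:
  fixes x :: "'i \<Rightarrow> 'a::real_vector"
  shows "finite A \<Longrightarrow> (\<And>n. \<bar>\<theta> n\<bar> = (1::real)) \<Longrightarrow>
  (\<Sum>n\<in>A. \<theta> n *\<^sub>R x n) = (\<Sum>n\<in>{n\<in>A. \<theta> n = 1}. x n) - (\<Sum>n\<in>{n\<in>A. \<theta> n \<noteq> 1}. x n)"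
proof -
  assume A: "finite A" and th: "\<And>n. \<bar>\<theta> n\<bar> = (1::real)"
  have m: "\<theta> n = -1" if "\<theta> n \<noteq> 1" for n using th[of n] that by (auto simp: abs_if split: if_splits)
  have "(\<Sum>n\<in>A. \<theta> n *\<^sub>R x n) = (\<Sum>n\<in>{n\<in>A. \<theta> n = 1} \<union> {n\<in>A. \<theta> n \<noteq> 1}. \<theta> n *\<^sub>R x n)"
    by (rule arg_cong[of _ _ "sum _"]) auto
  also have "\<dots> = (\<Sum>n\<in>{n\<in>A. \<theta> n = 1}. \<theta> n *\<^sub>R x n) + (\<Sum>n\<in>{n\<in>A. \<theta> n \<noteq> 1}. \<theta> n *\<^sub>R x n)"
    using A by (intro sum.union_disjoint) auto
  also have "(\<Sum>n\<in>{n\<in>A. \<theta> n \<noteq> 1}. \<theta> n *\<^sub>R x n) = (\<Sum>n\<in>{n\<in>A. \<theta> n \<noteq> 1}. - x n)"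
    by (intro sum.cong) (auto dest: m)
  finally show ?thesis by (simp add: sum_negf)
qed

text \<open>
  What the uniqueness argument uses of a greedy basis. One constant \<open>K\<close> serves for the bounds on the
  basis and on the coefficient functionals \<open>f\<close>, for unconditionality and for democracy.
\<close>

locale unconditional_democratic_basis = seminormed_space V N
  for V :: "'a::real_vector set" and N +
  fixes y :: "nat \<Rightarrow> 'a" and f :: "nat \<Rightarrow> 'a \<Rightarrow> real" and K :: real
  assumes y_in [simp]: "y n \<in> V"
    and y_le: "N (y n) \<le> K"
    and f_add: "v \<in> V \<Longrightarrow> w \<in> V \<Longrightarrow> f n (v + w) = f n v + f n w"
    and f_scale: "v \<in> V \<Longrightarrow> f n (r *\<^sub>R v) = r * f n v"
    and f_y: "f n (y m) = (if n = m then 1 else 0)"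
    and f_le: "v \<in> V \<Longrightarrow> \<bar>f n v\<bar> \<le> K * N v"
    and expansion: "v \<in> V \<Longrightarrow> (\<lambda>m. N (v - (\<Sum>n<m. f n v *\<^sub>R y n))) \<longlonglongrightarrow> 0"
    and multiplier: "v \<in> V \<Longrightarrow> finite A \<Longrightarrow> (\<And>n. n \<in> A \<Longrightarrow> \<bar>\<mu> n\<bar> \<le> 1) \<Longrightarrow>
      N (\<Sum>n\<in>A. (\<mu> n * f n v) *\<^sub>R y n) \<le> K * N v"
    and democratic: "finite A \<Longrightarrow> finite B \<Longrightarrow> card A = card B \<Longrightarrow>
      N (\<Sum>n\<in>A. y n) \<le> K * N (\<Sum>n\<in>B. y n)"
    and K_ge_1: "1 \<le> K"

locale greedy_basis_of = seminormed_space V N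
  for V :: "'a::real_vector set" and N +
  fixes y :: "nat \<Rightarrow> 'a"
  assumes greedy: "greedy_basis V N y" and semi: "semi_normalized N y"
begin

abbreviation f where "f \<equiv> basis_coeff N y"

lemma y_V [simp]: "y n \<in> V"
  using greedy by (simp add: greedy_basis_def schauder_basis_def)

lemma ex1_expansion: "v \<in> V \<Longrightarrow> \<exists>!c. basis_expansion N y v c"
  using greedy by (simp add: greedy_basis_def schauder_basis_def)

lemma expansion_f: "v \<in> V \<Longrightarrow> basis_expansion N y v (\<lambda>n. f n v)"
  unfolding basis_coeff_def using theI'[OF ex1_expansion] by simp

lemma f_unique: "v \<in> V \<Longrightarrow> basis_expansion N y v c \<Longrightarrow> f n v = c n"
  unfolding basis_coeff_def using the1_equality[OF ex1_expansion] by metis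

lemma partial_sum_V [simp]: "(\<Sum>n\<in>A. c n *\<^sub>R y n) \<in> V"
  by (intro V_sum V_scale y_V)

lemma f_add: "v \<in> V \<Longrightarrow> w \<in> V \<Longrightarrow> f n (v + w) = f n v + f n w"
proof (rule f_unique)
  assume v: "v \<in> V" and w: "w \<in> V"
  have lim: "(\<lambda>m. N (v - (\<Sum>n<m. f n v *\<^sub>R y n)) + N (w - (\<Sum>n<m. f n w *\<^sub>R y n))) \<longlonglongrightarrow> 0"
    using tendsto_add[OF expansion_f[OF v, unfolded basis_expansion_def] expansion_f[OF w, unfolded basis_expansion_def]]
    by simp
  show "basis_expansion N y (v + w) (\<lambda>n. f n v + f n w)"
    unfolding basis_expansion_def
  proof (rule tendsto_sandwich[OF _ _ tendsto_const lim])
    have eq: "v + w - (\<Sum>n<m. (f n v + f n w) *\<^sub>R y n)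
        = (v - (\<Sum>n<m. f n v *\<^sub>R y n)) + (w - (\<Sum>n<m. f n w *\<^sub>R y n))" for m
      by (simp add: scaleR_add_left sum.distrib)
    show "\<forall>\<^sub>F m in sequentially. 0 \<le> N (v + w - (\<Sum>n<m. (f n v + f n w) *\<^sub>R y n))"
      using v w by (intro always_eventually allI N_nonneg V_diff V_add partial_sum_V)
    show "\<forall>\<^sub>F m in sequentially. N (v + w - (\<Sum>n<m. (f n v + f n w) *\<^sub>R y n))
        \<le> N (v - (\<Sum>n<m. f n v *\<^sub>R y n)) + N (w - (\<Sum>n<m. f n w *\<^sub>R y n))"
      unfolding eq using v w by (intro always_eventually allI N_triangle V_diff partial_sum_V)
  qed
qed simp

lemma f_scale: "v \<in> V \<Longrightarrow> f n (r *\<^sub>R v) = r * f n v"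
proof (rule f_unique)
  assume v: "v \<in> V"
  have "r *\<^sub>R v - (\<Sum>n<m. (r * f n v) *\<^sub>R y n) = r *\<^sub>R (v - (\<Sum>n<m. f n v *\<^sub>R y n))" for m
    by (simp add: scaleR_diff_right scaleR_sum_right)
  then have "N (r *\<^sub>R v - (\<Sum>n<m. (r * f n v) *\<^sub>R y n)) = \<bar>r\<bar> * N (v - (\<Sum>n<m. f n v *\<^sub>R y n))" for m
    using v by (simp add: N_scale)
  then show "basis_expansion N y (r *\<^sub>R v) (\<lambda>n. r * f n v)"
    unfolding basis_expansion_def
    using tendsto_mult_right_zero[OF expansion_f[OF v, unfolded basis_expansion_def], of "\<bar>r\<bar>"] by simp
qed simp

lemma f_finite_sum: 
  assumes "finite A"
  shows "f n (\<Sum>k\<in>A. c k *\<^sub>R y k) = (if n \<in> A then c n else 0)"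
proof (rule f_unique)
  obtain M where M: "A \<subseteq> {..<M}" using assms finite_nat_iff_bounded by blast
  have "N ((\<Sum>k\<in>A. c k *\<^sub>R y k) - (\<Sum>n<m. (if n \<in> A then c n else 0) *\<^sub>R y n)) = 0" if "m \<ge> M" for m
  proof -
    have "(\<Sum>n<m. (if n \<in> A then c n else 0) *\<^sub>R y n) = (\<Sum>k\<in>A. c k *\<^sub>R y k)"
      using M that by (intro sum.mono_neutral_cong_right) auto
    then show ?thesis by simp
  qed
  then show "basis_expansion N y (\<Sum>k\<in>A. c k *\<^sub>R y k) (\<lambda>n. if n \<in> A then c n else 0)"
    unfolding basis_expansion_def
    by (intro tendsto_eventually) (auto simp: eventually_sequentially)
qed simp

lemma f_y: "f n (y m) = (if n = m then 1 else 0)"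
  using f_finite_sum[of "{m}" n "\<lambda>_. 1"] by simp

lemma y_lower: obtains s where "s > 0" "\<And>n. s \<le> N (y n)"
proof (rule that)
  show "0 < (INF n. N (y n))" using semi by (simp add: semi_normalized_def)
  have "bdd_below (range (\<lambda>n. N (y n)))" using N_nonneg by (intro bdd_belowI[of _ 0]) auto
  then show "(INF n. N (y n)) \<le> N (y n)" for n by (rule cINF_lower) simp
qed

text \<open>
  Each term of the expansion is a difference of two remainders, which are bounded as they converge,
  and the basis vectors are bounded away from \<open>0\<close>. This bound may depend on \<open>v\<close>; one proportional to
  the norm of \<open>v\<close> comes from the greedy inequality.
\<close>

lemma f_bounded: 
  assumes v: "v \<in> V"
  obtains T where "\<And>n. \<bar>f n v\<bar> \<le> T"
proof -
  obtain s where s: "s > 0" "\<And>n. s \<le> N (y n)" using y_lower by blast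
  have "Bseq (\<lambda>m. N (v - (\<Sum>n<m. f n v *\<^sub>R y n)))"
    using expansion_f[OF v] unfolding basis_expansion_def
    by (intro convergent_imp_Bseq convergentI)
  then obtain R where R: "\<And>m. \<bar>N (v - (\<Sum>n<m. f n v *\<^sub>R y n))\<bar> \<le> R"
    by (auto simp: Bseq_def)
  have "\<bar>f n v\<bar> \<le> 2 * R / s" for n
  proof -
    have "f n v *\<^sub>R y n = (v - (\<Sum>n<n. f n v *\<^sub>R y n)) - (v - (\<Sum>n<Suc n. f n v *\<^sub>R y n))"
      by simp
    then have "N (f n v *\<^sub>R y n) \<le> N (v - (\<Sum>n<n. f n v *\<^sub>R y n)) + N (v - (\<Sum>n<Suc n. f n v *\<^sub>R y n))"
      using v by (simp only:) (intro N_triangle_diff V_diff partial_sum_V)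
    also have "\<dots> \<le> 2 * R" using R[of n] R[of "Suc n"] by linarith
    finally have "\<bar>f n v\<bar> * N (y n) \<le> 2 * R" by (simp add: N_scale)
    moreover have "\<bar>f n v\<bar> * s \<le> \<bar>f n v\<bar> * N (y n)" using s by (intro mult_left_mono) auto
    ultimately show ?thesis using s by (simp add: field_simps)
  qed
  then show ?thesis by (rule that)
qed

text \<open>
  The infimum is bounded by each competitor, and the constant can be taken nonnegative because the
  infimum is nonnegative.
\<close>

lemma greedy_competitor:
  obtains C where "C \<ge> 0" "\<And>v \<Lambda> A \<alpha>. v \<in> V \<Longrightarrow> finite \<Lambda> \<Longrightarrow> finite A \<Longrightarrow> card A = card \<Lambda> \<Longrightarrow>
    (\<And>n m. n \<in> \<Lambda> \<Longrightarrow> m \<notin> \<Lambda> \<Longrightarrow> \<bar>f m v\<bar> \<le> \<bar>f n v\<bar>) \<Longrightarrow>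
    N (v - (\<Sum>n\<in>\<Lambda>. f n v *\<^sub>R y n)) \<le> C * N (v - (\<Sum>n\<in>A. \<alpha> n *\<^sub>R y n))"
proof -
  from greedy obtain C where C0: "\<forall>v\<in>V. \<forall>k. \<forall>\<Lambda>. finite \<Lambda> \<and> card \<Lambda> = k \<and>
        (\<forall>n\<in>\<Lambda>. \<forall>m. m \<notin> \<Lambda> \<longrightarrow> \<bar>f m v\<bar> \<le> \<bar>f n v\<bar>) \<longrightarrow>
        N (v - (\<Sum>n\<in>\<Lambda>. f n v *\<^sub>R y n)) \<le> C * best_approx_error N y k v"
    unfolding greedy_basis_def by (elim conjE exE)
  have C: "N (v - (\<Sum>n\<in>\<Lambda>. f n v *\<^sub>R y n)) \<le> C * best_approx_error N y (card \<Lambda>) v"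
    if "v \<in> V" "finite \<Lambda>" "\<And>n m. n \<in> \<Lambda> \<Longrightarrow> m \<notin> \<Lambda> \<Longrightarrow> \<bar>f m v\<bar> \<le> \<bar>f n v\<bar>" for v \<Lambda>
    by (rule C0[rule_format]) (use that in auto)
  have "N (v - (\<Sum>n\<in>\<Lambda>. f n v *\<^sub>R y n)) \<le> \<bar>C\<bar> * N (v - (\<Sum>n\<in>A. \<alpha> n *\<^sub>R y n))"
    if v: "v \<in> V" and "finite \<Lambda>" and A: "finite A" "card A = card \<Lambda>"
      and "\<And>n m. n \<in> \<Lambda> \<Longrightarrow> m \<notin> \<Lambda> \<Longrightarrow> \<bar>f m v\<bar> \<le> \<bar>f n v\<bar>" for v \<Lambda> A \<alpha>
  proof -
    let ?S = "{N (v - (\<Sum>n\<in>A. \<alpha> n *\<^sub>R y n)) | A \<alpha>. finite A \<and> card A = card \<Lambda>}"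
    have nn: "0 \<le> x" if "x \<in> ?S" for x using that v N_nonneg by auto
    have mem: "N (v - (\<Sum>n\<in>A. \<alpha> n *\<^sub>R y n)) \<in> ?S" using A by blast
    have "best_approx_error N y (card \<Lambda>) v \<le> N (v - (\<Sum>n\<in>A. \<alpha> n *\<^sub>R y n))"
      unfolding best_approx_error_def using mem nn by (intro cInf_lower bdd_belowI[of _ 0]) auto
    moreover have "0 \<le> best_approx_error N y (card \<Lambda>) v"
      unfolding best_approx_error_def using mem nn by (intro cInf_greatest) auto
    ultimately have "C * best_approx_error N y (card \<Lambda>) v \<le> \<bar>C\<bar> * N (v - (\<Sum>n\<in>A. \<alpha> n *\<^sub>R y n))"
      by (intro mult_mono) auto
    with C[of v \<Lambda>, OF that(1,2,5)] show ?thesis by linarith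
  qed
  then show ?thesis by (rule that[OF abs_ge_zero])
qed

text \<open>
  Raising the coefficients on \<open>A\<close> above all others makes \<open>A\<close> a greedy set, and lowering them back
  is an approximation by \<open>card A\<close> terms.
\<close>

lemma complement_projection_bounded:
  obtains C where "C \<ge> 0" "\<And>v A. v \<in> V \<Longrightarrow> finite A \<Longrightarrow> N (v - (\<Sum>n\<in>A. f n v *\<^sub>R y n)) \<le> C * N v"
proof -
  obtain C where C: "C \<ge> 0" "\<And>v \<Lambda> A \<alpha>. v \<in> V \<Longrightarrow> finite \<Lambda> \<Longrightarrow> finite A \<Longrightarrow> card A = card \<Lambda> \<Longrightarrow>
    (\<And>n m. n \<in> \<Lambda> \<Longrightarrow> m \<notin> \<Lambda> \<Longrightarrow> \<bar>f m v\<bar> \<le> \<bar>f n v\<bar>) \<Longrightarrow>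
    N (v - (\<Sum>n\<in>\<Lambda>. f n v *\<^sub>R y n)) \<le> C * N (v - (\<Sum>n\<in>A. \<alpha> n *\<^sub>R y n))"
    by (erule greedy_competitor)
  have "N (v - (\<Sum>n\<in>A. f n v *\<^sub>R y n)) \<le> C * N v" if v: "v \<in> V" and A: "finite A" for v A
  proof -
    obtain T where T: "\<And>n. \<bar>f n v\<bar> \<le> T" using f_bounded[OF v] by blast
    define g where "g = v + (\<Sum>n\<in>A. (T - f n v) *\<^sub>R y n)"
    have gV: "g \<in> V" using v by (simp add: g_def)
    have fg: "f n g = (if n \<in> A then T else f n v)" for n
      using A v by (simp add: g_def f_add f_finite_sum)
    have "T \<ge> 0" using T[of 0] by linarith
    then have "\<bar>f m g\<bar> \<le> \<bar>f n g\<bar>" if "n \<in> A" "m \<notin> A" for n m using that fg T[of m] by simp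
    then have "N (g - (\<Sum>n\<in>A. f n g *\<^sub>R y n)) \<le> C * N (g - (\<Sum>n\<in>A. (T - f n v) *\<^sub>R y n))"
      using A gV by (intro C(2)) auto
    moreover have "g - (\<Sum>n\<in>A. f n g *\<^sub>R y n) = v - (\<Sum>n\<in>A. f n v *\<^sub>R y n)"
    proof -
      have "(\<Sum>n\<in>A. f n g *\<^sub>R y n) = (\<Sum>n\<in>A. (T - f n v) *\<^sub>R y n) + (\<Sum>n\<in>A. f n v *\<^sub>R y n)"
        unfolding sum.distrib[symmetric] scaleR_add_left[symmetric] by (intro sum.cong) (auto simp: fg)
      then show ?thesis by (simp add: g_def)
    qed
    moreover have "g - (\<Sum>n\<in>A. (T - f n v) *\<^sub>R y n) = v" by (simp add: g_def)
    ultimately show ?thesis by (simp only:)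
  qed
  with C(1) show ?thesis by (rule that)
qed

text \<open>
  All nonzero coefficients of the sum of the basis vectors over \<open>A\<close> and \<open>D\<close> are equal, so \<open>D\<close> is
  a greedy set for it; removing \<open>D\<close> leaves the sum over \<open>A\<close>, and removing \<open>A\<close> instead is a competitor.
\<close>

lemma disjoint_democratic:
  obtains C where "C \<ge> 0" "\<And>A D. finite A \<Longrightarrow> finite D \<Longrightarrow> card A = card D \<Longrightarrow> A \<inter> D = {} \<Longrightarrow>
    N (\<Sum>n\<in>A. y n) \<le> C * N (\<Sum>n\<in>D. y n)"
proof -
  obtain C where C: "C \<ge> 0" "\<And>v \<Lambda> A \<alpha>. v \<in> V \<Longrightarrow> finite \<Lambda> \<Longrightarrow> finite A \<Longrightarrow> card A = card \<Lambda> \<Longrightarrow>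
    (\<And>n m. n \<in> \<Lambda> \<Longrightarrow> m \<notin> \<Lambda> \<Longrightarrow> \<bar>f m v\<bar> \<le> \<bar>f n v\<bar>) \<Longrightarrow>
    N (v - (\<Sum>n\<in>\<Lambda>. f n v *\<^sub>R y n)) \<le> C * N (v - (\<Sum>n\<in>A. \<alpha> n *\<^sub>R y n))"
    by (erule greedy_competitor)
  have "N (\<Sum>n\<in>A. y n) \<le> C * N (\<Sum>n\<in>D. y n)"
    if A: "finite A" and D: "finite D" and card: "card A = card D" and dis: "A \<inter> D = {}" for A D
  proof -
    define g where "g = (\<Sum>n\<in>A \<union> D. 1 *\<^sub>R y n)"
    have gV: "g \<in> V" unfolding g_def by (rule partial_sum_V)
    have fg: "f n g = (if n \<in> A \<union> D then 1 else 0)" for n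
      using A D by (simp only: g_def f_finite_sum finite_Un)
    have g: "g = (\<Sum>n\<in>A. y n) + (\<Sum>n\<in>D. y n)"
      unfolding g_def using A D dis by (simp add: sum.union_disjoint)
    have "N (g - (\<Sum>n\<in>D. f n g *\<^sub>R y n)) \<le> C * N (g - (\<Sum>n\<in>A. 1 *\<^sub>R y n))"
      using A D gV card by (intro C(2)) (auto simp: fg)
    moreover have "(\<Sum>n\<in>D. f n g *\<^sub>R y n) = (\<Sum>n\<in>D. y n)" by (intro sum.cong) (auto simp: fg)
    ultimately show ?thesis by (simp add: g)
  qed
  with C(1) show ?thesis by (rule that)
qed

text \<open>Two arbitrary sets are compared through a third one, disjoint from both.\<close>

lemma democratic_bound:
  obtains C where "C \<ge> 0" "\<And>A B. finite A \<Longrightarrow> finite B \<Longrightarrow> card A = card B \<Longrightarrow>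
    N (\<Sum>n\<in>A. y n) \<le> C * N (\<Sum>n\<in>B. y n)"
proof -
  obtain C where C: "C \<ge> 0" "\<And>A D. finite A \<Longrightarrow> finite D \<Longrightarrow> card A = card D \<Longrightarrow> A \<inter> D = {} \<Longrightarrow>
    N (\<Sum>n\<in>A. y n) \<le> C * N (\<Sum>n\<in>D. y n)" by (erule disjoint_democratic)
  have "N (\<Sum>n\<in>A. y n) \<le> (C * C) * N (\<Sum>n\<in>B. y n)"
    if A: "finite A" and B: "finite B" and card: "card A = card B" for A B
  proof -
    have "infinite (- (A \<union> B))" using A B by (simp add: Compl_eq_Diff_UNIV)
    then obtain D where D: "D \<subseteq> - (A \<union> B)" "finite D" "card D = card A"
      using infinite_arbitrarily_large by blast
    have "N (\<Sum>n\<in>A. y n) \<le> C * N (\<Sum>n\<in>D. y n)" using D A by (intro C(2)) auto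
    also have "\<dots> \<le> C * (C * N (\<Sum>n\<in>B. y n))" using D B card C(1) by (intro mult_left_mono C(2)) auto
    finally show ?thesis by simp
  qed
  then show ?thesis using C(1) by (intro that[of "C * C"]) auto
qed

theorem unconditional_democratic:
  "\<exists>K. unconditional_democratic_basis V N y f K"
proof -
  obtain C where C: "C \<ge> 0" and proj: "\<And>v A. v \<in> V \<Longrightarrow> finite A \<Longrightarrow> N (v - (\<Sum>n\<in>A. f n v *\<^sub>R y n)) \<le> C * N v"
    by (erule complement_projection_bounded)
  obtain C' where C': "C' \<ge> 0" and dem: "\<And>A B. finite A \<Longrightarrow> finite B \<Longrightarrow> card A = card B \<Longrightarrow>
    N (\<Sum>n\<in>A. y n) \<le> C' * N (\<Sum>n\<in>B. y n)" by (erule democratic_bound)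
  obtain s where s: "s > 0" "\<And>n. s \<le> N (y n)" using y_lower by blast
  obtain M where M: "\<And>n. N (y n) \<le> M"
    using semi unfolding semi_normalized_def bdd_above_def by auto
  define Q where "Q = (1 + C) / s"
  define K where "K = Max {1, M, C', 2 * (1 + C), Q}"
  have K: "1 \<le> K" and KM: "M \<le> K" and KC': "C' \<le> K" and KC: "2 * (1 + C) \<le> K" and Ks: "Q \<le> K"
    unfolding K_def by (intro Max_ge; simp)+
  have proj': "N (\<Sum>n\<in>A. f n v *\<^sub>R y n) \<le> (1 + C) * N v" if "v \<in> V" "finite A" for v A
    using N_triangle_diff[of v "v - (\<Sum>n\<in>A. f n v *\<^sub>R y n)"] proj[OF that] that by (simp add: algebra_simps)
  show ?thesis
  proof (intro exI[of _ K] unconditional_democratic_basis.intro unconditional_democratic_basis_axioms.intro)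
    show "seminormed_space V N" by (rule seminormed_space_axioms)
    show "y n \<in> V" for n by simp
    show "N (y n) \<le> K" for n using M[of n] KM by linarith
    show "f n (v + w) = f n v + f n w" if "v \<in> V" "w \<in> V" for v w n using that by (rule f_add)
    show "f n (r *\<^sub>R v) = r * f n v" if "v \<in> V" for v n r using that by (rule f_scale)
    show "f n (y m) = (if n = m then 1 else 0)" for n m by (rule f_y)
    show "\<bar>f n v\<bar> \<le> K * N v" if v: "v \<in> V" for n v
    proof -
      have "s * \<bar>f n v\<bar> \<le> N (y n) * \<bar>f n v\<bar>" using s by (intro mult_right_mono) auto
      also have "\<dots> \<le> (1 + C) * N v" using proj'[OF v, of "{n}"] by (simp add: N_scale mult.commute)
      finally have "\<bar>f n v\<bar> \<le> Q * N v" using s by (simp add: Q_def field_simps)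
      also have "\<dots> \<le> K * N v" using Ks N_nonneg[OF v] by (rule mult_right_mono)
      finally show ?thesis .
    qed
    show "(\<lambda>m. N (v - (\<Sum>n<m. f n v *\<^sub>R y n))) \<longlonglongrightarrow> 0" if "v \<in> V" for v
      using expansion_f[OF that] by (simp add: basis_expansion_def)
    show "N (\<Sum>n\<in>A. (\<mu> n * f n v) *\<^sub>R y n) \<le> K * N v"
      if v: "v \<in> V" and A: "finite A" and mu: "\<And>n. n \<in> A \<Longrightarrow> \<bar>\<mu> n\<bar> \<le> 1" for v A \<mu>
    proof -
      obtain \<theta> where th: "\<forall>k. \<bar>\<theta> k\<bar> = (1::real)"
        and le: "N (0 + (\<Sum>n\<in>A. \<mu> n *\<^sub>R (f n v *\<^sub>R y n))) \<le> N (0 + (\<Sum>n\<in>A. \<theta> n *\<^sub>R (f n v *\<^sub>R y n)))"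
        using multipliers_dominated_by_signs[of A "\<lambda>n. f n v *\<^sub>R y n" 0 \<mu>] A mu by auto
      have "N (\<Sum>n\<in>A. \<theta> n *\<^sub>R (f n v *\<^sub>R y n))
        \<le> N (\<Sum>n\<in>{n\<in>A. \<theta> n = 1}. f n v *\<^sub>R y n) + N (\<Sum>n\<in>{n\<in>A. \<theta> n \<noteq> 1}. f n v *\<^sub>R y n)"
        using th A by (subst signed_sum_eq_diff) (auto intro!: N_triangle_diff)
      also have "\<dots> \<le> 2 * (1 + C) * N v"
        using proj'[OF v, of "{n\<in>A. \<theta> n = 1}"] proj'[OF v, of "{n\<in>A. \<theta> n \<noteq> 1}"] A by (simp add: algebra_simps)
      also have "\<dots> \<le> K * N v" using KC N_nonneg[OF v] by (rule mult_right_mono)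
      finally show ?thesis using le by simp
    qed
    show "N (\<Sum>n\<in>A. y n) \<le> K * N (\<Sum>n\<in>B. y n)" if "finite A" "finite B" "card A = card B" for A B
    proof -
      have "C' * N (\<Sum>n\<in>B. y n) \<le> K * N (\<Sum>n\<in>B. y n)"
        using KC' by (intro mult_right_mono N_nonneg V_sum) auto
      with dem[OF that] show ?thesis by linarith
    qed
    show "1 \<le> K" by (rule K)
  qed
qed

end

context unconditional_democratic_basis
begin

lemma K_pos: "0 < K" using K_ge_1 by simp

lemma comb_in [simp]: "(\<Sum>i\<in>I. c i *\<^sub>R y (\<nu> i)) \<in> V"
  by (intro V_sum V_scale y_in)

lemma f_zero: "f n 0 = 0" using f_scale[of 0 n 0] by simp

lemma f_diff: "v \<in> V \<Longrightarrow> w \<in> V \<Longrightarrow> f n (v - w) = f n v - f n w"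
  using f_add[of v "(-1) *\<^sub>R w" n] f_scale[of w n "-1"] V_scale[of w "-1"] by simp

lemma f_sum: "(\<And>i. i \<in> I \<Longrightarrow> x i \<in> V) \<Longrightarrow> f n (\<Sum>i\<in>I. x i) = (\<Sum>i\<in>I. f n (x i))"
  by (induction I rule: infinite_finite_induct) (auto simp: f_zero f_add V_sum)

lemma f_comb:
  assumes "finite I" "inj_on \<nu> I" "k \<in> I"
  shows "f (\<nu> k) (\<Sum>i\<in>I. c i *\<^sub>R y (\<nu> i)) = c k"
proof -
  have "f (\<nu> k) (\<Sum>i\<in>I. c i *\<^sub>R y (\<nu> i)) = (\<Sum>i\<in>I. if i = k then c i else 0)"
  proof (subst f_sum)
    show "(\<Sum>i\<in>I. f (\<nu> k) (c i *\<^sub>R y (\<nu> i))) = (\<Sum>i\<in>I. if i = k then c i else 0)"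
      using assms by (intro sum.cong) (auto simp: f_scale f_y inj_on_def)
  qed simp
  then show ?thesis using assms by simp
qed

lemma multiplier_indexed:
  assumes v: "v \<in> V" and I: "finite I" "inj_on \<nu> I" and mu: "\<And>i. i \<in> I \<Longrightarrow> \<bar>\<mu> i\<bar> \<le> 1"
  shows "N (\<Sum>i\<in>I. (\<mu> i * f (\<nu> i) v) *\<^sub>R y (\<nu> i)) \<le> K * N v"
proof -
  have "(\<Sum>i\<in>I. (\<mu> i * f (\<nu> i) v) *\<^sub>R y (\<nu> i)) = (\<Sum>n\<in>\<nu> ` I. (\<mu> (inv_into I \<nu> n) * f n v) *\<^sub>R y n)"
    using I by (simp add: sum.reindex)
  also have "N \<dots> \<le> K * N v"
    using I mu by (intro multiplier v) (auto simp: inv_into_f_f)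
  finally show ?thesis .
qed

lemma comb_mono:
  assumes I: "finite I" "inj_on \<nu> I" and le: "\<And>i. i \<in> I \<Longrightarrow> \<bar>d i\<bar> \<le> \<bar>c i\<bar>"
  shows "N (\<Sum>i\<in>I. d i *\<^sub>R y (\<nu> i)) \<le> K * N (\<Sum>i\<in>I. c i *\<^sub>R y (\<nu> i))"
proof -
  define g where "g = (\<Sum>i\<in>I. c i *\<^sub>R y (\<nu> i))"
  have "(\<Sum>i\<in>I. d i *\<^sub>R y (\<nu> i)) = (\<Sum>i\<in>I. (d i / c i * f (\<nu> i) g) *\<^sub>R y (\<nu> i))"
  proof (rule sum.cong[OF refl])
    fix i assume i: "i \<in> I"
    have "d i = d i / c i * c i" using le[OF i] by (cases "c i = 0") auto
    then show "d i *\<^sub>R y (\<nu> i) = (d i / c i * f (\<nu> i) g) *\<^sub>R y (\<nu> i)"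
      using f_comb[OF I i, of c] by (simp add: g_def)
  qed
  also have "N \<dots> \<le> K * N g"
    using I le by (intro multiplier_indexed) (auto simp: g_def divide_le_eq_1)
  finally show ?thesis by (simp only: g_def)
qed

end

section \<open>Orlicz sequence spaces close to the space of summable sequences\<close>

lemma sum_fun_apply: "(\<Sum>i\<in>I. g i) k = (\<Sum>i\<in>I. g i k)"
  for g :: "'i \<Rightarrow> 'b \<Rightarrow> real"
  by (induction I rule: infinite_finite_induct) auto

definition unit_vec :: "nat \<Rightarrow> nat \<Rightarrow> real" where
  "unit_vec n = (\<lambda>k. if k = n then 1 else 0)"

definition restrict_to :: "nat set \<Rightarrow> (nat \<Rightarrow> real) \<Rightarrow> nat \<Rightarrow> real" where
  "restrict_to D x = (\<lambda>i. if i \<in> D then x i else 0)"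

lemma unit_vec_comb_apply:
  assumes "finite I" "inj_on \<mu> I" "k \<in> I"
  shows "(\<Sum>i\<in>I. c i *\<^sub>R unit_vec (\<mu> i)) (\<mu> k) = c k"
proof -
  have "(\<Sum>i\<in>I. c i *\<^sub>R unit_vec (\<mu> i)) (\<mu> k) = (\<Sum>i\<in>I. if i = k then c i else 0)"
    unfolding sum_fun_apply using assms by (intro sum.cong) (auto simp: unit_vec_def inj_on_def)
  then show ?thesis using assms by simp
qed

lemma unit_vec_comb_apply_id:
  "finite I \<Longrightarrow> (\<Sum>i\<in>I. c i *\<^sub>R unit_vec i) k = (if k \<in> I then c k else 0)"
  by (simp add: sum_fun_apply unit_vec_def if_distrib[of "\<lambda>t. _ * t"] cong: if_cong)

lemma unit_vec_comb_apply_0: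
  "k \<notin> \<mu> ` I \<Longrightarrow> (\<Sum>i\<in>I. c i *\<^sub>R unit_vec (\<mu> i)) k = 0"
  unfolding sum_fun_apply by (intro sum.neutral) (auto simp: unit_vec_def)

lemma restrict_to_eq_sum: "finite D \<Longrightarrow> restrict_to D x = (\<Sum>i\<in>D. x i *\<^sub>R unit_vec i)"
  by (rule ext) (simp only: unit_vec_comb_apply_id restrict_to_def)

text \<open>
  The function is linear near \<open>0\<close> up to the factor \<open>\<kappa>\<close>, in the sense that dividing a small argument by
  \<open>h\<close> divides the value by at most \<open>h / \<kappa>\<close>; how small depends on \<open>h\<close>. It is not equivalent to a
  linear function, as \<open>F s / s\<close> tends to \<open>0\<close>. The last condition embeds the Orlicz space into \<open>\<ell>\<^sub>2\<close>.
\<close>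

locale near_linear_orlicz =
  fixes F :: "real \<Rightarrow> real" and \<kappa> \<gamma> :: real
  assumes F_zero: "F 0 = 0" and F_one: "F 1 = 1"
    and F_convex: "convex_on {0..} F"
    and F_pos: "0 < t \<Longrightarrow> 0 < F t"
    and kappa_pos: "0 < \<kappa>"
    and F_almost_linear: "1 \<le> h \<Longrightarrow> \<exists>\<tau>>0. \<forall>s. 0 \<le> s \<and> s \<le> \<tau> \<longrightarrow> \<kappa> * F s / h \<le> F (s / h)"
    and F_sublinear: "0 < \<epsilon> \<Longrightarrow> \<exists>\<tau>>0. \<forall>s. 0 \<le> s \<and> s \<le> \<tau> \<longrightarrow> F s \<le> \<epsilon> * s"
    and square_le_F: "0 \<le> t \<Longrightarrow> t \<le> 1 \<Longrightarrow> t\<^sup>2 \<le> \<gamma> * F t"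
begin

abbreviation X where "X \<equiv> orlicz_space F"
abbreviation N where "N \<equiv> orlicz_norm F"

lemma F_nonneg: "0 \<le> t \<Longrightarrow> 0 \<le> F t"
  using F_pos[of t] F_zero by (cases "t = 0") auto

lemma F_star: "0 \<le> l \<Longrightarrow> l \<le> 1 \<Longrightarrow> 0 \<le> u \<Longrightarrow> F (l * u) \<le> l * F u"
  using convex_onD[OF F_convex, of l 0 u] F_zero by simp

lemma F_mono: assumes "0 \<le> s" "s \<le> t" shows "F s \<le> F t"
proof (cases "t = 0")
  case False
  then have t: "t > 0" using assms by simp
  have "F (s / t * t) \<le> s / t * F t" using assms t by (intro F_star) auto
  also have "\<dots> \<le> 1 * F t" using assms t F_nonneg[of t] by (intro mult_right_mono) auto
  finally show ?thesis using t by simp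
qed (use assms in auto)

lemma F_le_1: assumes "0 \<le> t" "F t \<le> 1" shows "t \<le> 1"
proof (rule ccontr)
  assume "\<not> t \<le> 1"
  then have t: "t > 1" by simp
  then have "F (1 / t * t) \<le> 1 / t * F t" by (intro F_star) auto
  then have "t \<le> F t" using t F_one by (simp add: field_simps)
  with t assms show False by simp
qed

lemma F_convex_comb:
  assumes "0 < s" "0 < t" "0 \<le> u" "0 \<le> v"
  shows "F ((u + v) / (s + t)) \<le> s / (s + t) * F (u / s) + t / (s + t) * F (v / t)"
proof -
  have "F ((1 - t / (s + t)) *\<^sub>R (u / s) + (t / (s + t)) *\<^sub>R (v / t))
    \<le> (1 - t / (s + t)) * F (u / s) + (t / (s + t)) * F (v / t)"
    using assms by (intro convex_onD[OF F_convex]) auto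
  moreover have "1 - t / (s + t) = s / (s + t)" using assms by (simp add: field_simps)
  moreover have "(s / (s + t)) *\<^sub>R (u / s) + (t / (s + t)) *\<^sub>R (v / t) = (u + v) / (s + t)"
    using assms by (simp add: add_divide_distrib)
  ultimately show ?thesis by simp
qed

text \<open>
  Almost linearity with \<open>h = 2\<close> is the doubling condition at \<open>0\<close>, so summability does not depend on
  the scale.
\<close>

lemma summable_half:
  assumes t: "0 < t" and sm: "summable (\<lambda>n. F (\<bar>x n\<bar> / t))"
  shows "summable (\<lambda>n. F (\<bar>x n\<bar> / (t / 2)))"
proof -
  obtain \<tau> where tau: "\<tau> > 0" "\<And>s. 0 \<le> s \<Longrightarrow> s \<le> \<tau> \<Longrightarrow> \<kappa> * F s / 2 \<le> F (s / 2)"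
    using F_almost_linear[of 2] by auto
  have "(\<lambda>n. F (\<bar>x n\<bar> / t)) \<longlonglongrightarrow> 0" using sm by (rule summable_LIMSEQ_zero)
  then have "\<forall>\<^sub>F n in sequentially. F (\<bar>x n\<bar> / t) < F (\<tau> / 2)"
    using tau(1) F_pos[of "\<tau> / 2"] by (intro order_tendstoD) auto
  then have "\<forall>\<^sub>F n in sequentially. norm (F (\<bar>x n\<bar> / (t / 2))) \<le> 2 / \<kappa> * F (\<bar>x n\<bar> / t)"
  proof eventually_elim
    case (elim n)
    define u where "u = \<bar>x n\<bar> / (t / 2)"
    have u: "0 \<le> u" "\<bar>x n\<bar> / t = u / 2" using t by (auto simp: u_def)
    have "u / 2 < \<tau> / 2" using elim F_mono[of "\<tau> / 2" "u / 2"] tau(1) unfolding u(2) by linarith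
    then have "\<kappa> * F u / 2 \<le> F (u / 2)" using tau(2) u by simp
    then show ?case using kappa_pos F_nonneg[OF u(1)] unfolding u_def[symmetric] u(2)
      by (simp add: field_simps)
  qed
  then show ?thesis by (rule summable_comparison_test_ev) (intro summable_mult sm)
qed

lemma summable_mono:
  assumes "0 < s" "s \<le> t" "summable (\<lambda>n. F (\<bar>x n\<bar> / s))"
  shows "summable (\<lambda>n. F (\<bar>x n\<bar> / t))"
proof (rule summable_comparison_test[OF _ assms(3)], intro exI allI impI)
  fix n
  have "\<bar>x n\<bar> / t \<le> \<bar>x n\<bar> / s" using assms by (intro divide_left_mono) auto
  then show "norm (F (\<bar>x n\<bar> / t)) \<le> F (\<bar>x n\<bar> / s)"
    using assms F_nonneg[of "\<bar>x n\<bar> / t"] by (simp add: F_mono)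
qed

lemma summable_modular:
  assumes x: "x \<in> X" and t: "0 < t"
  shows "summable (\<lambda>n. F (\<bar>x n\<bar> / t))"
proof -
  obtain s where s: "0 < s" "summable (\<lambda>n. F (\<bar>x n\<bar> / s))" using x by (auto simp: orlicz_space_def)
  have half: "summable (\<lambda>n. F (\<bar>x n\<bar> / (s / 2 ^ k)))" for k
  proof (induction k)
    case (Suc k)
    then show ?case using summable_half[of "s / 2 ^ k" x] s by (simp add: field_simps)
  qed (use s in simp)
  obtain k where k: "s / t < 2 ^ k" using real_arch_pow[of 2 "s / t"] by auto
  then have "s / 2 ^ k \<le> t" using t by (simp add: field_simps)
  then show ?thesis using s half by (intro summable_mono[of "s / 2 ^ k" t]) auto
qed

lemma in_XI: "0 < t \<Longrightarrow> summable (\<lambda>n. F (\<bar>x n\<bar> / t)) \<Longrightarrow> x \<in> X"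
  by (auto simp: orlicz_space_def)

lemma norm_set_bdd: "bdd_below {t. 0 < t \<and> summable (\<lambda>n. F (\<bar>x n\<bar> / t)) \<and> (\<Sum>n. F (\<bar>x n\<bar> / t)) \<le> 1}"
  by (intro bdd_belowI[of _ 0]) auto

lemma norm_leI: "0 < t \<Longrightarrow> summable (\<lambda>n. F (\<bar>x n\<bar> / t)) \<Longrightarrow> (\<Sum>n. F (\<bar>x n\<bar> / t)) \<le> 1 \<Longrightarrow> N x \<le> t"
  unfolding orlicz_norm_def by (rule cInf_lower[OF _ norm_set_bdd]) auto

lemma norm_set_nonempty:
  assumes x: "x \<in> X"
  shows "{t. 0 < t \<and> summable (\<lambda>n. F (\<bar>x n\<bar> / t)) \<and> (\<Sum>n. F (\<bar>x n\<bar> / t)) \<le> 1} \<noteq> {}"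
proof -
  define h where "h = max 1 (\<Sum>n. F (\<bar>x n\<bar> / 1))"
  have h: "h \<ge> 1" "(\<Sum>n. F (\<bar>x n\<bar> / 1)) \<le> h" by (auto simp: h_def)
  have s: "summable (\<lambda>n. F (\<bar>x n\<bar> / h))" "summable (\<lambda>n. F (\<bar>x n\<bar> / 1))"
    using h by (auto intro!: summable_modular[OF x] simp del: div_by_1)
  have "(\<Sum>n. F (\<bar>x n\<bar> / h)) \<le> (\<Sum>n. 1 / h * F (\<bar>x n\<bar> / 1))"
    using F_star[of "1 / h" "\<bar>x n\<bar>" for n] h s by (intro suminf_le) (auto intro: summable_mult)
  also have "\<dots> = 1 / h * (\<Sum>n. F (\<bar>x n\<bar> / 1))" using s(2) by (rule suminf_mult)
  also have "\<dots> \<le> 1" using h by (simp add: field_simps)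
  finally show ?thesis using s h by (intro ex_in_conv[THEN iffD1] exI[of _ h]) auto
qed

lemma norm_nonneg: "x \<in> X \<Longrightarrow> 0 \<le> N x"
  unfolding orlicz_norm_def by (rule cInf_greatest[OF norm_set_nonempty]) auto

lemma norm_lessD:
  assumes x: "x \<in> X" and less: "N x < t"
  shows "0 < t" "(\<Sum>n. F (\<bar>x n\<bar> / t)) \<le> 1"
proof -
  obtain s where s: "0 < s" "summable (\<lambda>n. F (\<bar>x n\<bar> / s))" "(\<Sum>n. F (\<bar>x n\<bar> / s)) \<le> 1" "s < t"
    using cInf_lessD[OF norm_set_nonempty[OF x] less[unfolded orlicz_norm_def]] by auto
  show t: "0 < t" using s by simp
  have "\<bar>x n\<bar> / t \<le> \<bar>x n\<bar> / s" for n using s t by (intro divide_left_mono) auto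
  then have "(\<Sum>n. F (\<bar>x n\<bar> / t)) \<le> (\<Sum>n. F (\<bar>x n\<bar> / s))"
    using t s by (intro suminf_le summable_modular[OF x] F_mono) auto
  with s show "(\<Sum>n. F (\<bar>x n\<bar> / t)) \<le> 1" by simp
qed

lemma norm_le_of_less: "(\<And>t. N x < t \<Longrightarrow> a \<le> t) \<Longrightarrow> a \<le> N x"
  by (rule dense_ge) auto

lemma modular_finite_le_1:
  assumes x: "x \<in> X" and less: "N x < t" and S: "finite S"
  shows "(\<Sum>n\<in>S. F (\<bar>x n\<bar> / t)) \<le> 1"
proof -
  have "0 < t" using norm_lessD[OF x less] by simp
  then have "(\<Sum>n\<in>S. F (\<bar>x n\<bar> / t)) \<le> (\<Sum>n. F (\<bar>x n\<bar> / t))"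
    using S by (intro sum_le_suminf summable_modular[OF x]) (auto intro: F_nonneg)
  also have "\<dots> \<le> 1" using norm_lessD[OF x less] by simp
  finally show ?thesis .
qed

lemma finite_support_in_X:
  assumes "finite S" "\<And>i. i \<notin> S \<Longrightarrow> x i = 0"
  shows "x \<in> X"
  by (rule in_XI[of 1]) (use assms F_zero in \<open>auto intro!: summable_finite[of S]\<close>)

lemma finite_support_norm_le:
  assumes S: "finite S" "\<And>i. i \<notin> S \<Longrightarrow> x i = 0" and t: "0 < t" and le: "(\<Sum>i\<in>S. F (\<bar>x i\<bar> / t)) \<le> 1"
  shows "N x \<le> t"
proof -
  have "(\<Sum>n. F (\<bar>x n\<bar> / t)) = (\<Sum>i\<in>S. F (\<bar>x i\<bar> / t))"
    using S F_zero by (intro suminf_finite) auto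
  then show ?thesis using le t finite_support_in_X[OF S]
    by (intro norm_leI summable_modular) auto
qed

lemma lattice_in_X:
  assumes x: "x \<in> X" and le: "\<And>i. \<bar>z i\<bar> \<le> \<bar>x i\<bar>"
  shows "z \<in> X"
proof (rule in_XI[of 1])
  show "summable (\<lambda>n. F (\<bar>z n\<bar> / 1))"
    using F_nonneg F_mono le
    by (intro summable_comparison_test'[OF summable_modular[OF x, of 1], of 0]) auto
qed simp

lemma lattice_norm:
  assumes x: "x \<in> X" and le: "\<And>i. \<bar>z i\<bar> \<le> \<bar>x i\<bar>"
  shows "N z \<le> N x"
proof (rule norm_le_of_less)
  fix t assume t: "N x < t"
  have z: "z \<in> X" using assms by (rule lattice_in_X)
  have t0: "0 < t" using norm_lessD[OF x t] by simp
  have "(\<Sum>n. F (\<bar>z n\<bar> / t)) \<le> (\<Sum>n. F (\<bar>x n\<bar> / t))"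
    using le t0 by (intro suminf_le summable_modular z x F_mono) (auto intro: divide_right_mono)
  also have "\<dots> \<le> 1" using norm_lessD[OF x t] by simp
  finally show "N z \<le> t" using t0 z by (intro norm_leI summable_modular)
qed

lemma norm_scale_le: assumes x: "x \<in> X" shows "r *\<^sub>R x \<in> X \<and> N (r *\<^sub>R x) \<le> \<bar>r\<bar> * N x"
proof (cases "r = 0")
  case True
  have "N (\<lambda>_. 0) \<le> t" if "t > 0" for t
    using that by (intro finite_support_norm_le[of "{}"]) auto
  then have "N (\<lambda>_. 0) \<le> 0" by (rule dense_ge)
  then show ?thesis using True finite_support_in_X[of "{}" "\<lambda>_. 0"] by (simp add: zero_fun_def)
next
  case False
  have eq: "\<bar>(r *\<^sub>R x) n\<bar> / (\<bar>r\<bar> * t) = \<bar>x n\<bar> / t" for n t using False by (simp add: abs_mult)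
  have "r *\<^sub>R x \<in> X" 
    by (rule in_XI[of "\<bar>r\<bar> * 1"]) (use False eq[of _ 1] summable_modular[OF x, of 1] in simp_all)
  moreover have "N (r *\<^sub>R x) / \<bar>r\<bar> \<le> N x"
  proof (rule norm_le_of_less)
    fix t assume t: "N x < t"
    have "N (r *\<^sub>R x) \<le> \<bar>r\<bar> * t"
      by (rule norm_leI)
        (use False norm_lessD[OF x t] summable_modular[OF x, of t] in \<open>simp_all only: eq\<close>, simp)
    then show "N (r *\<^sub>R x) / \<bar>r\<bar> \<le> t" using False by (simp add: field_simps)
  qed
  ultimately show ?thesis using False by (simp add: field_simps)
qed

lemma norm_scale: assumes x: "x \<in> X" shows "N (r *\<^sub>R x) = \<bar>r\<bar> * N x"
proof (cases "r = 0")
  case True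
  then show ?thesis using norm_scale_le[OF x, of 0] norm_nonneg[of "0 *\<^sub>R x"] by simp
next
  case False
  have "N x \<le> \<bar>1 / r\<bar> * N (r *\<^sub>R x)"
    using norm_scale_le[of "r *\<^sub>R x" "1 / r"] norm_scale_le[OF x, of r] False by simp
  then have "\<bar>r\<bar> * N x \<le> N (r *\<^sub>R x)" using False by (simp add: field_simps)
  then show ?thesis using norm_scale_le[OF x, of r] by simp
qed

lemma norm_add:
  assumes x: "x \<in> X" and z: "z \<in> X"
  shows "x + z \<in> X \<and> N (x + z) \<le> N x + N z"
proof -
  have sub: "summable (\<lambda>n. F (\<bar>(x + z) n\<bar> / (s + t))) \<and> (\<Sum>n. F (\<bar>(x + z) n\<bar> / (s + t)))
      \<le> s / (s + t) * (\<Sum>n. F (\<bar>x n\<bar> / s)) + t / (s + t) * (\<Sum>n. F (\<bar>z n\<bar> / t))"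
    if s: "0 < s" and t: "0 < t" for s t
  proof -
    let ?g = "\<lambda>n. s / (s + t) * F (\<bar>x n\<bar> / s) + t / (s + t) * F (\<bar>z n\<bar> / t)"
    have pt: "F (\<bar>(x + z) n\<bar> / (s + t)) \<le> ?g n" for n
    proof -
      have "F (\<bar>(x + z) n\<bar> / (s + t)) \<le> F ((\<bar>x n\<bar> + \<bar>z n\<bar>) / (s + t))"
        using s t by (intro F_mono divide_right_mono) auto
      also have "\<dots> \<le> ?g n" using s t by (intro F_convex_comb) auto
      finally show ?thesis .
    qed
    have sm: "summable (\<lambda>n. s / (s + t) * F (\<bar>x n\<bar> / s))" "summable (\<lambda>n. t / (s + t) * F (\<bar>z n\<bar> / t))"
      using s t by (auto intro!: summable_mult summable_modular x z)
    have sg: "summable ?g" using sm by (rule summable_add)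
    have 1: "summable (\<lambda>n. F (\<bar>(x + z) n\<bar> / (s + t)))"
      using pt s t F_nonneg by (intro summable_comparison_test'[OF sg, of 0]) (auto simp: F_nonneg)
    have "(\<Sum>n. F (\<bar>(x + z) n\<bar> / (s + t))) \<le> suminf ?g" using pt 1 sg by (rule suminf_le)
    also have "\<dots> = s / (s + t) * (\<Sum>n. F (\<bar>x n\<bar> / s)) + t / (s + t) * (\<Sum>n. F (\<bar>z n\<bar> / t))"
      unfolding suminf_add[OF sm, symmetric]
      by (simp only: suminf_mult[OF summable_modular[OF x s]] suminf_mult[OF summable_modular[OF z t]])
    finally show ?thesis using 1 by simp
  qed
  have mem: "x + z \<in> X" using sub[of 1 1] by (intro in_XI[of "1 + 1"]) auto
  have "N (x + z) - N z \<le> N x"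
  proof (rule norm_le_of_less)
    fix s assume s: "N x < s"
    have "N (x + z) - s \<le> N z"
    proof (rule norm_le_of_less)
      fix t assume t: "N z < t"
      have pos: "0 < s" "0 < t" using norm_lessD[OF x s] norm_lessD[OF z t] by auto
      have "(\<Sum>n. F (\<bar>(x + z) n\<bar> / (s + t))) \<le> s / (s + t) * 1 + t / (s + t) * 1"
        using sub[OF pos] norm_lessD(2)[OF x s] norm_lessD(2)[OF z t] pos
        by (elim conjE order.trans) (intro add_mono mult_left_mono; simp)
      also have "\<dots> = 1" using pos by (simp add: add_divide_distrib[symmetric])
      finally have "N (x + z) \<le> s + t" using sub[OF pos] pos by (intro norm_leI) auto
      then show "N (x + z) - s \<le> t" by simp
    qed
    then show "N (x + z) - N z \<le> s" by simp
  qed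
  with mem show ?thesis by simp
qed

sublocale seminormed_space X N
proof
  have "0 \<in> X" using finite_support_in_X[of "{}" 0] by simp
  then show "subspace X" using norm_add norm_scale_le by (simp add: subspace_def)
qed (use norm_nonneg norm_add norm_scale in auto)

lemma coordinate_le: assumes x: "x \<in> X" shows "\<bar>x i\<bar> \<le> N x"
proof (rule norm_le_of_less)
  fix t assume t: "N x < t"
  have "F (\<bar>x i\<bar> / t) \<le> 1" using modular_finite_le_1[OF x t, of "{i}"] by simp
  moreover have "0 < t" using norm_lessD[OF x t] by simp
  ultimately show "\<bar>x i\<bar> \<le> t" using F_le_1[of "\<bar>x i\<bar> / t"] by simp
qed

lemma unit_vec_in [simp]: "unit_vec n \<in> X"
  by (rule finite_support_in_X[of "{n}"]) (auto simp: unit_vec_def)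

lemma norm_unit_vec: "N (unit_vec n) = 1"
proof (rule antisym)
  show "N (unit_vec n) \<le> 1"
    by (rule finite_support_norm_le[of "{n}"]) (auto simp: unit_vec_def F_one)
  show "1 \<le> N (unit_vec n)" using coordinate_le[OF unit_vec_in, of n n] by (simp add: unit_vec_def)
qed

lemma restrict_in [simp]: "x \<in> X \<Longrightarrow> restrict_to D x \<in> X"
  by (rule lattice_in_X[of x]) (auto simp: restrict_to_def)

lemma norm_restrict_le_card:
  assumes "x \<in> X" "finite D" "\<And>i. i \<in> D \<Longrightarrow> \<bar>x i\<bar> \<le> \<tau>"
  shows "N (restrict_to D x) \<le> real (card D) * \<tau>"
proof -
  have "N (restrict_to D x) \<le> (\<Sum>i\<in>D. N (x i *\<^sub>R unit_vec i))"
    using assms(2) by (simp only: restrict_to_eq_sum) (intro N_sum V_scale unit_vec_in)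
  also have "\<dots> \<le> (\<Sum>i\<in>D. \<tau>)" using assms(3) by (intro sum_mono) (simp add: N_scale norm_unit_vec)
  finally show ?thesis by simp
qed

lemma norm_tail_tendsto_0:
  assumes x: "x \<in> X"
  shows "(\<lambda>m. N (restrict_to {m..} x)) \<longlonglongrightarrow> 0"
proof (rule order_tendstoI)
  fix a :: real assume "a < 0"
  then show "\<forall>\<^sub>F m in sequentially. a < N (restrict_to {m..} x)"
    using x by (intro always_eventually allI) (use norm_nonneg[OF restrict_in[OF x]] in \<open>auto intro: less_le_trans\<close>)
next
  fix a :: real assume a: "0 < a"
  have sm: "summable (\<lambda>n. F (\<bar>x n\<bar> / (a / 2)))" using x a by (intro summable_modular) auto
  have "(\<lambda>m. \<Sum>n. F (\<bar>x (n + m)\<bar> / (a / 2))) \<longlonglongrightarrow> 0"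
    using suminf_exist_split2[OF sm] .
  then have "\<forall>\<^sub>F m in sequentially. (\<Sum>n. F (\<bar>x (n + m)\<bar> / (a / 2))) < 1"
    by (rule order_tendstoD) simp
  then show "\<forall>\<^sub>F m in sequentially. N (restrict_to {m..} x) < a"
  proof eventually_elim
    case (elim m)
    have sm': "summable (\<lambda>n. F (\<bar>restrict_to {m..} x n\<bar> / (a / 2)))"
      using x a by (intro summable_modular restrict_in) auto
    have "(\<Sum>n. F (\<bar>restrict_to {m..} x n\<bar> / (a / 2)))
      = (\<Sum>n. F (\<bar>x (n + m)\<bar> / (a / 2))) + (\<Sum>n<m. F (\<bar>restrict_to {m..} x n\<bar> / (a / 2)))"
      using suminf_split_initial_segment[OF sm', of m] by (simp add: restrict_to_def)
    also have "(\<Sum>n<m. F (\<bar>restrict_to {m..} x n\<bar> / (a / 2))) = 0"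
      by (intro sum.neutral) (auto simp: restrict_to_def F_zero)
    finally have "N (restrict_to {m..} x) \<le> a / 2"
      using elim a sm' by (intro norm_leI) auto
    then show ?case using a by simp
  qed
qed

lemma partial_sum_unit_vec: "x - (\<Sum>n<m. x n *\<^sub>R unit_vec n) = restrict_to {m..} x"
  by (rule ext) (simp add: unit_vec_comb_apply_id restrict_to_def)

lemma unit_vec_expansion: "x \<in> X \<Longrightarrow> (\<lambda>m. N (x - (\<Sum>n<m. x n *\<^sub>R unit_vec n))) \<longlonglongrightarrow> 0"
  unfolding partial_sum_unit_vec by (rule norm_tail_tendsto_0)

lemma unit_vec_sum_in [simp]: "(\<Sum>i\<in>I. c i *\<^sub>R unit_vec (\<mu> i)) \<in> X"
  by (intro V_sum V_scale unit_vec_in)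

text \<open>The modular of both combinations at scale \<open>t\<close> is the sum of the \<open>F (\<bar>c i\<bar> / t)\<close>.\<close>

lemma symmetric_le:
  assumes I: "finite I" "inj_on \<mu> I" "inj_on \<nu> I"
  shows "N (\<Sum>i\<in>I. c i *\<^sub>R unit_vec (\<mu> i)) \<le> N (\<Sum>i\<in>I. c i *\<^sub>R unit_vec (\<nu> i))"
proof (rule norm_le_of_less)
  fix t assume t: "N (\<Sum>i\<in>I. c i *\<^sub>R unit_vec (\<nu> i)) < t"
  have re: "(\<Sum>k\<in>\<pi> ` I. F (\<bar>(\<Sum>i\<in>I. c i *\<^sub>R unit_vec (\<pi> i)) k\<bar> / t)) = (\<Sum>i\<in>I. F (\<bar>c i\<bar> / t))"
    if "inj_on \<pi> I" for \<pi>
    using that I(1) by (simp add: sum.reindex unit_vec_comb_apply)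
  have "(\<Sum>i\<in>I. F (\<bar>c i\<bar> / t)) \<le> 1"
    using modular_finite_le_1[OF unit_vec_sum_in t, of "\<nu> ` I"] I re[OF I(3)] by simp
  then show "N (\<Sum>i\<in>I. c i *\<^sub>R unit_vec (\<mu> i)) \<le> t"
    using I re[OF I(2)] norm_lessD(1)[OF unit_vec_sum_in t]
    by (intro finite_support_norm_le[of "\<mu> ` I"]) (auto intro: unit_vec_comb_apply_0)
qed

lemma symmetric:
  "finite I \<Longrightarrow> inj_on \<mu> I \<Longrightarrow> inj_on \<nu> I \<Longrightarrow>
    N (\<Sum>i\<in>I. c i *\<^sub>R unit_vec (\<mu> i)) = N (\<Sum>i\<in>I. c i *\<^sub>R unit_vec (\<nu> i))"
  by (intro antisym symmetric_le)

lemma unit_vec_comb_mono: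
  assumes "finite I" "inj_on \<mu> I" "\<And>i. i \<in> I \<Longrightarrow> \<bar>c i\<bar> \<le> \<bar>d i\<bar>"
  shows "N (\<Sum>i\<in>I. c i *\<^sub>R unit_vec (\<mu> i)) \<le> N (\<Sum>i\<in>I. d i *\<^sub>R unit_vec (\<mu> i))"
proof (rule lattice_norm[OF unit_vec_sum_in])
  fix k show "\<bar>(\<Sum>i\<in>I. c i *\<^sub>R unit_vec (\<mu> i)) k\<bar> \<le> \<bar>(\<Sum>i\<in>I. d i *\<^sub>R unit_vec (\<mu> i)) k\<bar>"
    by (cases "k \<in> \<mu> ` I") (use assms in \<open>auto simp: unit_vec_comb_apply unit_vec_comb_apply_0\<close>)
qed

text \<open>This is where the Orlicz space differs from \<open>\<ell>\<^sub>1\<close>.\<close>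

lemma fundamental_function_sublinear:
  assumes "0 < \<epsilon>"
  shows "\<exists>h. \<forall>B. finite B \<and> h \<le> card B \<longrightarrow> N (\<Sum>j\<in>B. unit_vec j) \<le> \<epsilon> * real (card B)"
proof -
  obtain \<tau> where tau: "\<tau> > 0" "\<And>s. 0 \<le> s \<Longrightarrow> s \<le> \<tau> \<Longrightarrow> F s \<le> \<epsilon> * s"
    using F_sublinear[OF assms] by auto
  obtain h :: nat where h: "1 / (\<epsilon> * \<tau>) < h" using reals_Archimedean2 by blast
  have h0: "0 < real h" using h assms tau by (smt (verit) divide_pos_pos mult_pos_pos)
  have "N (\<Sum>j\<in>B. unit_vec j) \<le> \<epsilon> * real (card B)" if B: "finite B" "h \<le> card B" for B
  proof -
    have c: "0 < real (card B)" "1 / (\<epsilon> * \<tau>) < real (card B)" using h0 h B by auto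
    have "1 / (\<epsilon> * real (card B)) \<le> \<tau>" using c assms tau by (simp add: field_simps)
    then have "F (1 / (\<epsilon> * real (card B))) \<le> \<epsilon> * (1 / (\<epsilon> * real (card B)))" using c assms by (intro tau(2)) auto
    then have F1: "F (1 / (\<epsilon> * real (card B))) \<le> 1 / real (card B)" using assms by simp
    have ap: "(\<Sum>j\<in>B. unit_vec j) k = (if k \<in> B then 1 else 0)" for k
      using unit_vec_comb_apply_id[OF B(1), of "\<lambda>_. 1" k] by simp
    have "(\<Sum>i\<in>B. F (\<bar>(\<Sum>j\<in>B. unit_vec j) i\<bar> / (\<epsilon> * real (card B)))) = real (card B) * F (1 / (\<epsilon> * real (card B)))"
      by (simp add: ap)
    also have "\<dots> \<le> 1" using F1 c by (simp add: field_simps)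
    finally show ?thesis using B c assms
      by (intro finite_support_norm_le[of B]) (auto simp: ap)
  qed
  then show ?thesis by blast
qed

text \<open>
  The factor \<open>4\<close> comes from evaluating the modular at twice the norm, where it is known to be at
  most \<open>1\<close>.
\<close>

lemma sum_square_le:
  assumes x: "x \<in> X" and S: "finite S"
  shows "(\<Sum>i\<in>S. (x i)\<^sup>2) \<le> 4 * \<gamma> * (N x)\<^sup>2"
proof (cases "N x = 0")
  case True
  then have "x i = 0" for i using coordinate_le[OF x, of i] by simp
  then show ?thesis by (simp add: True)
next
  case False
  then have pos: "0 < N x" using norm_nonneg[OF x] by simp
  have "(\<Sum>i\<in>S. (\<bar>x i\<bar> / (2 * N x))\<^sup>2) \<le> (\<Sum>i\<in>S. \<gamma> * F (\<bar>x i\<bar> / (2 * N x)))"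
    using pos coordinate_le[OF x] by (intro sum_mono square_le_F) (auto simp: field_simps intro: order.trans[of _ "N x"])
  also have "\<dots> \<le> \<gamma> * 1"
    using modular_finite_le_1[OF x _ S, of "2 * N x"] pos square_le_F[of 1] F_one
    unfolding sum_distrib_left[symmetric] by (intro mult_left_mono) auto
  finally show ?thesis using pos
    by (simp add: power_divide sum_divide_distrib[symmetric] power_mult_distrib field_simps)
qed

lemma large_coordinates:
  assumes x: "x \<in> X" and t: "0 < \<tau>"
  shows "finite {i. \<tau> \<le> \<bar>x i\<bar>}" "real (card {i. \<tau> \<le> \<bar>x i\<bar>}) * \<tau>\<^sup>2 \<le> 4 * \<gamma> * (N x)\<^sup>2"
proof -
  have le: "real (card S) * \<tau>\<^sup>2 \<le> 4 * \<gamma> * (N x)\<^sup>2" if S: "finite S" "S \<subseteq> {i. \<tau> \<le> \<bar>x i\<bar>}" for S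
  proof -
    have "(\<Sum>i\<in>S. \<tau>\<^sup>2) \<le> (\<Sum>i\<in>S. (x i)\<^sup>2)"
    proof (rule sum_mono)
      fix i assume "i \<in> S"
      then have "\<tau> \<le> \<bar>x i\<bar>" using S by auto
      then have "\<tau>\<^sup>2 \<le> \<bar>x i\<bar>\<^sup>2" using t by (intro power_mono) auto
      then show "\<tau>\<^sup>2 \<le> (x i)\<^sup>2" by simp
    qed
    with sum_square_le[OF x S(1)] show ?thesis by simp
  qed
  show fin: "finite {i. \<tau> \<le> \<bar>x i\<bar>}"
  proof (rule ccontr)
    assume inf: "infinite {i. \<tau> \<le> \<bar>x i\<bar>}"
    obtain m :: nat where m: "4 * \<gamma> * (N x)\<^sup>2 / \<tau>\<^sup>2 < m" using reals_Archimedean2 by blast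
    obtain S where "finite S" "card S = m" "S \<subseteq> {i. \<tau> \<le> \<bar>x i\<bar>}"
      using infinite_arbitrarily_large[OF inf] by blast
    with le[of S] m t show False by (simp add: field_simps)
  qed
  show "real (card {i. \<tau> \<le> \<bar>x i\<bar>}) * \<tau>\<^sup>2 \<le> 4 * \<gamma> * (N x)\<^sup>2" using fin by (rule le) simp
qed

lemma gamma_ge_1: "1 \<le> \<gamma>"
  using square_le_F[of 1] F_one by simp

text \<open>
  On small arguments the Orlicz function is linear up to the factor \<open>\<kappa>\<close>, so flat disjoint pieces of
  norm at least \<open>c\<close> add up as in \<open>\<ell>\<^sub>1\<close>. The vectors \<open>w k\<close> themselves may overlap: the pieces form
  the diagonal of the array of restrictions of \<open>w l\<close> to \<open>D k\<close>, and a bound for all signed sums of the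
  \<open>w k\<close> is inherited by the diagonal.
\<close>

lemma flat_pieces_lower_bound:
  assumes c: "0 < c" and n: "2 \<le> \<kappa> * real n"
  obtains \<tau> where "0 < \<tau>"
    and "\<And>w D R. (\<And>k. k < n \<Longrightarrow> w k \<in> X) \<Longrightarrow> (\<And>k. k < n \<Longrightarrow> finite (D k)) \<Longrightarrow>
      (\<And>k i. k < n \<Longrightarrow> i \<in> D k \<Longrightarrow> \<bar>w k i\<bar> \<le> \<tau>) \<Longrightarrow>
      (\<And>k. k < n \<Longrightarrow> c \<le> N (restrict_to (D k) (w k))) \<Longrightarrow>
      (\<And>k l. k < n \<Longrightarrow> l < n \<Longrightarrow> k \<noteq> l \<Longrightarrow> D k \<inter> D l = {}) \<Longrightarrow>
      (\<And>\<theta>. (\<forall>k. \<bar>\<theta> k\<bar> = 1) \<Longrightarrow> N (\<Sum>k<n. \<theta> k *\<^sub>R w k) \<le> R) \<Longrightarrow>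
      c * \<kappa> / 4 * real n \<le> R"
proof -
  \<comment> \<open>At scale \<open>c / 2\<close> each piece has modular at least \<open>1\<close>. Dividing further by \<open>h\<close> leaves at least
    \<open>\<kappa> / h = 2 / n\<close> of it, hence more than \<open>1\<close> in total.\<close>
  define h where "h = \<kappa> * real n / 2"
  have h: "1 \<le> h" using n by (simp add: h_def)
  obtain \<tau>' where tau': "\<tau>' > 0" "\<And>s. 0 \<le> s \<Longrightarrow> s \<le> \<tau>' \<Longrightarrow> \<kappa> * F s / h \<le> F (s / h)"
    using F_almost_linear[OF h] by auto
  define \<tau> where "\<tau> = \<tau>' * c / 2"
  have tau: "\<tau> > 0" using tau' c by (simp add: \<tau>_def)
  have key: "c * \<kappa> / 4 * real n \<le> R"
    if w: "\<And>k. k < n \<Longrightarrow> w k \<in> X" and D: "\<And>k. k < n \<Longrightarrow> finite (D k)"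
      and flat: "\<And>k i. k < n \<Longrightarrow> i \<in> D k \<Longrightarrow> \<bar>w k i\<bar> \<le> \<tau>"
      and big: "\<And>k. k < n \<Longrightarrow> c \<le> N (restrict_to (D k) (w k))"
      and dis: "\<And>k l. k < n \<Longrightarrow> l < n \<Longrightarrow> k \<noteq> l \<Longrightarrow> D k \<inter> D l = {}"
      and R: "\<And>\<theta>. (\<forall>k. \<bar>\<theta> k\<bar> = 1) \<Longrightarrow> N (\<Sum>k<n. \<theta> k *\<^sub>R w k) \<le> R" for w D R
  proof -
    define u where "u = (\<Sum>k<n. restrict_to (D k) (w k))"
    obtain \<theta> :: "nat \<Rightarrow> real" where th: "\<forall>k. \<bar>\<theta> k\<bar> = 1"
      and le: "N (0 + (\<Sum>k<n. restrict_to (D k) (w k)))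
        \<le> N (0 + (\<Sum>k<n. \<Sum>l<n. (\<theta> k * \<theta> l) *\<^sub>R restrict_to (D k) (w l)))"
      using sign_diagonal[of "{..<n}" "\<lambda>k l. restrict_to (D k) (w l)" 0] w by auto
    have uX: "u \<in> X" unfolding u_def using w by (intro V_sum restrict_in) auto
    have sX: "(\<Sum>k<n. \<theta> k *\<^sub>R w k) \<in> X" using w by (intro V_sum V_scale) auto
    have "N (\<Sum>k<n. \<Sum>l<n. (\<theta> k * \<theta> l) *\<^sub>R restrict_to (D k) (w l)) \<le> N (\<Sum>k<n. \<theta> k *\<^sub>R w k)"
    proof (rule lattice_norm[OF sX])
      fix i
      have eq: "(\<Sum>k<n. \<Sum>l<n. (\<theta> k * \<theta> l) *\<^sub>R restrict_to (D k) (w l)) i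
        = (\<Sum>k<n. (if i \<in> D k then \<theta> k else 0) * (\<Sum>l<n. \<theta> l *\<^sub>R w l) i)"
        unfolding sum_fun_apply sum_distrib_left
        by (intro sum.cong) (auto simp: restrict_to_def)
      show "\<bar>(\<Sum>k<n. \<Sum>l<n. (\<theta> k * \<theta> l) *\<^sub>R restrict_to (D k) (w l)) i\<bar> \<le> \<bar>(\<Sum>k<n. \<theta> k *\<^sub>R w k) i\<bar>"
      proof (cases "\<exists>k0<n. i \<in> D k0")
        case True
        then obtain k0 where k0: "k0 < n" "i \<in> D k0" by blast
        have "(\<Sum>k<n. (if i \<in> D k then \<theta> k else 0) * t) = (\<Sum>k<n. if k = k0 then \<theta> k0 * t else 0)" for t
          using k0 dis by (intro sum.cong) auto
        then show ?thesis unfolding eq using k0 th by (simp add: abs_mult)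
      next
        case False
        then have "(\<Sum>k<n. (if i \<in> D k then \<theta> k else 0) * t) = 0" for t
          by (intro sum.neutral) auto
        then show ?thesis unfolding eq by simp
      qed
    qed
    with le R[OF th] have uR: "N u \<le> R" by (simp add: u_def)
    have un: "u i = w k i" if "k < n" "i \<in> D k" for k i
    proof -
      have "u i = (\<Sum>l<n. if l = k then w k i else 0)"
        unfolding u_def sum_fun_apply using that dis by (intro sum.cong) (auto simp: restrict_to_def)
      then show ?thesis using that by simp
    qed
    have piece: "1 \<le> (\<Sum>i\<in>D k. F (\<bar>w k i\<bar> / (c / 2)))" if k: "k < n" for k
    proof (rule ccontr)
      assume "\<not> 1 \<le> (\<Sum>i\<in>D k. F (\<bar>w k i\<bar> / (c / 2)))"
      moreover have "(\<Sum>i\<in>D k. F (\<bar>w k i\<bar> / (c / 2))) = (\<Sum>i\<in>D k. F (\<bar>restrict_to (D k) (w k) i\<bar> / (c / 2)))"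
        by (intro sum.cong) (auto simp: restrict_to_def)
      ultimately have "N (restrict_to (D k) (w k)) \<le> c / 2"
        using D[OF k] c by (intro finite_support_norm_le[of "D k"]) (auto simp: restrict_to_def)
      with big[OF k] c show False by simp
    qed
    have spread: "2 / real n \<le> (\<Sum>i\<in>D k. F (\<bar>u i\<bar> / (c / 2 * h)))" if k: "k < n" for k
    proof -
      have "\<kappa> / h * 1 \<le> \<kappa> / h * (\<Sum>i\<in>D k. F (\<bar>w k i\<bar> / (c / 2)))"
        using piece[OF k] kappa_pos h by (intro mult_left_mono) auto
      also have "\<dots> = (\<Sum>i\<in>D k. \<kappa> * F (\<bar>w k i\<bar> / (c / 2)) / h)"
        by (simp add: sum_distrib_left)
      also have "\<dots> \<le> (\<Sum>i\<in>D k. F (\<bar>w k i\<bar> / (c / 2) / h))"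
        using flat[OF k] c by (intro sum_mono tau'(2)) (auto simp: \<tau>_def field_simps)
      also have "\<dots> = (\<Sum>i\<in>D k. F (\<bar>u i\<bar> / (c / 2 * h)))"
        using un[OF k] by (intro sum.cong) auto
      finally show ?thesis using kappa_pos n by (simp add: h_def field_simps)
    qed
    have npos: "0 < n" using n by (cases n) auto
    have two: "2 \<le> (\<Sum>i\<in>(\<Union>k<n. D k). F (\<bar>u i\<bar> / (c / 2 * h)))"
    proof -
      have "2 = (\<Sum>k<n. 2 / real n)" using npos by simp
      also have "\<dots> \<le> (\<Sum>k<n. \<Sum>i\<in>D k. F (\<bar>u i\<bar> / (c / 2 * h)))" using spread by (intro sum_mono) auto
      also have "\<dots> = (\<Sum>i\<in>(\<Union>k<n. D k). F (\<bar>u i\<bar> / (c / 2 * h)))"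
        using D dis by (intro sum.UNION_disjoint[symmetric]) auto
      finally show ?thesis .
    qed
    have "c / 2 * h \<le> N u"
    proof (rule ccontr)
      assume "\<not> c / 2 * h \<le> N u"
      then have "(\<Sum>i\<in>(\<Union>k<n. D k). F (\<bar>u i\<bar> / (c / 2 * h))) \<le> 1"
        using D by (intro modular_finite_le_1[OF uX]) auto
      with two show False by simp
    qed
    with uR show ?thesis by (simp add: h_def)
  qed
  show thesis by (rule that[OF tau key])
qed

end

section \<open>The unit vectors form a greedy basis\<close>

context near_linear_orlicz
begin

lemma unit_vec_expansion_unique:
  assumes x: "x \<in> X" and c: "basis_expansion N unit_vec x c"
  shows "c = x"
proof
  fix k
  have le: "\<bar>x k - c k\<bar> \<le> N (x - (\<Sum>n<m. c n *\<^sub>R unit_vec n))" if "k < m" for m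
  proof -
    have "x - (\<Sum>n<m. c n *\<^sub>R unit_vec n) \<in> X" using x unit_vec_sum_in[of c "\<lambda>n. n"] by (intro V_diff)
    from coordinate_le[OF this, of k] show ?thesis using that by (simp add: unit_vec_comb_apply_id)
  qed
  have "\<bar>x k - c k\<bar> \<le> 0"
    using c unfolding basis_expansion_def
    by (rule tendsto_lowerbound) (use le in \<open>auto simp: eventually_sequentially intro!: exI[of _ "Suc k"]\<close>)
  then show "c k = x k" by simp
qed

lemma unit_vec_expansion_iff: "x \<in> X \<Longrightarrow> basis_expansion N unit_vec x c \<longleftrightarrow> c = x"
  using unit_vec_expansion_unique unit_vec_expansion by (auto simp: basis_expansion_def)

lemma basis_coeff_unit_vec: "x \<in> X \<Longrightarrow> basis_coeff N unit_vec n x = x n"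
  by (simp add: basis_coeff_def unit_vec_expansion_iff)

lemma schauder_basis_unit_vec: "schauder_basis X N unit_vec"
  by (simp add: schauder_basis_def unit_vec_expansion_iff)

lemma semi_normalized_unit_vec: "semi_normalized N unit_vec"
  by (simp add: semi_normalized_def norm_unit_vec)

text \<open>
  A competitor on \<open>A\<close> leaves the coordinates outside \<open>A\<close> unchanged. The coordinates in \<open>A\<close> missed by
  the greedy set are outweighed by as many coordinates of the greedy set outside \<open>A\<close>.
\<close>

lemma unit_vec_greedy_competitor:
  assumes v: "v \<in> X" and L: "finite \<Lambda>" and A: "finite A" "card A = card \<Lambda>"
    and gr: "\<And>n m. n \<in> \<Lambda> \<Longrightarrow> m \<notin> \<Lambda> \<Longrightarrow> \<bar>v m\<bar> \<le> \<bar>v n\<bar>"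
  shows "N (v - (\<Sum>n\<in>\<Lambda>. v n *\<^sub>R unit_vec n)) \<le> 2 * N (v - (\<Sum>n\<in>A. \<alpha> n *\<^sub>R unit_vec n))"
proof -
  define w where "w = v - (\<Sum>n\<in>A. \<alpha> n *\<^sub>R unit_vec n)"
  have wX: "w \<in> X" unfolding w_def using v unit_vec_sum_in[of \<alpha> "\<lambda>n. n"] by (intro V_diff)
  have wv: "w i = v i" if "i \<notin> A" for i using that A by (simp add: w_def unit_vec_comb_apply_id)
  have eq: "v - (\<Sum>n\<in>\<Lambda>. v n *\<^sub>R unit_vec n) = restrict_to (- (\<Lambda> \<union> A)) v + restrict_to (A - \<Lambda>) v"
    by (rule ext) (use L in \<open>auto simp: unit_vec_comb_apply_id restrict_to_def\<close>)
  have 1: "N (restrict_to (- (\<Lambda> \<union> A)) v) \<le> N w"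
    by (rule lattice_norm[OF wX]) (use wv in \<open>auto simp: restrict_to_def\<close>)
  have "card (A - \<Lambda>) = card (\<Lambda> - A)"
    using card_le_sym_Diff[of A \<Lambda>] card_le_sym_Diff[of \<Lambda> A] A L by simp
  then obtain \<pi> where pi: "bij_betw \<pi> (A - \<Lambda>) (\<Lambda> - A)"
    using finite_same_card_bij[of "A - \<Lambda>" "\<Lambda> - A"] A L by auto
  have inj: "inj_on \<pi> (A - \<Lambda>)" and img: "\<And>i. i \<in> A - \<Lambda> \<Longrightarrow> \<pi> i \<in> \<Lambda> - A"
    using pi by (auto simp: bij_betw_def)
  have fin: "finite (A - \<Lambda>)" using A by simp
  have "N (restrict_to (A - \<Lambda>) v) = N (\<Sum>i\<in>A - \<Lambda>. v i *\<^sub>R unit_vec i)"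
    using fin by (simp only: restrict_to_eq_sum)
  also have "\<dots> \<le> N (\<Sum>i\<in>A - \<Lambda>. v (\<pi> i) *\<^sub>R unit_vec i)"
    using fin by (rule unit_vec_comb_mono) (use gr img in auto)
  also have "\<dots> = N (\<Sum>i\<in>A - \<Lambda>. v (\<pi> i) *\<^sub>R unit_vec (\<pi> i))"
    using fin inj by (intro symmetric) auto
  also have "\<dots> \<le> N w"
  proof (rule lattice_norm[OF wX])
    fix k
    show "\<bar>(\<Sum>i\<in>A - \<Lambda>. v (\<pi> i) *\<^sub>R unit_vec (\<pi> i)) k\<bar> \<le> \<bar>w k\<bar>"
    proof (cases "k \<in> \<pi> ` (A - \<Lambda>)")
      case True
      then obtain i where i: "i \<in> A - \<Lambda>" "k = \<pi> i" by blast
      then show ?thesis using unit_vec_comb_apply[OF fin inj i(1), of "\<lambda>i. v (\<pi> i)"] wv[of k] img[of i] by simp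
    qed (simp add: unit_vec_comb_apply_0)
  qed
  finally have 2: "N (restrict_to (A - \<Lambda>) v) \<le> N w" .
  have "N (v - (\<Sum>n\<in>\<Lambda>. v n *\<^sub>R unit_vec n)) \<le> N (restrict_to (- (\<Lambda> \<union> A)) v) + N (restrict_to (A - \<Lambda>) v)"
    unfolding eq using v by (intro N_triangle restrict_in)
  with 1 2 show ?thesis by (simp add: w_def)
qed

lemma greedy_basis_unit_vec: "greedy_basis X N unit_vec"
  unfolding greedy_basis_def
proof (intro conjI schauder_basis_unit_vec exI[of _ 2] ballI allI impI)
  fix v k \<Lambda>
  assume v: "v \<in> X" and "finite \<Lambda> \<and> card \<Lambda> = k \<and> (\<forall>n\<in>\<Lambda>. \<forall>m. m \<notin> \<Lambda> \<longrightarrow>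
    \<bar>basis_coeff N unit_vec m v\<bar> \<le> \<bar>basis_coeff N unit_vec n v\<bar>)"
  then have L: "finite \<Lambda>" "card \<Lambda> = k" and gr: "\<And>n m. n \<in> \<Lambda> \<Longrightarrow> m \<notin> \<Lambda> \<Longrightarrow> \<bar>v m\<bar> \<le> \<bar>v n\<bar>"
    by (auto simp: basis_coeff_unit_vec[OF v])
  have "N (v - (\<Sum>n\<in>\<Lambda>. v n *\<^sub>R unit_vec n)) / 2 \<le> best_approx_error N unit_vec k v"
    unfolding best_approx_error_def
  proof (rule cInf_greatest)
    show "{N (v - (\<Sum>n\<in>A. \<alpha> n *\<^sub>R unit_vec n)) |A \<alpha>. finite A \<and> card A = k} \<noteq> {}" using L by blast
    fix x assume "x \<in> {N (v - (\<Sum>n\<in>A. \<alpha> n *\<^sub>R unit_vec n)) |A \<alpha>. finite A \<and> card A = k}"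
    then obtain A \<alpha> where "x = N (v - (\<Sum>n\<in>A. \<alpha> n *\<^sub>R unit_vec n))" "finite A" "card A = k" by blast
    then show "N (v - (\<Sum>n\<in>\<Lambda>. v n *\<^sub>R unit_vec n)) / 2 \<le> x"
      using unit_vec_greedy_competitor[OF v L(1), of A \<alpha>] gr L(2) by simp
  qed
  then show "N (v - (\<Sum>n\<in>\<Lambda>. basis_coeff N unit_vec n v *\<^sub>R unit_vec n)) \<le> 2 * best_approx_error N unit_vec k v"
    by (simp add: basis_coeff_unit_vec[OF v])
qed

end

section \<open>Two unconditional bases with large common entries\<close>

locale near_linear_orlicz_basis =
  near_linear_orlicz F \<kappa> \<gamma> + unconditional_democratic_basis "orlicz_space F" "orlicz_norm F" y f K
  for F :: "real \<Rightarrow> real" and \<kappa> \<gamma> :: real and y :: "nat \<Rightarrow> nat \<Rightarrow> real"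
    and f :: "nat \<Rightarrow> (nat \<Rightarrow> real) \<Rightarrow> real" and K :: real
begin

lemma entry_y_le: "\<bar>y n i\<bar> \<le> K"
  using coordinate_le[OF y_in] y_le by (rule order.trans)

lemma entry_f_le: "\<bar>f n (unit_vec j)\<bar> \<le> K"
  using f_le[of "unit_vec j" n] by (simp add: norm_unit_vec)

text \<open>Signs make all contributions to the coordinate \<open>i\<close> of a partial expansion of \<open>x\<close> nonnegative.\<close>

lemma coordinate_abs_sum_le:
  assumes x: "x \<in> X" and A: "finite A"
  shows "(\<Sum>n\<in>A. \<bar>f n x * y n i\<bar>) \<le> K * N x"
proof -
  define v where "v = (\<Sum>n\<in>A. (sgn (f n x * y n i) * f n x) *\<^sub>R y n)"
  have vX: "v \<in> X" unfolding v_def by (rule comb_in)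
  have "v i = (\<Sum>n\<in>A. \<bar>f n x * y n i\<bar>)"
    unfolding v_def sum_fun_apply by (intro sum.cong) (auto simp: abs_sgn mult_ac)
  then have "(\<Sum>n\<in>A. \<bar>f n x * y n i\<bar>) \<le> N v" using coordinate_le[OF vX, of i] by linarith
  also have "\<dots> \<le> K * N x" unfolding v_def using x A by (rule multiplier) (simp add: abs_sgn_eq)
  finally show ?thesis .
qed

text \<open>
  The vectors \<open>f (\<nu> k) (unit_vec (\<mu> l)) *\<^sub>R y (\<nu> k)\<close> form an array whose rows and columns may be
  multiplied by signs at bounded cost, as \<open>y\<close> and the unit vectors are unconditional. Hence its
  diagonal is controlled by the whole array, which represents the identity.
\<close>

lemma dominated_if_large_coefficients:
  assumes I: "finite I" "inj_on \<nu> I" "inj_on \<mu> I" and d: "0 < \<delta>"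
    and large: "\<And>i. i \<in> I \<Longrightarrow> \<delta> \<le> \<bar>f (\<nu> i) (unit_vec (\<mu> i))\<bar>"
  shows "N (\<Sum>i\<in>I. c i *\<^sub>R y (\<nu> i)) \<le> K\<^sup>2 / \<delta> * N (\<Sum>i\<in>I. c i *\<^sub>R unit_vec (\<mu> i))"
proof -
  let ?b = "\<lambda>k l. f (\<nu> k) (unit_vec (\<mu> l))"
  obtain \<theta> :: "_ \<Rightarrow> real" where th: "\<forall>k. \<bar>\<theta> k\<bar> = 1"
    and le: "N (0 + (\<Sum>k\<in>I. (c k * ?b k k) *\<^sub>R y (\<nu> k)))
      \<le> N (0 + (\<Sum>k\<in>I. \<Sum>l\<in>I. (\<theta> k * \<theta> l) *\<^sub>R ((c l * ?b k l) *\<^sub>R y (\<nu> k))))"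
    using sign_diagonal[OF I(1), of "\<lambda>k l. (c l * ?b k l) *\<^sub>R y (\<nu> k)" 0] by auto
  define g where "g = (\<Sum>l\<in>I. (\<theta> l * c l) *\<^sub>R unit_vec (\<mu> l))"
  have gX: "g \<in> X" unfolding g_def by (rule unit_vec_sum_in)
  have fg: "f n g = (\<Sum>l\<in>I. \<theta> l * c l * f n (unit_vec (\<mu> l)))" for n
    unfolding g_def by (subst f_sum) (auto simp: f_scale)
  have "(\<Sum>k\<in>I. \<Sum>l\<in>I. (\<theta> k * \<theta> l) *\<^sub>R ((c l * ?b k l) *\<^sub>R y (\<nu> k)))
      = (\<Sum>k\<in>I. (\<theta> k * f (\<nu> k) g) *\<^sub>R y (\<nu> k))"
    unfolding fg sum_distrib_left scaleR_sum_left by (simp add: mult_ac)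
  then have "N (\<Sum>k\<in>I. (c k * ?b k k) *\<^sub>R y (\<nu> k)) \<le> N (\<Sum>k\<in>I. (\<theta> k * f (\<nu> k) g) *\<^sub>R y (\<nu> k))"
    using le by simp
  also have "\<dots> \<le> K * N g" using th I by (intro multiplier_indexed gX) auto
  also have "N g \<le> N (\<Sum>l\<in>I. c l *\<^sub>R unit_vec (\<mu> l))"
    unfolding g_def using I th by (intro unit_vec_comb_mono) (auto simp: abs_mult)
  finally have up: "N (\<Sum>k\<in>I. (c k * ?b k k) *\<^sub>R y (\<nu> k)) \<le> K * N (\<Sum>l\<in>I. c l *\<^sub>R unit_vec (\<mu> l))"
    using K_pos by simp
  have "\<delta> * N (\<Sum>i\<in>I. c i *\<^sub>R y (\<nu> i)) = N (\<Sum>i\<in>I. (\<delta> * c i) *\<^sub>R y (\<nu> i))"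
    using d N_scale[OF comb_in[of c \<nu> I], of \<delta>] by (simp add: scaleR_sum_right)
  also have "\<dots> \<le> K * N (\<Sum>k\<in>I. (c k * ?b k k) *\<^sub>R y (\<nu> k))"
  proof (rule comb_mono[OF I(1,2)])
    fix i assume "i \<in> I"
    then have "\<bar>c i\<bar> * \<delta> \<le> \<bar>c i\<bar> * \<bar>?b i i\<bar>" using large by (intro mult_left_mono) auto
    then show "\<bar>\<delta> * c i\<bar> \<le> \<bar>c i * ?b i i\<bar>" using d by (simp add: abs_mult mult.commute)
  qed
  also have "\<dots> \<le> K * (K * N (\<Sum>l\<in>I. c l *\<^sub>R unit_vec (\<mu> l)))"
    using up K_pos by (intro mult_left_mono) auto
  finally show ?thesis using d by (simp add: field_simps power2_eq_square)
qed

text \<open>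
  The same with the roles of the two bases exchanged: the array consists of the components
  \<open>y (\<nu> l) (\<mu> k) *\<^sub>R unit_vec (\<mu> k)\<close>.
\<close>

lemma dominates_if_large_entries:
  assumes I: "finite I" "inj_on \<nu> I" "inj_on \<mu> I" and d: "0 < \<delta>"
    and large: "\<And>i. i \<in> I \<Longrightarrow> \<delta> \<le> \<bar>y (\<nu> i) (\<mu> i)\<bar>"
  shows "N (\<Sum>i\<in>I. c i *\<^sub>R unit_vec (\<mu> i)) \<le> K / \<delta> * N (\<Sum>i\<in>I. c i *\<^sub>R y (\<nu> i))"
proof -
  let ?a = "\<lambda>k l. y (\<nu> l) (\<mu> k)"
  obtain \<theta> :: "_ \<Rightarrow> real" where th: "\<forall>k. \<bar>\<theta> k\<bar> = 1"
    and le: "N (0 + (\<Sum>k\<in>I. (c k * ?a k k) *\<^sub>R unit_vec (\<mu> k)))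
      \<le> N (0 + (\<Sum>k\<in>I. \<Sum>l\<in>I. (\<theta> k * \<theta> l) *\<^sub>R ((c l * ?a k l) *\<^sub>R unit_vec (\<mu> k))))"
    using sign_diagonal[OF I(1), of "\<lambda>k l. (c l * ?a k l) *\<^sub>R unit_vec (\<mu> k)" 0] by auto
  define g where "g = (\<Sum>l\<in>I. (\<theta> l * c l) *\<^sub>R y (\<nu> l))"
  have gX: "g \<in> X" unfolding g_def by (rule comb_in)
  have eq: "(\<Sum>k\<in>I. \<Sum>l\<in>I. (\<theta> k * \<theta> l) *\<^sub>R ((c l * ?a k l) *\<^sub>R unit_vec (\<mu> k)))
      = (\<Sum>k\<in>I. (\<theta> k * g (\<mu> k)) *\<^sub>R unit_vec (\<mu> k))"
    unfolding g_def sum_fun_apply sum_distrib_left scaleR_sum_left by (simp add: mult_ac)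
  have "N (\<Sum>k\<in>I. (c k * ?a k k) *\<^sub>R unit_vec (\<mu> k)) \<le> N (\<Sum>k\<in>I. (\<theta> k * g (\<mu> k)) *\<^sub>R unit_vec (\<mu> k))"
    using le unfolding eq by simp
  also have "\<dots> \<le> N g"
  proof (rule lattice_norm[OF gX])
    fix i show "\<bar>(\<Sum>k\<in>I. (\<theta> k * g (\<mu> k)) *\<^sub>R unit_vec (\<mu> k)) i\<bar> \<le> \<bar>g i\<bar>"
    proof (cases "i \<in> \<mu> ` I")
      case True
      then obtain k where k: "k \<in> I" "i = \<mu> k" by blast
      then show ?thesis
        using unit_vec_comb_apply[OF I(1,3) k(1), of "\<lambda>k. \<theta> k * g (\<mu> k)"] th by (simp add: abs_mult)
    qed (simp add: unit_vec_comb_apply_0)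
  qed
  also have "\<dots> \<le> K * N (\<Sum>l\<in>I. c l *\<^sub>R y (\<nu> l))"
    unfolding g_def using I th by (intro comb_mono) (auto simp: abs_mult)
  finally have up: "N (\<Sum>k\<in>I. (c k * ?a k k) *\<^sub>R unit_vec (\<mu> k)) \<le> K * N (\<Sum>l\<in>I. c l *\<^sub>R y (\<nu> l))" .
  have "\<delta> * N (\<Sum>i\<in>I. c i *\<^sub>R unit_vec (\<mu> i)) = N (\<Sum>i\<in>I. (\<delta> * c i) *\<^sub>R unit_vec (\<mu> i))"
    using d N_scale[OF unit_vec_sum_in[of c \<mu> I], of \<delta>] by (simp add: scaleR_sum_right)
  also have "\<dots> \<le> N (\<Sum>k\<in>I. (c k * ?a k k) *\<^sub>R unit_vec (\<mu> k))"
  proof (rule unit_vec_comb_mono[OF I(1,3)])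
    fix i assume "i \<in> I"
    then have "\<bar>c i\<bar> * \<delta> \<le> \<bar>c i\<bar> * \<bar>?a i i\<bar>" using large by (intro mult_left_mono) auto
    then show "\<bar>\<delta> * c i\<bar> \<le> \<bar>c i * ?a i i\<bar>" using d by (simp add: abs_mult mult.commute)
  qed
  also note up
  finally show ?thesis using d by (simp add: field_simps)
qed

text \<open>
  If every \<open>y n\<close> has a coordinate \<open>J n\<close> contributing a fixed amount to \<open>1 = f n (y n)\<close>, then
  boundedly many \<open>n\<close> share a coordinate. Finitely many classes on which \<open>J\<close> is injective
  therefore cover the index set, and on each class the basis vectors \<open>y n\<close> and \<open>unit_vec (J n)\<close> dominate
  each other.
\<close>

lemma equivalent_if_peaks:
  assumes d: "0 < \<delta>" and peak: "\<And>n. \<exists>j. \<delta> \<le> \<bar>y n j * f n (unit_vec j)\<bar>"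
  shows "equivalent_bases N unit_vec y"
proof -
  obtain J where J: "\<And>n. \<delta> \<le> \<bar>y n (J n) * f n (unit_vec (J n))\<bar>" using peak by metis
  define \<delta>' where "\<delta>' = \<delta> / K"
  have d': "0 < \<delta>'" using d K_pos by (simp add: \<delta>'_def)
  have ya: "\<delta>' \<le> \<bar>y n (J n)\<bar>" and fb: "\<delta>' \<le> \<bar>f n (unit_vec (J n))\<bar>" for n
  proof -
    have "\<bar>y n (J n) * f n (unit_vec (J n))\<bar> \<le> \<bar>y n (J n)\<bar> * K"
      unfolding abs_mult by (intro mult_left_mono entry_f_le) simp
    with J[of n] show "\<delta>' \<le> \<bar>y n (J n)\<bar>" using K_pos by (simp add: \<delta>'_def field_simps)
    have "\<bar>y n (J n) * f n (unit_vec (J n))\<bar> \<le> K * \<bar>f n (unit_vec (J n))\<bar>"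
      unfolding abs_mult by (intro mult_right_mono entry_y_le) simp
    with J[of n] show "\<delta>' \<le> \<bar>f n (unit_vec (J n))\<bar>" using K_pos by (simp add: \<delta>'_def field_simps)
  qed
  obtain R :: nat where R: "K / \<delta> < R" using reals_Archimedean2 by blast
  \<comment> \<open>The class of \<open>n\<close> is its rank among the indices with the same value of \<open>J\<close>.\<close>
  define col where "col n = card {m. m < n \<and> J m = J n}" for n
  have col: "col n < R" for n
  proof -
    have "real (col n) * \<delta> = (\<Sum>m | m < n \<and> J m = J n. \<delta>)" by (simp add: col_def)
    also have "\<dots> \<le> (\<Sum>m | m < n \<and> J m = J n. \<bar>f m (unit_vec (J n)) * y m (J n)\<bar>)"
    proof (rule sum_mono)
      fix m assume "m \<in> {m. m < n \<and> J m = J n}"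
      then show "\<delta> \<le> \<bar>f m (unit_vec (J n)) * y m (J n)\<bar>" using J[of m] by (simp add: mult.commute)
    qed
    also have "\<dots> \<le> K * N (unit_vec (J n))" by (rule coordinate_abs_sum_le) auto
    finally have "real (col n) \<le> K / \<delta>" using d by (simp add: norm_unit_vec field_simps)
    with R show ?thesis by simp
  qed
  have col_less: "col m < col n" if "m < n" "J m = J n" for m n
    unfolding col_def by (rule psubset_card_mono) (use that in auto)
  have inj: "inj_on J {n\<in>S. col n = r}" for S r
  proof (rule inj_onI)
    fix m n assume "m \<in> {n\<in>S. col n = r}" "n \<in> {n\<in>S. col n = r}" "J m = J n"
    then show "m = n" using col_less[of m n] col_less[of n m] by (cases m n rule: linorder_cases) auto
  qed
  define C where "C = max 1 (real R * (K\<^sup>2 / \<delta>'))"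
  have C: "1 \<le> C" "real R * (K\<^sup>2 / \<delta>') \<le> C" by (simp_all add: C_def)
  have split: "(\<Sum>n\<in>S. g n) = (\<Sum>r<R. \<Sum>n | n \<in> S \<and> col n = r. g n)"
    if "finite S" for S and g :: "nat \<Rightarrow> nat \<Rightarrow> real"
  proof -
    have "col ` S \<subseteq> {..<R}" using col by auto
    then show ?thesis using sum.group[OF that, of "{..<R}" col g] by simp
  qed
  have main: "N (\<Sum>n\<in>S. c n *\<^sub>R y n) \<le> C * N (\<Sum>n\<in>S. c n *\<^sub>R unit_vec n) \<and>
      N (\<Sum>n\<in>S. c n *\<^sub>R unit_vec n) \<le> C * N (\<Sum>n\<in>S. c n *\<^sub>R y n)" if S: "finite S" for S c
  proof
    let ?E = "\<Sum>n\<in>S. c n *\<^sub>R unit_vec n" and ?Y = "\<Sum>n\<in>S. c n *\<^sub>R y n"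
    have EX: "?E \<in> X" and YX: "?Y \<in> X" using unit_vec_sum_in[of c "\<lambda>n. n" S] comb_in[of c "\<lambda>n. n" S] by auto
    have Sr: "finite {n\<in>S. col n = r}" for r using S by simp
    have CN: "real R * (K\<^sup>2 / \<delta>' * N z) \<le> C * N z" if "z \<in> X" for z
      using mult_right_mono[OF C(2) norm_nonneg[OF that]] by (simp add: mult_ac)
    have same: "N (\<Sum>n | n \<in> S \<and> col n = r. c n *\<^sub>R unit_vec (J n)) = N (\<Sum>n | n \<in> S \<and> col n = r. c n *\<^sub>R unit_vec n)" for r
      using symmetric[OF Sr inj, of "\<lambda>n. n" r c] by simp
    have "N ?Y \<le> (\<Sum>r<R. N (\<Sum>n | n \<in> S \<and> col n = r. c n *\<^sub>R y n))"
      unfolding split[OF S, of "\<lambda>n. c n *\<^sub>R y n"] by (intro N_sum comb_in)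
    also have "\<dots> \<le> (\<Sum>r<R. K\<^sup>2 / \<delta>' * N ?E)"
    proof (rule sum_mono)
      fix r
      have "N (\<Sum>n | n \<in> S \<and> col n = r. c n *\<^sub>R y n) \<le> K\<^sup>2 / \<delta>' * N (\<Sum>n | n \<in> S \<and> col n = r. c n *\<^sub>R unit_vec (J n))"
        using dominated_if_large_coefficients[OF Sr _ inj d', of "\<lambda>n. n" r c] fb by simp
      moreover have "N (\<Sum>n | n \<in> S \<and> col n = r. c n *\<^sub>R unit_vec (J n)) \<le> N ?E"
        unfolding same by (rule lattice_norm[OF EX]) (use S in \<open>simp add: unit_vec_comb_apply_id\<close>)
      ultimately show "N (\<Sum>n | n \<in> S \<and> col n = r. c n *\<^sub>R y n) \<le> K\<^sup>2 / \<delta>' * N ?E"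
        using d' by (elim order.trans) (intro mult_left_mono; simp)
    qed
    finally show "N ?Y \<le> C * N ?E" using CN[OF EX] by simp
    have "N ?E \<le> (\<Sum>r<R. N (\<Sum>n | n \<in> S \<and> col n = r. c n *\<^sub>R unit_vec n))"
      unfolding split[OF S, of "\<lambda>n. c n *\<^sub>R unit_vec n"] by (intro N_sum unit_vec_sum_in)
    also have "\<dots> \<le> (\<Sum>r<R. K\<^sup>2 / \<delta>' * N ?Y)"
    proof (rule sum_mono)
      fix r
      have "N (\<Sum>n | n \<in> S \<and> col n = r. c n *\<^sub>R unit_vec n) \<le> K / \<delta>' * N (\<Sum>n | n \<in> S \<and> col n = r. c n *\<^sub>R y n)"
        unfolding same[symmetric] using dominates_if_large_entries[OF Sr _ inj d', of "\<lambda>n. n" r c] ya by simp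
      also have "(\<Sum>n | n \<in> S \<and> col n = r. c n *\<^sub>R y n) = (\<Sum>n | n \<in> S \<and> col n = r. (1 * f n ?Y) *\<^sub>R y n)"
        using f_comb[OF S, of "\<lambda>n. n" _ c] by (intro sum.cong) auto
      also have "K / \<delta>' * N \<dots> \<le> K / \<delta>' * (K * N ?Y)"
        using d' K_pos S by (intro mult_left_mono multiplier YX) auto
      also have "\<dots> = K\<^sup>2 / \<delta>' * N ?Y" by (simp add: power2_eq_square)
      finally show "N (\<Sum>n | n \<in> S \<and> col n = r. c n *\<^sub>R unit_vec n) \<le> K\<^sup>2 / \<delta>' * N ?Y" .
    qed
    finally show "N ?E \<le> C * N ?Y" using CN[OF YX] by simp
  qed
  show ?thesis unfolding equivalent_bases_def
  proof (intro exI[of _ C] conjI allI impI C(1))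
    fix c :: "nat \<Rightarrow> real" assume S: "finite {n. c n \<noteq> 0}"
    show "inverse C * N (\<Sum>n | c n \<noteq> 0. c n *\<^sub>R unit_vec n) \<le> N (\<Sum>n | c n \<noteq> 0. c n *\<^sub>R y n)"
      using main[OF S, of c] C(1) by (simp add: field_simps)
    show "N (\<Sum>n | c n \<noteq> 0. c n *\<^sub>R y n) \<le> C * N (\<Sum>n | c n \<noteq> 0. c n *\<^sub>R unit_vec n)"
      using main[OF S, of c] by simp
  qed
qed

end

section \<open>Bases without large common entries\<close>

text \<open>
  If admissible objects can be found away from every finite set, then any number of them can be found
  with disjoint footprints.
\<close>

lemma disjoint_selection:
  fixes n :: nat and foot :: "'c \<Rightarrow> 'b set" and P :: "'c \<Rightarrow> bool"
  assumes step: "\<And>Y. finite Y \<Longrightarrow> \<exists>c. P c \<and> finite (foot c) \<and> foot c \<inter> Y = {}"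
  shows "\<exists>s. (\<forall>k<n. P (s k) \<and> finite (foot (s k))) \<and>
    (\<forall>k<n. \<forall>l<n. k \<noteq> l \<longrightarrow> foot (s k) \<inter> foot (s l) = {})"
proof (induction n)
  case (Suc n)
  then obtain s where s: "\<And>k. k < n \<Longrightarrow> P (s k) \<and> finite (foot (s k))"
    "\<And>k l. k < n \<Longrightarrow> l < n \<Longrightarrow> k \<noteq> l \<Longrightarrow> foot (s k) \<inter> foot (s l) = {}" by blast
  obtain c where c: "P c" "finite (foot c)" "foot c \<inter> (\<Union>k<n. foot (s k)) = {}"
    using step[of "\<Union>k<n. foot (s k)"] s(1) by auto
  show ?case
    by (rule exI[of _ "s(n := c)"]) (use s c in \<open>auto simp: less_Suc_eq\<close>)
qed simp

text \<open>
  For independent random signs, the fourth moment of \<open>s + (\<Sum>n\<in>B. \<theta> n * x n)\<close> is at most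
  \<open>s ^ 4 + 6 * s\<^sup>2 * r + 3 * r\<^sup>2\<close>, where \<open>r\<close> is the sum of the \<open>(x n)\<^sup>2\<close>. Fixing the signs one by one, this
  bound for the signs still open can be kept from increasing.
\<close>

lemma fourth_moment_signs:
  fixes x :: "'n \<Rightarrow> 'i \<Rightarrow> real"
  assumes "finite B"
  shows "\<exists>\<theta>::'n \<Rightarrow> real. (\<forall>n. \<bar>\<theta> n\<bar> = 1) \<and> (\<Sum>i\<in>J. (s i + (\<Sum>n\<in>B. \<theta> n * x n i)) ^ 4)
    \<le> (\<Sum>i\<in>J. s i ^ 4 + 6 * (s i)\<^sup>2 * (\<Sum>n\<in>B. (x n i)\<^sup>2) + 3 * (\<Sum>n\<in>B. (x n i)\<^sup>2)\<^sup>2)"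
  using assms
proof (induction B arbitrary: s rule: finite_induct)
  case empty
  show ?case by (rule exI[of _ "\<lambda>_. 1"]) simp
next
  case (insert b B)
  define r where "r i = (\<Sum>n\<in>B. (x n i)\<^sup>2)" for i
  define \<Phi> where "\<Phi> t i = t ^ 4 + 6 * t\<^sup>2 * r i + 3 * (r i)\<^sup>2" for t i
  have pt: "\<Phi> (s i + x b i) i + \<Phi> (s i - x b i) i
      \<le> 2 * (s i ^ 4 + 6 * (s i)\<^sup>2 * ((x b i)\<^sup>2 + r i) + 3 * ((x b i)\<^sup>2 + r i)\<^sup>2)" for i
  proof -
    have "2 * (s i ^ 4 + 6 * (s i)\<^sup>2 * ((x b i)\<^sup>2 + r i) + 3 * ((x b i)\<^sup>2 + r i)\<^sup>2)
        - (\<Phi> (s i + x b i) i + \<Phi> (s i - x b i) i) = 4 * ((x b i)\<^sup>2)\<^sup>2"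
      unfolding \<Phi>_def by (simp add: power2_eq_square power4_eq_xxxx algebra_simps)
    moreover have "0 \<le> 4 * ((x b i)\<^sup>2)\<^sup>2" by simp
    ultimately show ?thesis by linarith
  qed
  have "(\<Sum>i\<in>J. \<Phi> (s i + x b i) i) + (\<Sum>i\<in>J. \<Phi> (s i - x b i) i)
      \<le> 2 * (\<Sum>i\<in>J. s i ^ 4 + 6 * (s i)\<^sup>2 * ((x b i)\<^sup>2 + r i) + 3 * ((x b i)\<^sup>2 + r i)\<^sup>2)"
    unfolding sum.distrib[symmetric] sum_distrib_left by (intro sum_mono pt)
  then have "(\<Sum>i\<in>J. \<Phi> (s i + 1 * x b i) i) \<le> (\<Sum>i\<in>J. s i ^ 4 + 6 * (s i)\<^sup>2 * ((x b i)\<^sup>2 + r i) + 3 * ((x b i)\<^sup>2 + r i)\<^sup>2)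
    \<or> (\<Sum>i\<in>J. \<Phi> (s i + (-1) * x b i) i) \<le> (\<Sum>i\<in>J. s i ^ 4 + 6 * (s i)\<^sup>2 * ((x b i)\<^sup>2 + r i) + 3 * ((x b i)\<^sup>2 + r i)\<^sup>2)"
    by auto
  then obtain e :: real where e: "\<bar>e\<bar> = 1"
    "(\<Sum>i\<in>J. \<Phi> (s i + e * x b i) i) \<le> (\<Sum>i\<in>J. s i ^ 4 + 6 * (s i)\<^sup>2 * ((x b i)\<^sup>2 + r i) + 3 * ((x b i)\<^sup>2 + r i)\<^sup>2)"
  proof
    assume a: "(\<Sum>i\<in>J. \<Phi> (s i + 1 * x b i) i) \<le> (\<Sum>i\<in>J. s i ^ 4 + 6 * (s i)\<^sup>2 * ((x b i)\<^sup>2 + r i) + 3 * ((x b i)\<^sup>2 + r i)\<^sup>2)"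
    show ?thesis by (rule that[OF _ a]) simp
  next
    assume a: "(\<Sum>i\<in>J. \<Phi> (s i + (-1) * x b i) i) \<le> (\<Sum>i\<in>J. s i ^ 4 + 6 * (s i)\<^sup>2 * ((x b i)\<^sup>2 + r i) + 3 * ((x b i)\<^sup>2 + r i)\<^sup>2)"
    show ?thesis by (rule that[OF _ a]) simp
  qed
  obtain \<theta> where th: "\<forall>n. \<bar>\<theta> n\<bar> = (1::real)" and
    le: "(\<Sum>i\<in>J. (s i + e * x b i + (\<Sum>n\<in>B. \<theta> n * x n i)) ^ 4) \<le> (\<Sum>i\<in>J. \<Phi> (s i + e * x b i) i)"
    using insert.IH[of "\<lambda>i. s i + e * x b i"] unfolding \<Phi>_def r_def by (elim exE conjE)
  have "(\<Sum>n\<in>insert b B. (\<theta>(b := e)) n * x n i) = e * x b i + (\<Sum>n\<in>B. \<theta> n * x n i)" for i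
    using insert.hyps by (simp, intro sum.cong) auto
  moreover have "(\<Sum>n\<in>insert b B. (x n i)\<^sup>2) = (x b i)\<^sup>2 + r i" for i
    using insert.hyps by (simp add: r_def)
  ultimately show ?case
    using th e le by (intro exI[of _ "\<theta>(b := e)"] conjI) (simp, simp only: add.assoc[symmetric] order.trans)
qed

text \<open>The left-hand side is the mean of the right-hand side over all signs.\<close>

lemma second_moment_signs:
  fixes x :: "'n \<Rightarrow> 'i \<Rightarrow> real"
  assumes "finite B"
  shows "\<exists>\<theta>::'n \<Rightarrow> real. (\<forall>n. \<bar>\<theta> n\<bar> = 1) \<and>
    (\<Sum>i\<in>J. (s i)\<^sup>2 + (\<Sum>n\<in>B. (x n i)\<^sup>2)) \<le> (\<Sum>i\<in>J. (s i + (\<Sum>n\<in>B. \<theta> n * x n i))\<^sup>2)"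
  using assms
proof (induction B arbitrary: s rule: finite_induct)
  case empty
  show ?case by (rule exI[of _ "\<lambda>_. 1"]) simp
next
  case (insert b B)
  define r where "r i = (\<Sum>n\<in>B. (x n i)\<^sup>2)" for i
  have "(\<Sum>i\<in>J. (s i + 1 * x b i)\<^sup>2 + r i) + (\<Sum>i\<in>J. (s i + (-1) * x b i)\<^sup>2 + r i)
      = 2 * (\<Sum>i\<in>J. (s i)\<^sup>2 + ((x b i)\<^sup>2 + r i))"
    unfolding sum.distrib[symmetric] sum_distrib_left
    by (intro sum.cong) (auto simp: power2_eq_square algebra_simps)
  then have "(\<Sum>i\<in>J. (s i)\<^sup>2 + ((x b i)\<^sup>2 + r i)) \<le> (\<Sum>i\<in>J. (s i + 1 * x b i)\<^sup>2 + r i)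
    \<or> (\<Sum>i\<in>J. (s i)\<^sup>2 + ((x b i)\<^sup>2 + r i)) \<le> (\<Sum>i\<in>J. (s i + (-1) * x b i)\<^sup>2 + r i)"
    by linarith
  then obtain e :: real where e: "\<bar>e\<bar> = 1"
    "(\<Sum>i\<in>J. (s i)\<^sup>2 + ((x b i)\<^sup>2 + r i)) \<le> (\<Sum>i\<in>J. (s i + e * x b i)\<^sup>2 + r i)"
  proof
    assume a: "(\<Sum>i\<in>J. (s i)\<^sup>2 + ((x b i)\<^sup>2 + r i)) \<le> (\<Sum>i\<in>J. (s i + 1 * x b i)\<^sup>2 + r i)"
    show ?thesis by (rule that[OF _ a]) simp
  next
    assume a: "(\<Sum>i\<in>J. (s i)\<^sup>2 + ((x b i)\<^sup>2 + r i)) \<le> (\<Sum>i\<in>J. (s i + (-1) * x b i)\<^sup>2 + r i)"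
    show ?thesis by (rule that[OF _ a]) simp
  qed
  obtain \<theta> where th: "\<forall>n. \<bar>\<theta> n\<bar> = (1::real)" and
    le: "(\<Sum>i\<in>J. (s i + e * x b i)\<^sup>2 + r i) \<le> (\<Sum>i\<in>J. (s i + e * x b i + (\<Sum>n\<in>B. \<theta> n * x n i))\<^sup>2)"
    using insert.IH[of "\<lambda>i. s i + e * x b i"] unfolding r_def by (elim exE conjE)
  have "(\<Sum>n\<in>insert b B. (\<theta>(b := e)) n * x n i) = e * x b i + (\<Sum>n\<in>B. \<theta> n * x n i)" for i
    using insert.hyps by (simp, intro sum.cong) auto
  moreover have "(\<Sum>n\<in>insert b B. (x n i)\<^sup>2) = (x b i)\<^sup>2 + r i" for i
    using insert.hyps by (simp add: r_def)
  ultimately show ?case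
    using th e order.trans[OF e(2) le] by (intro exI[of _ "\<theta>(b := e)"] conjI) (simp, simp only: add.assoc[symmetric])
qed

context near_linear_orlicz_basis
begin

text \<open>The products are the terms of a series for \<open>f n (y n) = 1\<close>.\<close>

lemma exists_nonzero_product: "\<exists>j. y n j * f n (unit_vec j) \<noteq> 0"
proof (rule ccontr)
  assume "\<not> ?thesis"
  then have z: "y n j * f n (unit_vec j) = 0" for j by blast
  have le: "1 \<le> K * N (restrict_to {m..} (y n))" for m
  proof -
    have "f n (\<Sum>j<m. y n j *\<^sub>R unit_vec j) = 0"
      by (subst f_sum) (auto simp: f_scale z)
    then have "f n (restrict_to {m..} (y n)) = 1"
      using f_diff[of "y n" "\<Sum>j<m. y n j *\<^sub>R unit_vec j" n] unit_vec_sum_in[of "y n" "\<lambda>j. j" "{..<m}"]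
      by (simp add: partial_sum_unit_vec f_y)
    then show ?thesis using f_le[of "restrict_to {m..} (y n)" n] by simp
  qed
  have "(\<lambda>m. K * N (restrict_to {m..} (y n))) \<longlonglongrightarrow> K * 0"
    by (intro tendsto_mult tendsto_const norm_tail_tendsto_0 y_in)
  then have "1 \<le> K * 0" by (rule tendsto_lowerbound) (use le in auto)
  then show False by simp
qed

text \<open>
  A vector splits into three parts: its coordinates in \<open>J\<close>, which are negligible if they are small,
  its tail, and a finite piece away from \<open>J\<close>, which carries what remains of the norm.
\<close>

lemma finite_piece:
  assumes x: "x \<in> X" and J: "finite J" and c: "0 < c" and big: "4 * c \<le> N x"
    and small: "\<And>i. i \<in> J \<Longrightarrow> \<bar>x i\<bar> \<le> c / (real (card J) + 1)"
    and tail: "N (restrict_to {m..} x) \<le> c"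
  shows "2 * c \<le> N (restrict_to ({..<m} - J) x)"
proof -
  have "x = restrict_to ({..<m} - J) x + restrict_to J x + restrict_to ({m..} - J) x"
    by (rule ext) (auto simp: restrict_to_def)
  then have "N x \<le> N (restrict_to ({..<m} - J) x + restrict_to J x) + N (restrict_to ({m..} - J) x)"
    using N_triangle[of "restrict_to ({..<m} - J) x + restrict_to J x" "restrict_to ({m..} - J) x"] x
    by simp
  also have "\<dots> \<le> N (restrict_to ({..<m} - J) x) + N (restrict_to J x) + N (restrict_to ({m..} - J) x)"
    using x by (intro add_right_mono N_triangle) auto
  finally have "N x \<le> N (restrict_to ({..<m} - J) x) + N (restrict_to J x) + N (restrict_to ({m..} - J) x)" .
  moreover have "N (restrict_to J x) \<le> c"
  proof -
    have "N (restrict_to J x) \<le> real (card J) * (c / (real (card J) + 1))"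
      using x J small by (rule norm_restrict_le_card)
    also have "\<dots> \<le> c" using c by (simp add: field_simps)
    finally show ?thesis .
  qed
  moreover have "N (restrict_to ({m..} - J) x) \<le> N (restrict_to {m..} x)"
    by (rule lattice_norm[OF restrict_in[OF x]]) (auto simp: restrict_to_def)
  ultimately show ?thesis using big tail by linarith
qed

text \<open>
  A vector \<open>y n\<close> all of whose products \<open>y n j * f n (unit_vec j)\<close> are tiny keeps half of
  \<open>f n (y n) = 1\<close> when its large coordinates, boundedly many, are deleted.
\<close>

lemma flat_piece_of_basis_vector:
  assumes flat: "\<And>\<delta>. 0 < \<delta> \<Longrightarrow> \<exists>n. \<forall>j. \<bar>y n j * f n (unit_vec j)\<bar> < \<delta>"
    and t: "0 < \<tau>" and T: "finite T" and J: "finite J"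
  shows "\<exists>n D. n \<notin> T \<and> finite D \<and> D \<inter> J = {} \<and> (\<forall>i\<in>D. \<bar>y n i\<bar> \<le> \<tau>)
    \<and> 1 / (4 * K) \<le> N (restrict_to D (y n))"
proof -
  define c where "c = 1 / (8 * K)"
  have c: "0 < c" using K_pos by (simp add: c_def)
  define \<tau>' where "\<tau>' = min \<tau> (c / (real (card J) + 1))"
  have t': "0 < \<tau>'" "\<tau>' \<le> \<tau>" "\<tau>' \<le> c / (real (card J) + 1)" using t c by (auto simp: \<tau>'_def)
  define Q where "Q = 4 * \<gamma> * K\<^sup>2"
  have Q: "0 < Q" using gamma_ge_1 K_pos by (simp add: Q_def)
  obtain j0 where j0: "\<And>n. y n (j0 n) * f n (unit_vec (j0 n)) \<noteq> 0" using exists_nonzero_product by metis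
  \<comment> \<open>Below the first bound the at most \<open>Q / \<tau>'\<^sup>2\<close> large coordinates contribute at most \<open>1 / 2\<close> to
    \<open>f n (y n)\<close>; the other bounds exclude the indices in \<open>T\<close>.\<close>
  define \<delta> where "\<delta> = Min (insert (\<tau>'\<^sup>2 / (2 * Q)) ((\<lambda>n. \<bar>y n (j0 n) * f n (unit_vec (j0 n))\<bar>) ` T))"
  have d: "0 < \<delta>" unfolding \<delta>_def using T Q t' j0 by (subst Min_gr_iff) auto
  have dQ: "\<delta> \<le> \<tau>'\<^sup>2 / (2 * Q)" and dT: "\<And>n. n \<in> T \<Longrightarrow> \<delta> \<le> \<bar>y n (j0 n) * f n (unit_vec (j0 n))\<bar>"
    unfolding \<delta>_def using T by (auto intro: Min_le)
  obtain n where n: "\<And>j. \<bar>y n j * f n (unit_vec j)\<bar> < \<delta>" using flat[OF d] by blast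
  have nT: "n \<notin> T" using dT[of n] n[of "j0 n"] by force
  define W where "W = {i. \<tau>' \<le> \<bar>y n i\<bar>}"
  have W: "finite W" "real (card W) * \<tau>'\<^sup>2 \<le> 4 * \<gamma> * (N (y n))\<^sup>2"
    unfolding W_def using large_coordinates[OF y_in t'(1)] by auto
  have "(N (y n))\<^sup>2 \<le> K\<^sup>2" using y_le norm_nonneg[OF y_in] by (intro power_mono) auto
  then have "4 * \<gamma> * (N (y n))\<^sup>2 \<le> Q" unfolding Q_def using gamma_ge_1 by (intro mult_left_mono) auto
  with W have WQ: "real (card W) * \<tau>'\<^sup>2 \<le> Q" by linarith
  define x where "x = restrict_to (- W) (y n)"
  have xX: "x \<in> X" by (simp add: x_def)
  have x_eq: "x = y n - restrict_to W (y n)" unfolding x_def by (rule ext) (simp add: restrict_to_def)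
  have fW: "f n (restrict_to W (y n)) = (\<Sum>j\<in>W. y n j * f n (unit_vec j))"
    unfolding restrict_to_eq_sum[OF W(1)] by (subst f_sum) (auto simp: f_scale)
  have "\<bar>f n (restrict_to W (y n))\<bar> \<le> (\<Sum>j\<in>W. \<delta>)"
    unfolding fW using n by (intro order.trans[OF sum_abs] sum_mono) (auto intro: less_imp_le)
  also have "\<dots> = real (card W) * \<delta>" by simp
  also have "\<dots> \<le> real (card W) * (\<tau>'\<^sup>2 / (2 * Q))" using dQ by (intro mult_left_mono) auto
  also have "\<dots> \<le> 1 / 2" using WQ Q by (simp add: field_simps)
  finally have "\<bar>f n (restrict_to W (y n))\<bar> \<le> 1 / 2" .
  moreover have "f n x = 1 - f n (restrict_to W (y n))"
    unfolding x_eq by (subst f_diff) (auto simp: f_y)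
  ultimately have "1 / 2 \<le> \<bar>f n x\<bar>" by linarith
  also have "\<dots> \<le> K * N x" using xX by (rule f_le)
  finally have big: "4 * c \<le> N x" using K_pos by (simp add: c_def field_simps)
  have xs: "\<bar>x i\<bar> \<le> \<tau>'" for i using t' by (auto simp: x_def restrict_to_def W_def)
  have "\<forall>\<^sub>F m in sequentially. N (restrict_to {m..} x) < c"
    using norm_tail_tendsto_0[OF xX] c by (rule order_tendstoD)
  then obtain m where m: "N (restrict_to {m..} x) < c" by (auto simp: eventually_sequentially)
  have "2 * c \<le> N (restrict_to ({..<m} - J) x)"
  proof (rule finite_piece[OF xX J c big])
    show "\<bar>x i\<bar> \<le> c / (real (card J) + 1)" for i using xs[of i] t' by linarith
  qed (use m in simp)
  also have "restrict_to ({..<m} - J) x = restrict_to ({..<m} - J - W) (y n)"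
    by (rule ext) (auto simp: x_def restrict_to_def)
  finally have "1 / (4 * K) \<le> N (restrict_to ({..<m} - J - W) (y n))" by (simp add: c_def)
  moreover have "\<forall>i\<in>{..<m} - J - W. \<bar>y n i\<bar> \<le> \<tau>" using t' by (auto simp: W_def)
  ultimately show ?thesis using nT by (intro exI[of _ n] exI[of _ "{..<m} - J - W"]) auto
qed

text \<open>
  Flat pieces of suitable basis vectors can be taken disjoint, so by democracy sums of basis
  vectors grow linearly, as in \<open>\<ell>\<^sub>1\<close>.
\<close>

lemma linear_growth_if_no_peaks:
  assumes flat: "\<And>\<delta>. 0 < \<delta> \<Longrightarrow> \<exists>n. \<forall>j. \<bar>y n j * f n (unit_vec j)\<bar> < \<delta>"
  shows "\<exists>c>0. \<forall>A. finite A \<and> 2 \<le> \<kappa> * real (card A) \<longrightarrow> c * real (card A) \<le> N (\<Sum>n\<in>A. y n)"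
proof -
  define c where "c = 1 / (4 * K) * \<kappa> / 4 / K\<^sup>2"
  have c: "0 < c" using K_pos kappa_pos by (simp add: c_def)
  have "c * real (card A) \<le> N (\<Sum>n\<in>A. y n)" if A: "finite A" "2 \<le> \<kappa> * real (card A)" for A
  proof -
    let ?n = "card A"
    have c0: "0 < 1 / (4 * K)" using K_pos by simp
    obtain \<tau> where t: "0 < \<tau>"
      and flat_bound: "\<And>w D R. (\<And>k. k < ?n \<Longrightarrow> w k \<in> X) \<Longrightarrow> (\<And>k. k < ?n \<Longrightarrow> finite (D k)) \<Longrightarrow>
        (\<And>k i. k < ?n \<Longrightarrow> i \<in> D k \<Longrightarrow> \<bar>w k i\<bar> \<le> \<tau>) \<Longrightarrow>
        (\<And>k. k < ?n \<Longrightarrow> 1 / (4 * K) \<le> N (restrict_to (D k) (w k))) \<Longrightarrow>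
        (\<And>k l. k < ?n \<Longrightarrow> l < ?n \<Longrightarrow> k \<noteq> l \<Longrightarrow> D k \<inter> D l = {}) \<Longrightarrow>
        (\<And>\<theta>. (\<forall>k. \<bar>\<theta> k\<bar> = 1) \<Longrightarrow> N (\<Sum>k<?n. \<theta> k *\<^sub>R w k) \<le> R) \<Longrightarrow>
        1 / (4 * K) * \<kappa> / 4 * real ?n \<le> R"
      by (erule flat_pieces_lower_bound[OF c0 A(2)])
    \<comment> \<open>A candidate is an index with a piece of its basis vector. The footprint keeps indices and
      pieces apart.\<close>
    define P where "P p \<longleftrightarrow> finite (snd p) \<and> (\<forall>i\<in>snd p. \<bar>y (fst p) i\<bar> \<le> \<tau>)
      \<and> 1 / (4 * K) \<le> N (restrict_to (snd p) (y (fst p)))" for p :: "nat \<times> nat set"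
    define foot :: "nat \<times> nat set \<Rightarrow> (nat + nat) set" where "foot p = insert (Inl (fst p)) (Inr ` snd p)" for p
    have step: "\<exists>p. P p \<and> finite (foot p) \<and> foot p \<inter> Y = {}" if Y: "finite Y" for Y
    proof -
      have fin: "finite (Inl -` Y)" "finite (Inr -` Y)" using Y by (auto intro!: finite_vimageI)
      have "\<exists>n D. n \<notin> Inl -` Y \<and> finite D \<and> D \<inter> Inr -` Y = {} \<and> (\<forall>i\<in>D. \<bar>y n i\<bar> \<le> \<tau>)
        \<and> 1 / (4 * K) \<le> N (restrict_to D (y n))"
        by (rule flat_piece_of_basis_vector[OF _ t fin]) (rule flat)
      then obtain n D where "n \<notin> Inl -` Y" "finite D" "D \<inter> Inr -` Y = {}" "\<forall>i\<in>D. \<bar>y n i\<bar> \<le> \<tau>"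
        "1 / (4 * K) \<le> N (restrict_to D (y n))" by (elim exE conjE)
      then show ?thesis by (intro exI[of _ "(n, D)"]) (auto simp: P_def foot_def)
    qed
    have "\<exists>s. (\<forall>k<?n. P (s k) \<and> finite (foot (s k))) \<and>
      (\<forall>k<?n. \<forall>l<?n. k \<noteq> l \<longrightarrow> foot (s k) \<inter> foot (s l) = {})"
    by (rule disjoint_selection) (rule step)
    then obtain s where s: "\<forall>k<?n. P (s k) \<and> finite (foot (s k))"
      and dis: "\<forall>k<?n. \<forall>l<?n. k \<noteq> l \<longrightarrow> foot (s k) \<inter> foot (s l) = {}" by (elim exE conjE)
    define \<nu> where "\<nu> k = fst (s k)" for k
    have inj: "inj_on \<nu> {..<?n}"
    proof (rule inj_onI)
      fix k l assume "k \<in> {..<?n}" "l \<in> {..<?n}" "\<nu> k = \<nu> l"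
      then show "k = l" using dis by (auto simp: foot_def \<nu>_def)
    qed
    have "1 / (4 * K) * \<kappa> / 4 * real ?n \<le> K * N (\<Sum>k<?n. y (\<nu> k))"
    proof (rule flat_bound[of "\<lambda>k. y (\<nu> k)" "\<lambda>k. snd (s k)"])
      fix k assume "k < ?n"
      then have "P (s k)" using s by simp
      then show "finite (snd (s k))" "1 / (4 * K) \<le> N (restrict_to (snd (s k)) (y (\<nu> k)))"
        "\<And>i. i \<in> snd (s k) \<Longrightarrow> \<bar>y (\<nu> k) i\<bar> \<le> \<tau>"
        by (auto simp: P_def \<nu>_def)
    next
      fix k l assume "k < ?n" "l < ?n" "k \<noteq> l"
      then have "foot (s k) \<inter> foot (s l) = {}" using dis by simp
      then show "snd (s k) \<inter> snd (s l) = {}" by (auto simp: foot_def)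
    next
      fix \<theta> :: "nat \<Rightarrow> real" assume "\<forall>k. \<bar>\<theta> k\<bar> = 1"
      then show "N (\<Sum>k<?n. \<theta> k *\<^sub>R y (\<nu> k)) \<le> K * N (\<Sum>k<?n. y (\<nu> k))"
        using comb_mono[OF _ inj, of \<theta> "\<lambda>_. 1"] by simp
    qed (rule y_in)
    also have "(\<Sum>k<?n. y (\<nu> k)) = (\<Sum>m\<in>\<nu> ` {..<?n}. y m)" using inj by (simp add: sum.reindex)
    also have "K * N \<dots> \<le> K * (K * N (\<Sum>n\<in>A. y n))"
      using K_pos A inj by (intro mult_left_mono democratic) (auto simp: card_image)
    also have "\<dots> = N (\<Sum>n\<in>A. y n) * K\<^sup>2" by (simp add: power2_eq_square)
    finally have "1 / (4 * K) * \<kappa> / 4 * real ?n / K\<^sup>2 \<le> N (\<Sum>n\<in>A. y n)"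
      using K_pos by (simp only: pos_divide_le_eq zero_less_power)
    then show ?thesis by (simp add: c_def)
  qed
  with c show ?thesis by blast
qed

text \<open>
  A bounded functional that is large on many unit vectors would make suitably signed sums of them grow
  linearly.
\<close>

lemma finite_large_coefficients_of_one_functional:
  assumes d: "0 < \<delta>"
  shows "finite {j. \<delta> \<le> \<bar>f n (unit_vec j)\<bar>}"
proof (rule ccontr)
  assume inf: "infinite {j. \<delta> \<le> \<bar>f n (unit_vec j)\<bar>}"
  have "0 < \<delta> / (2 * K)" using d K_pos by simp
  then obtain h where h: "\<And>B. finite B \<Longrightarrow> h \<le> card B \<Longrightarrow> N (\<Sum>j\<in>B. unit_vec j) \<le> \<delta> / (2 * K) * real (card B)"
    using fundamental_function_sublinear by blast
  obtain B where B: "finite B" "card B = Suc h" "B \<subseteq> {j. \<delta> \<le> \<bar>f n (unit_vec j)\<bar>}"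
    using infinite_arbitrarily_large[OF inf] by blast
  define g where "g = (\<Sum>j\<in>B. sgn (f n (unit_vec j)) *\<^sub>R unit_vec j)"
  have gX: "g \<in> X" unfolding g_def using unit_vec_sum_in[of _ "\<lambda>j. j"] by simp
  have "\<delta> * real (card B) = (\<Sum>j\<in>B. \<delta>)" by simp
  also have "\<dots> \<le> (\<Sum>j\<in>B. \<bar>f n (unit_vec j)\<bar>)" using B by (intro sum_mono) auto
  also have "\<dots> = f n g" unfolding g_def by (subst f_sum) (auto simp: f_scale abs_sgn mult.commute)
  also have "\<dots> \<le> K * N g" using f_le[OF gX, of n] by simp
  also have "\<dots> \<le> K * N (\<Sum>j\<in>B. 1 *\<^sub>R unit_vec j)"
    unfolding g_def using B K_pos unit_vec_comb_mono[of B "\<lambda>j. j" "\<lambda>j. sgn (f n (unit_vec j))" "\<lambda>_. 1"]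
    by (intro mult_left_mono) (auto simp: abs_sgn_eq)
  also have "\<dots> \<le> K * (\<delta> / (2 * K) * real (card B))" using h[of B] B K_pos by (intro mult_left_mono) auto
  also have "\<dots> = \<delta> * real (card B) / 2" using K_pos by simp
  finally show False using d B by simp
qed

text \<open>
  If the \<open>y\<close> grow linearly while the unit vectors do not, then large coefficients
  \<open>f n (unit_vec j)\<close> are exceptional, because they would let the unit vectors dominate the \<open>y\<close>.
\<close>

lemma finite_large_coefficients:
  assumes c: "0 < c" and grow: "\<And>A. finite A \<Longrightarrow> 2 \<le> \<kappa> * real (card A) \<Longrightarrow> c * real (card A) \<le> N (\<Sum>n\<in>A. y n)"
    and d: "0 < \<delta>"
  shows "finite {j. \<exists>n. \<delta> \<le> \<bar>f n (unit_vec j)\<bar>}"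
proof (rule ccontr)
  let ?Z = "{j. \<exists>n. \<delta> \<le> \<bar>f n (unit_vec j)\<bar>}"
  assume inf: "infinite ?Z"
  have "\<forall>j\<in>?Z. \<exists>n. \<delta> \<le> \<bar>f n (unit_vec j)\<bar>" by blast
  then obtain \<nu> where nu: "\<And>j. j \<in> ?Z \<Longrightarrow> \<delta> \<le> \<bar>f (\<nu> j) (unit_vec j)\<bar>" by (elim bchoice[THEN exE]) blast
  have "?Z \<subseteq> (\<Union>n\<in>\<nu> ` ?Z. {j. \<delta> \<le> \<bar>f n (unit_vec j)\<bar>})" using nu by blast
  then have infS: "infinite (\<nu> ` ?Z)"
    using inf finite_large_coefficients_of_one_functional[OF d] by (metis (no_types, lifting) finite_UN finite_subset)
  define \<epsilon> where "\<epsilon> = \<delta> * c / (2 * K\<^sup>2)"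
  have e: "0 < \<epsilon>" using d c K_pos by (simp add: \<epsilon>_def)
  obtain h where h: "\<And>B. finite B \<Longrightarrow> h \<le> card B \<Longrightarrow> N (\<Sum>j\<in>B. unit_vec j) \<le> \<epsilon> * real (card B)"
    using fundamental_function_sublinear[OF e] by blast
  obtain h2 :: nat where h2: "2 / \<kappa> < h2" using reals_Archimedean2 by blast
  obtain S where S: "finite S" "card S = h + h2 + 1" "S \<subseteq> \<nu> ` ?Z"
    using infinite_arbitrarily_large[OF infS] by blast
  have "2 / \<kappa> \<le> real (card S)" using h2 S by simp
  then have S2: "2 \<le> \<kappa> * real (card S)" using kappa_pos by (simp add: field_simps)
  define \<mu> where "\<mu> = inv_into ?Z \<nu>"
  have mu: "\<mu> n \<in> ?Z" "\<nu> (\<mu> n) = n" if "n \<in> S" for n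
  proof -
    have "n \<in> \<nu> ` ?Z" using that S by blast
    then show "\<mu> n \<in> ?Z" "\<nu> (\<mu> n) = n" unfolding \<mu>_def by (rule inv_into_into, rule f_inv_into_f)
  qed
  have inj: "inj_on \<mu> S" by (rule inj_onI) (metis mu(2))
  have "c * real (card S) \<le> N (\<Sum>n\<in>S. y n)" using S(1) S2 by (rule grow)
  also have "\<dots> \<le> K\<^sup>2 / \<delta> * N (\<Sum>n\<in>S. unit_vec (\<mu> n))"
  proof -
    have "\<delta> \<le> \<bar>f n (unit_vec (\<mu> n))\<bar>" if "n \<in> S" for n using nu[OF mu(1)[OF that]] mu(2)[OF that] by simp
    then show ?thesis using dominated_if_large_coefficients[OF S(1) _ inj d, of "\<lambda>n. n" "\<lambda>_. 1"] by simp
  qed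
  also have "(\<Sum>n\<in>S. unit_vec (\<mu> n)) = (\<Sum>j\<in>\<mu> ` S. unit_vec j)" using inj by (simp add: sum.reindex)
  also have "K\<^sup>2 / \<delta> * N \<dots> \<le> K\<^sup>2 / \<delta> * (\<epsilon> * real (card (\<mu> ` S)))"
    using S d inj by (intro mult_left_mono h) (auto simp: card_image)
  also have "\<dots> = c * real (card S) / 2" using d K_pos inj by (simp add: \<epsilon>_def card_image)
  finally show False using c S by simp
qed

end

context near_linear_orlicz_basis
begin

text \<open>
  Let \<open>B\<close> carry almost all of the expansion of a unit vector \<open>unit_vec j\<close> with tiny coefficients.
  For random signs on \<open>B\<close> the fourth powers of the coordinates of the signed sum are small in total,
  because the variances of the coordinates are uniformly small and their sum is bounded. So some
  signs make the sum flat, while unconditionality keeps its norm away from \<open>0\<close>.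
\<close>

lemma signed_expansion_with_flat_piece:
  assumes small: "\<And>\<delta>. 0 < \<delta> \<Longrightarrow> finite {j. \<exists>n. \<delta> \<le> \<bar>f n (unit_vec j)\<bar>}"
    and t: "0 < \<tau>" and eta: "0 < \<eta>" "\<eta> \<le> 1 / 2"
    and fin: "finite J0" "finite T" "finite J"
  shows "\<exists>j B \<theta> D. j \<notin> J0 \<and> finite B \<and> B \<inter> T = {} \<and> finite D \<and> D \<inter> J = {} \<and> (\<forall>n. \<bar>\<theta> n\<bar> = (1::real))
    \<and> N (unit_vec j - (\<Sum>n\<in>B. f n (unit_vec j) *\<^sub>R y n)) \<le> \<eta>
    \<and> (\<forall>i\<in>D. \<bar>(\<Sum>n\<in>B. (\<theta> n * f n (unit_vec j)) *\<^sub>R y n) i\<bar> \<le> \<tau>)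
    \<and> 1 / (4 * K) \<le> N (restrict_to D (\<Sum>n\<in>B. (\<theta> n * f n (unit_vec j)) *\<^sub>R y n))"
proof -
  define c where "c = 1 / (8 * K)"
  have c: "0 < c" using K_pos by (simp add: c_def)
  define \<tau>' where "\<tau>' = min \<tau> (c / (real (card J) + 1))"
  have t': "0 < \<tau>'" "\<tau>' \<le> \<tau>" "\<tau>' \<le> c / (real (card J) + 1)" using t c by (auto simp: \<tau>'_def)
  have g0: "0 < \<gamma>" using gamma_ge_1 by simp
  \<comment> \<open>The first bound lets the indices in \<open>T\<close> be dropped from the expansion, the second one makes the
    sum of the fourth powers at most \<open>\<tau>' ^ 4\<close>.\<close>
  define \<delta> where "\<delta> = min (\<eta> / (2 * (real (card T) + 1) * K)) (\<tau>' ^ 4 / (12 * \<gamma> * K ^ 4))"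
  have d: "0 < \<delta>" unfolding \<delta>_def using eta K_pos g0 t' by simp
  have d1: "\<delta> * (2 * (real (card T) + 1) * K) \<le> \<eta>"
    using K_pos min.cobounded1[of "\<eta> / (2 * (real (card T) + 1) * K)" "\<tau>' ^ 4 / (12 * \<gamma> * K ^ 4)"]
    unfolding \<delta>_def[symmetric] by (simp add: pos_le_divide_eq)
  have d2: "12 * \<gamma> * \<delta> * K ^ 4 \<le> \<tau>' ^ 4"
    using K_pos g0 min.cobounded2[of "\<eta> / (2 * (real (card T) + 1) * K)" "\<tau>' ^ 4 / (12 * \<gamma> * K ^ 4)"]
    unfolding \<delta>_def[symmetric] by (simp add: pos_le_divide_eq mult_ac)
  have "finite ({j. \<exists>n. \<delta> \<le> \<bar>f n (unit_vec j)\<bar>} \<union> J0)" using small[OF d] fin by simp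
  then obtain j where j: "j \<notin> {j. \<exists>n. \<delta> \<le> \<bar>f n (unit_vec j)\<bar>} \<union> J0"
    using ex_new_if_finite[OF infinite_UNIV_nat] by blast
  define b where "b n = f n (unit_vec j)" for n
  have b: "\<bar>b n\<bar> \<le> \<delta>" for n using j by (auto simp: b_def not_le intro: less_imp_le)
  have "\<forall>\<^sub>F m in sequentially. N (unit_vec j - (\<Sum>n<m. b n *\<^sub>R y n)) < \<eta> / 2"
    unfolding b_def using expansion[OF unit_vec_in] eta by (intro order_tendstoD(2)) auto
  then obtain m where m: "N (unit_vec j - (\<Sum>n<m. b n *\<^sub>R y n)) < \<eta> / 2" by (auto simp: eventually_sequentially)
  define B where "B = {..<m} - T"
  have B: "finite B" "B \<inter> T = {}" by (auto simp: B_def)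
  have approx: "N (unit_vec j - (\<Sum>n\<in>B. b n *\<^sub>R y n)) \<le> \<eta>"
  proof -
    have "(\<Sum>n<m. b n *\<^sub>R y n) = (\<Sum>n\<in>B. b n *\<^sub>R y n) + (\<Sum>n\<in>{..<m} \<inter> T. b n *\<^sub>R y n)"
      unfolding B_def using sum.Int_Diff[of "{..<m}" "\<lambda>n. b n *\<^sub>R y n" T] by (simp add: add.commute)
    then have "unit_vec j - (\<Sum>n\<in>B. b n *\<^sub>R y n)
        = (unit_vec j - (\<Sum>n<m. b n *\<^sub>R y n)) + (\<Sum>n\<in>{..<m} \<inter> T. b n *\<^sub>R y n)" by simp
    then have split: "N (unit_vec j - (\<Sum>n\<in>B. b n *\<^sub>R y n))
        \<le> N (unit_vec j - (\<Sum>n<m. b n *\<^sub>R y n)) + N (\<Sum>n\<in>{..<m} \<inter> T. b n *\<^sub>R y n)"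
      by (simp only:) (intro N_triangle V_diff unit_vec_in comb_in)
    have "N (\<Sum>n\<in>{..<m} \<inter> T. b n *\<^sub>R y n) \<le> (\<Sum>n\<in>{..<m} \<inter> T. N (b n *\<^sub>R y n))"
      by (intro N_sum V_scale y_in)
    also have "\<dots> \<le> (\<Sum>n\<in>{..<m} \<inter> T. \<delta> * K)"
      using b y_le d norm_nonneg[OF y_in] by (intro sum_mono) (auto simp: N_scale intro!: mult_mono)
    also have "\<dots> \<le> real (card T) * (\<delta> * K)"
      using d K_pos fin by (simp add: card_mono mult_right_mono)
    also have "\<dots> \<le> \<eta> / 2"
    proof -
      have "2 * (real (card T) * (\<delta> * K)) \<le> \<delta> * (2 * (real (card T) + 1) * K)"
        using d K_pos by (simp add: algebra_simps)
      with d1 show ?thesis by linarith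
    qed
    finally have "N (\<Sum>n\<in>{..<m} \<inter> T. b n *\<^sub>R y n) \<le> \<eta> / 2" .
    with split m show ?thesis by linarith
  qed
  let ?u = "\<lambda>\<theta>. \<Sum>n\<in>B. (\<theta> n * b n) *\<^sub>R y n"
  have uX: "?u \<theta> \<in> X" for \<theta> by (rule comb_in)
  have u_ap: "?u \<theta> i = (\<Sum>n\<in>B. \<theta> n * (b n * y n i))" for \<theta> i
    by (simp add: sum_fun_apply mult_ac)
  have big: "4 * c \<le> N (?u \<theta>)" if th: "\<forall>n. \<bar>\<theta> n\<bar> = 1" for \<theta>
  proof -
    have "1 = N (unit_vec j)" by (simp add: norm_unit_vec)
    also have "\<dots> \<le> N (\<Sum>n\<in>B. b n *\<^sub>R y n) + N (unit_vec j - (\<Sum>n\<in>B. b n *\<^sub>R y n))"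
      by (intro N_triangle_rev unit_vec_in comb_in)
    finally have "1 / 2 \<le> N (\<Sum>n\<in>B. b n *\<^sub>R y n)" using approx eta by linarith
    also have "\<dots> \<le> K * N (?u \<theta>)"
      using comb_mono[of B "\<lambda>n. n" b "\<lambda>n. \<theta> n * b n"] B th by (simp add: abs_mult)
    finally show ?thesis using K_pos by (simp add: c_def field_simps)
  qed
  have u_le: "N (?u \<theta>) \<le> K" if "\<forall>n. \<bar>\<theta> n\<bar> = 1" for \<theta>
    using multiplier[of "unit_vec j" B \<theta>] B that by (simp add: b_def norm_unit_vec)
  \<comment> \<open>The tails are controlled uniformly in the signs, so finitely many coordinates remain.\<close>
  have "(\<lambda>M. \<Sum>n\<in>B. \<bar>b n\<bar> * N (restrict_to {M..} (y n))) \<longlonglongrightarrow> (\<Sum>n\<in>B. \<bar>b n\<bar> * 0)"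
    by (intro tendsto_sum tendsto_mult tendsto_const norm_tail_tendsto_0 y_in)
  then have "\<forall>\<^sub>F M in sequentially. (\<Sum>n\<in>B. \<bar>b n\<bar> * N (restrict_to {M..} (y n))) < c"
    using c by (intro order_tendstoD(2)) auto
  then obtain M where M: "(\<Sum>n\<in>B. \<bar>b n\<bar> * N (restrict_to {M..} (y n))) < c" by (auto simp: eventually_sequentially)
  have tail: "N (restrict_to {M..} (?u \<theta>)) \<le> c" if th: "\<forall>n. \<bar>\<theta> n\<bar> = 1" for \<theta>
  proof -
    have "restrict_to {M..} (?u \<theta>) = (\<Sum>n\<in>B. (\<theta> n * b n) *\<^sub>R restrict_to {M..} (y n))"
      by (rule ext) (simp add: restrict_to_def sum_fun_apply)
    then have "N (restrict_to {M..} (?u \<theta>)) \<le> (\<Sum>n\<in>B. N ((\<theta> n * b n) *\<^sub>R restrict_to {M..} (y n)))"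
      by (simp only:) (intro N_sum V_scale restrict_in y_in)
    also have "\<dots> = (\<Sum>n\<in>B. \<bar>b n\<bar> * N (restrict_to {M..} (y n)))"
      using th by (intro sum.cong) (auto simp: N_scale abs_mult)
    finally show ?thesis using M by simp
  qed
  define J' where "J' = {..<M} \<union> J"
  have J': "finite J'" using fin by (simp add: J'_def)
  define \<sigma> where "\<sigma> i = (\<Sum>n\<in>B. (b n * y n i)\<^sup>2)" for i
  have sig0: "0 \<le> \<sigma> i" for i unfolding \<sigma>_def by (intro sum_nonneg) auto
  have sig: "\<sigma> i \<le> \<delta> * K\<^sup>2" for i
  proof -
    have "\<sigma> i = (\<Sum>n\<in>B. (\<bar>b n\<bar> * \<bar>y n i\<bar>) * \<bar>b n * y n i\<bar>)"
      unfolding \<sigma>_def by (intro sum.cong) (auto simp: power2_eq_square abs_mult[symmetric])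
    also have "\<dots> \<le> (\<Sum>n\<in>B. (\<delta> * K) * \<bar>b n * y n i\<bar>)"
      using b entry_y_le d by (intro sum_mono mult_right_mono mult_mono) auto
    also have "\<dots> = \<delta> * K * (\<Sum>n\<in>B. \<bar>b n * y n i\<bar>)" by (simp add: sum_distrib_left)
    also have "\<dots> \<le> \<delta> * K * (K * N (unit_vec j))"
      unfolding b_def using d K_pos B by (intro mult_left_mono coordinate_abs_sum_le) auto
    finally show ?thesis by (simp add: norm_unit_vec power2_eq_square mult_ac)
  qed
  have sig_sum: "(\<Sum>i\<in>J'. \<sigma> i) \<le> 4 * \<gamma> * K\<^sup>2"
  proof -
    obtain \<theta> :: "nat \<Rightarrow> real" where th: "\<forall>n. \<bar>\<theta> n\<bar> = 1"
      and le: "(\<Sum>i\<in>J'. 0\<^sup>2 + (\<Sum>n\<in>B. (b n * y n i)\<^sup>2)) \<le> (\<Sum>i\<in>J'. (0 + (\<Sum>n\<in>B. \<theta> n * (b n * y n i)))\<^sup>2)"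
      using second_moment_signs[OF B(1), where J = J' and s = "\<lambda>_. 0" and x = "\<lambda>n i. b n * y n i"] by (elim exE conjE)
    have "(\<Sum>i\<in>J'. \<sigma> i) \<le> (\<Sum>i\<in>J'. (?u \<theta> i)\<^sup>2)"
      using le unfolding u_ap \<sigma>_def by simp
    also have "\<dots> \<le> 4 * \<gamma> * (N (?u \<theta>))\<^sup>2" using uX J' by (rule sum_square_le)
    also have "\<dots> \<le> 4 * \<gamma> * K\<^sup>2"
      using u_le[OF th] norm_nonneg[OF uX] g0 by (intro mult_left_mono power_mono) auto
    finally show ?thesis .
  qed
  obtain \<theta> :: "nat \<Rightarrow> real" where th: "\<forall>n. \<bar>\<theta> n\<bar> = 1"
    and le: "(\<Sum>i\<in>J'. (0 + (\<Sum>n\<in>B. \<theta> n * (b n * y n i))) ^ 4)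
      \<le> (\<Sum>i\<in>J'. 0 ^ 4 + 6 * 0\<^sup>2 * (\<Sum>n\<in>B. (b n * y n i)\<^sup>2) + 3 * (\<Sum>n\<in>B. (b n * y n i)\<^sup>2)\<^sup>2)"
    using fourth_moment_signs[OF B(1), where J = J' and s = "\<lambda>_. 0" and x = "\<lambda>n i. b n * y n i"] by (elim exE conjE)
  have "(\<Sum>i\<in>J'. (?u \<theta> i) ^ 4) \<le> (\<Sum>i\<in>J'. 3 * (\<sigma> i)\<^sup>2)"
    using le unfolding u_ap \<sigma>_def by simp
  also have "\<dots> \<le> (\<Sum>i\<in>J'. 3 * (\<delta> * K\<^sup>2) * \<sigma> i)"
  proof (rule sum_mono)
    fix i
    have "\<sigma> i * \<sigma> i \<le> \<delta> * K\<^sup>2 * \<sigma> i" using sig sig0 by (rule mult_right_mono)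
    then show "3 * (\<sigma> i)\<^sup>2 \<le> 3 * (\<delta> * K\<^sup>2) * \<sigma> i" by (simp add: power2_eq_square[of "\<sigma> i"])
  qed
  also have "\<dots> = 3 * (\<delta> * K\<^sup>2) * (\<Sum>i\<in>J'. \<sigma> i)" by (simp add: sum_distrib_left)
  also have "\<dots> \<le> 3 * (\<delta> * K\<^sup>2) * (4 * \<gamma> * K\<^sup>2)" using sig_sum d by (intro mult_left_mono) auto
  also have "\<dots> = 12 * \<gamma> * \<delta> * K ^ 4" by (simp add: power2_eq_square power4_eq_xxxx)
  also note d2
  finally have fourth: "(\<Sum>i\<in>J'. (?u \<theta> i) ^ 4) \<le> \<tau>' ^ 4" .
  have flat: "\<bar>?u \<theta> i\<bar> \<le> \<tau>'" if "i \<in> J'" for i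
  proof -
    have "(?u \<theta> i) ^ 4 \<le> (\<Sum>i\<in>J'. (?u \<theta> i) ^ 4)"
      using that J' by (intro member_le_sum) (auto simp: zero_le_even_power)
    with fourth have "\<bar>?u \<theta> i\<bar> ^ 4 \<le> \<tau>' ^ 4" by (simp add: power_even_abs)
    moreover have "0 \<le> \<tau>'" "(0::nat) < 4" using t' by auto
    ultimately show ?thesis using power_mono_iff[OF abs_ge_zero] by blast
  qed
  define D where "D = {..<M} - J"
  have "2 * c \<le> N (restrict_to D (?u \<theta>))"
    unfolding D_def
  proof (rule finite_piece[OF uX fin(3) c big[OF th] _ tail[OF th]])
    fix i assume "i \<in> J"
    then show "\<bar>?u \<theta> i\<bar> \<le> c / (real (card J) + 1)" using flat[of i] t' by (auto simp: J'_def)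
  qed
  then have "1 / (4 * K) \<le> N (restrict_to D (?u \<theta>))" by (simp add: c_def)
  moreover have "\<forall>i\<in>D. \<bar>?u \<theta> i\<bar> \<le> \<tau>"
  proof
    fix i assume "i \<in> D"
    then have "i \<in> J'" by (simp add: D_def J'_def)
    from flat[OF this] t' show "\<bar>?u \<theta> i\<bar> \<le> \<tau>" by linarith
  qed
  moreover have "finite D" "D \<inter> J = {}" by (auto simp: D_def)
  ultimately show ?thesis
    using j B th approx unfolding b_def
    by (intro exI[of _ j] exI[of _ B] exI[of _ \<theta>] exI[of _ D]) simp
qed

text \<open>
  If the coefficients tended to \<open>0\<close>, expansions of many unit vectors could be signed into flat disjoint pieces. Their sum
  would have norm proportional to their number, but unconditionality compares it to a sum
  of unit vectors, which is of smaller order.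
\<close>

lemma large_coefficients_exist:
  assumes small: "\<And>\<delta>. 0 < \<delta> \<Longrightarrow> finite {j. \<exists>n. \<delta> \<le> \<bar>f n (unit_vec j)\<bar>}"
  shows False
proof -
  define \<epsilon> where "\<epsilon> = min (1 / 2) (\<kappa> / (64 * K\<^sup>2))"
  have e: "0 < \<epsilon>" "\<epsilon> \<le> 1 / 2" using kappa_pos K_pos by (auto simp: \<epsilon>_def)
  have "\<epsilon> \<le> \<kappa> / (64 * K\<^sup>2)" unfolding \<epsilon>_def by (rule min.cobounded2)
  then have eK: "64 * (K\<^sup>2 * \<epsilon>) \<le> \<kappa>" using K_pos by (simp add: field_simps)
  obtain h where h: "\<And>B. finite B \<Longrightarrow> h \<le> card B \<Longrightarrow> N (\<Sum>j\<in>B. unit_vec j) \<le> \<epsilon> * real (card B)"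
    using fundamental_function_sublinear[OF e(1)] by blast
  obtain h2 :: nat where h2: "2 / \<kappa> < h2" using reals_Archimedean2 by blast
  define n where "n = h + h2 + 1"
  have n: "h \<le> n" "0 < n" by (auto simp: n_def)
  have "2 / \<kappa> \<le> real n" using h2 by (simp add: n_def)
  then have n2: "2 \<le> \<kappa> * real n" using kappa_pos by (simp add: field_simps)
  have c0: "0 < 1 / (4 * K)" using K_pos by simp
  obtain \<tau> where t: "0 < \<tau>"
    and flat_bound: "\<And>w D R. (\<And>k. k < n \<Longrightarrow> w k \<in> X) \<Longrightarrow> (\<And>k. k < n \<Longrightarrow> finite (D k)) \<Longrightarrow>
      (\<And>k i. k < n \<Longrightarrow> i \<in> D k \<Longrightarrow> \<bar>w k i\<bar> \<le> \<tau>) \<Longrightarrow>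
      (\<And>k. k < n \<Longrightarrow> 1 / (4 * K) \<le> N (restrict_to (D k) (w k))) \<Longrightarrow>
      (\<And>k l. k < n \<Longrightarrow> l < n \<Longrightarrow> k \<noteq> l \<Longrightarrow> D k \<inter> D l = {}) \<Longrightarrow>
      (\<And>\<theta>. (\<forall>k. \<bar>\<theta> k\<bar> = 1) \<Longrightarrow> N (\<Sum>k<n. \<theta> k *\<^sub>R w k) \<le> R) \<Longrightarrow>
      1 / (4 * K) * \<kappa> / 4 * real n \<le> R"
    by (erule flat_pieces_lower_bound[OF c0 n2])
  \<comment> \<open>A candidate consists of \<open>j\<close>, \<open>B\<close>, the signs and \<open>D\<close>; the first, second and fourth of these
    have to be disjoint for different candidates.\<close>
  define u where "u p = (case p of (j, B, \<theta>, D) \<Rightarrow> \<Sum>m\<in>B. (\<theta> m * f m (unit_vec j)) *\<^sub>R y m)"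
    for p :: "nat \<times> nat set \<times> (nat \<Rightarrow> real) \<times> nat set"
  define P where "P p \<longleftrightarrow> (case p of (j, B, \<theta>, D) \<Rightarrow> finite B \<and> finite D \<and> (\<forall>m. \<bar>\<theta> m\<bar> = 1)
      \<and> N (unit_vec j - (\<Sum>m\<in>B. f m (unit_vec j) *\<^sub>R y m)) \<le> \<epsilon>
      \<and> (\<forall>i\<in>D. \<bar>u p i\<bar> \<le> \<tau>) \<and> 1 / (4 * K) \<le> N (restrict_to D (u p)))"
    for p :: "nat \<times> nat set \<times> (nat \<Rightarrow> real) \<times> nat set"
  define foot :: "nat \<times> nat set \<times> (nat \<Rightarrow> real) \<times> nat set \<Rightarrow> (nat + nat + nat) set"
    where "foot p = (case p of (j, B, \<theta>, D) \<Rightarrow> insert (Inl j) ((Inr \<circ> Inl) ` B \<union> (Inr \<circ> Inr) ` D))" for p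
  have step: "\<exists>p. P p \<and> finite (foot p) \<and> foot p \<inter> Y = {}" if Y: "finite Y" for Y
  proof -
    have fin: "finite (Inl -` Y)" "finite ((Inr \<circ> Inl) -` Y)" "finite ((Inr \<circ> Inr) -` Y)"
      using Y by (auto intro!: finite_vimageI simp: inj_on_def)
    have "\<exists>j B \<theta> D. j \<notin> Inl -` Y \<and> finite B \<and> B \<inter> (Inr \<circ> Inl) -` Y = {} \<and> finite D
      \<and> D \<inter> (Inr \<circ> Inr) -` Y = {} \<and> (\<forall>n. \<bar>\<theta> n\<bar> = (1::real))
      \<and> N (unit_vec j - (\<Sum>n\<in>B. f n (unit_vec j) *\<^sub>R y n)) \<le> \<epsilon>
      \<and> (\<forall>i\<in>D. \<bar>(\<Sum>n\<in>B. (\<theta> n * f n (unit_vec j)) *\<^sub>R y n) i\<bar> \<le> \<tau>)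
      \<and> 1 / (4 * K) \<le> N (restrict_to D (\<Sum>n\<in>B. (\<theta> n * f n (unit_vec j)) *\<^sub>R y n))"
      by (rule signed_expansion_with_flat_piece[OF _ t e fin]) (rule small)
    then obtain j B \<theta> D where p: "j \<notin> Inl -` Y" "finite B" "B \<inter> (Inr \<circ> Inl) -` Y = {}" "finite D"
      "D \<inter> (Inr \<circ> Inr) -` Y = {}" "\<forall>n. \<bar>\<theta> n\<bar> = (1::real)"
      "N (unit_vec j - (\<Sum>n\<in>B. f n (unit_vec j) *\<^sub>R y n)) \<le> \<epsilon>"
      "\<forall>i\<in>D. \<bar>(\<Sum>n\<in>B. (\<theta> n * f n (unit_vec j)) *\<^sub>R y n) i\<bar> \<le> \<tau>"
      "1 / (4 * K) \<le> N (restrict_to D (\<Sum>n\<in>B. (\<theta> n * f n (unit_vec j)) *\<^sub>R y n))"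
      by (elim exE conjE)
    have "P (j, B, \<theta>, D)" unfolding P_def u_def prod.case using p by (intro conjI)
    moreover have "finite (foot (j, B, \<theta>, D))" "foot (j, B, \<theta>, D) \<inter> Y = {}"
      using p(1-5) by (auto simp: foot_def)
    ultimately show ?thesis by blast
  qed
  have "\<exists>s. (\<forall>k<n. P (s k) \<and> finite (foot (s k))) \<and>
      (\<forall>k<n. \<forall>l<n. k \<noteq> l \<longrightarrow> foot (s k) \<inter> foot (s l) = {})"
    by (rule disjoint_selection) (rule step)
  then obtain s where s: "\<forall>k<n. P (s k) \<and> finite (foot (s k))"
    and dis: "\<forall>k<n. \<forall>l<n. k \<noteq> l \<longrightarrow> foot (s k) \<inter> foot (s l) = {}" by (elim exE conjE)
  define j where "j k = fst (s k)" for k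
  define B where "B k = fst (snd (s k))" for k
  define \<phi> where "\<phi> k = fst (snd (snd (s k)))" for k
  define D where "D k = snd (snd (snd (s k)))" for k
  define b where "b k m = f m (unit_vec (j k))" for k m
  have sk: "s k = (j k, B k, \<phi> k, D k)" for k by (simp add: j_def B_def \<phi>_def D_def)
  have us: "u (s k) = (\<Sum>m\<in>B k. (\<phi> k m * b k m) *\<^sub>R y m)" for k by (simp add: sk u_def b_def)
  have Pk: "finite (B k)" "finite (D k)" "\<And>m. \<bar>\<phi> k m\<bar> = 1"
      "N (unit_vec (j k) - (\<Sum>m\<in>B k. b k m *\<^sub>R y m)) \<le> \<epsilon>"
      "\<And>i. i \<in> D k \<Longrightarrow> \<bar>u (s k) i\<bar> \<le> \<tau>" "1 / (4 * K) \<le> N (restrict_to (D k) (u (s k)))" if "k < n" for k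
  proof -
    have "P (j k, B k, \<phi> k, D k)" using s that by (simp add: sk[symmetric])
    then show "finite (B k)" "finite (D k)" "\<And>m. \<bar>\<phi> k m\<bar> = 1"
      "N (unit_vec (j k) - (\<Sum>m\<in>B k. b k m *\<^sub>R y m)) \<le> \<epsilon>"
      "\<And>i. i \<in> D k \<Longrightarrow> \<bar>u (s k) i\<bar> \<le> \<tau>" "1 / (4 * K) \<le> N (restrict_to (D k) (u (s k)))"
      unfolding P_def prod.case by (auto simp: b_def sk)
  qed
  have disk: "j k \<noteq> j l" "B k \<inter> B l = {}" "D k \<inter> D l = {}" if "k < n" "l < n" "k \<noteq> l" for k l
  proof -
    have *: "foot (j k, B k, \<phi> k, D k) \<inter> foot (j l, B l, \<phi> l, D l) = {}" using dis that by (simp add: sk[symmetric])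
    then show "j k \<noteq> j l" "B k \<inter> B l = {}" "D k \<inter> D l = {}" unfolding foot_def prod.case by auto
  qed
  define U where "U = (\<Union>k<n. B k)"
  have U: "finite U" using Pk(1) by (auto simp: U_def)
  define idx where "idx m = (SOME k. k < n \<and> m \<in> B k)" for m
  have idx: "idx m = k" if "k < n" "m \<in> B k" for k m
  proof -
    have "idx m < n \<and> m \<in> B (idx m)" unfolding idx_def
      by (rule someI[of "\<lambda>k. k < n \<and> m \<in> B k" k]) (use that in simp)
    then show ?thesis using disk(2)[of "idx m" k] that by blast
  qed
  have blocks: "(\<Sum>m\<in>U. g (idx m) m *\<^sub>R y m) = (\<Sum>k<n. \<Sum>m\<in>B k. g k m *\<^sub>R y m)" for g
  proof -
    have "(\<Sum>m\<in>U. g (idx m) m *\<^sub>R y m) = (\<Sum>k<n. \<Sum>m\<in>B k. g (idx m) m *\<^sub>R y m)"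
      unfolding U_def using Pk(1) disk(2) by (intro sum.UNION_disjoint) auto
    also have "\<dots> = (\<Sum>k<n. \<Sum>m\<in>B k. g k m *\<^sub>R y m)"
      using idx by (intro sum.cong refl) auto
    finally show ?thesis .
  qed
  define G where "G = (\<Sum>m\<in>U. b (idx m) m *\<^sub>R y m)"
  have G_le: "N G \<le> 2 * \<epsilon> * real n"
  proof -
    have inj: "inj_on j {..<n}" by (rule inj_onI) (use disk(1) in auto)
    have EX: "(\<Sum>k<n. unit_vec (j k)) \<in> X" by (intro V_sum unit_vec_in)
    have GX: "G \<in> X" unfolding G_def by (rule comb_in)
    have "(\<Sum>k<n. unit_vec (j k)) - G = (\<Sum>k<n. unit_vec (j k) - (\<Sum>m\<in>B k. b k m *\<^sub>R y m))"
      unfolding G_def blocks[of b] by (simp add: sum_subtractf)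
    then have "N ((\<Sum>k<n. unit_vec (j k)) - G) \<le> (\<Sum>k<n. N (unit_vec (j k) - (\<Sum>m\<in>B k. b k m *\<^sub>R y m)))"
      by (simp only:) (intro N_sum V_diff unit_vec_in comb_in)
    also have "\<dots> \<le> (\<Sum>k<n. \<epsilon>)" using Pk(4) by (intro sum_mono) auto
    finally have 1: "N ((\<Sum>k<n. unit_vec (j k)) - G) \<le> \<epsilon> * real n" by (simp add: mult.commute)
    have "N (\<Sum>k<n. unit_vec (j k)) = N (\<Sum>i\<in>j ` {..<n}. unit_vec i)" using inj by (simp add: sum.reindex)
    also have "\<dots> \<le> \<epsilon> * real n" using h[of "j ` {..<n}"] inj n by (simp add: card_image)
    finally show ?thesis using N_triangle_rev[OF GX EX] N_commute[OF GX EX] 1 by simp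
  qed
  have "1 / (4 * K) * \<kappa> / 4 * real n \<le> K * N G"
  proof (rule flat_bound[of "\<lambda>k. u (s k)" D])
    show "u (s k) \<in> X" for k unfolding us by (rule comb_in)
    fix \<theta> :: "nat \<Rightarrow> real" assume th: "\<forall>k. \<bar>\<theta> k\<bar> = 1"
    have "(\<Sum>k<n. \<theta> k *\<^sub>R u (s k)) = (\<Sum>k<n. \<Sum>m\<in>B k. (\<theta> k * (\<phi> k m * b k m)) *\<^sub>R y m)"
      unfolding us by (simp add: scaleR_sum_right)
    also have "\<dots> = (\<Sum>m\<in>U. (\<theta> (idx m) * (\<phi> (idx m) m * b (idx m) m)) *\<^sub>R y m)"
      by (rule blocks[of "\<lambda>k m. \<theta> k * (\<phi> k m * b k m)", symmetric])
    finally have eq: "(\<Sum>k<n. \<theta> k *\<^sub>R u (s k))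
      = (\<Sum>m\<in>U. (\<theta> (idx m) * (\<phi> (idx m) m * b (idx m) m)) *\<^sub>R y m)" .
    show "N (\<Sum>k<n. \<theta> k *\<^sub>R u (s k)) \<le> K * N G"
      unfolding eq G_def
    proof (rule comb_mono[OF U, of "\<lambda>m. m"])
      fix m assume "m \<in> U"
      then obtain k where k: "k < n" "m \<in> B k" by (auto simp: U_def)
      then have "idx m = k" by (rule idx)
      then show "\<bar>\<theta> (idx m) * (\<phi> (idx m) m * b (idx m) m)\<bar> \<le> \<bar>b (idx m) m\<bar>"
        using th Pk(3)[OF k(1)] by (simp add: abs_mult)
    qed simp
  qed (use Pk disk in auto)
  also have "\<dots> \<le> K * (2 * \<epsilon> * real n)" using G_le K_pos by (intro mult_left_mono) auto
  finally have "\<kappa> \<le> 32 * (K\<^sup>2 * \<epsilon>)" using n K_pos by (simp add: field_simps power2_eq_square)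
  moreover have "0 < K\<^sup>2 * \<epsilon>" using e K_pos by simp
  ultimately show False using eK by linarith
qed

lemma equivalent_to_unit_vec: "equivalent_bases N unit_vec y"
proof (cases "\<exists>\<delta>>0. \<forall>n. \<exists>j. \<delta> \<le> \<bar>y n j * f n (unit_vec j)\<bar>")
  case True
  then obtain \<delta> where "0 < \<delta>" "\<And>n. \<exists>j. \<delta> \<le> \<bar>y n j * f n (unit_vec j)\<bar>" by blast
  then show ?thesis by (rule equivalent_if_peaks)
next
  case False
  then have flat: "\<exists>n. \<forall>j. \<bar>y n j * f n (unit_vec j)\<bar> < \<delta>" if "0 < \<delta>" for \<delta>
    using that by (meson not_le)
  obtain c where c: "0 < c"
    "\<And>A. finite A \<Longrightarrow> 2 \<le> \<kappa> * real (card A) \<Longrightarrow> c * real (card A) \<le> N (\<Sum>n\<in>A. y n)"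
    using linear_growth_if_no_peaks[OF flat] by blast
  have "finite {j. \<exists>n. \<delta> \<le> \<bar>f n (unit_vec j)\<bar>}" if "0 < \<delta>" for \<delta>
    using c that by (rule finite_large_coefficients)
  then show ?thesis using large_coefficients_exist by blast
qed

end

theorem (in near_linear_orlicz) unique_greedy_basis: "has_unique_greedy_basis X N"
  unfolding has_unique_greedy_basis_def
proof (intro exI[of _ unit_vec] conjI allI impI greedy_basis_unit_vec semi_normalized_unit_vec)
  fix y assume y: "greedy_basis X N y \<and> semi_normalized N y"
  interpret greedy_basis_of X N y
    by unfold_locales (use y in auto)
  obtain K where "unconditional_democratic_basis X N y (basis_coeff N y) K"
    using unconditional_democratic by blast
  then interpret near_linear_orlicz_basis F \<kappa> \<gamma> y "basis_coeff N y" K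
    by (intro near_linear_orlicz_basis.intro near_linear_orlicz_axioms)
  show "equivalent_bases N unit_vec y" by (rule equivalent_to_unit_vec)
qed

section \<open>The Orlicz function of the theorem\<close>

text \<open>
  The derivative yields convexity on the open half-line only; a chord starting at \<open>0\<close> is handled by
  the star-shape inequality.
\<close>

lemma convex_on_atLeast_0I:
  fixes F :: "real \<Rightarrow> real"
  assumes pos: "convex_on {0<..} F" and zero: "F 0 = 0"
    and star: "\<And>l u. 0 < l \<Longrightarrow> l < 1 \<Longrightarrow> 0 < u \<Longrightarrow> F (l * u) \<le> l * F u"
  shows "convex_on {0..} F"
proof (rule convex_on_linorderI)
  fix t x y :: real
  assume t: "0 < t" "t < 1" and x: "x \<in> {0..}" and y: "y \<in> {0..}" and "x < y"
  show "F ((1 - t) *\<^sub>R x + t *\<^sub>R y) \<le> (1 - t) * F x + t * F y"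
  proof (cases "x = 0")
    case True
    then show ?thesis using star[of t y] t zero \<open>x < y\<close> by simp
  next
    case False
    then show ?thesis using convex_onD[OF pos, of t x y] x t \<open>x < y\<close> by simp
  qed
qed simp

lemma less_inv_e_iff: "0 < t \<Longrightarrow> t < 1 / exp 1 \<longleftrightarrow> 1 < - ln t" for t :: real
  using exp_less_cancel_iff[of "ln t" "-1"] by (simp add: exp_minus field_simps del: exp_less_cancel_iff)

lemma inv_e_powr: "(1 / exp 1) powr b = exp (- b)" for b :: real
  by (simp add: powr_def ln_div)

context
  fixes a :: real
  assumes a: "0 < a"
begin

text \<open>The quotient of \<open>orlicz_F1 a t\<close> by \<open>t\<close>, for positive \<open>t\<close>.\<close>

definition F1_slope :: "real \<Rightarrow> real" where
  "F1_slope t = (if t < 1 / exp 1 then exp (- a) * (- ln t) powr (- a) else t powr a)"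

text \<open>
  The one-sided derivatives agree at \<open>1 / exp 1\<close>, so the function is differentiable on the open half-line
  and its convexity is the monotonicity of this derivative.
\<close>

definition F1_deriv :: "real \<Rightarrow> real" where
  "F1_deriv t = (if t < 1 / exp 1 then exp (- a) * ((- ln t) powr (- a) + a * (- ln t) powr (- a - 1))
     else (1 + a) * t powr a)"

lemma F1_eq_slope: "0 < t \<Longrightarrow> orlicz_F1 a t = t * F1_slope t"
  by (simp add: orlicz_F1_def F1_slope_def powr_add)

lemma powr_small_le_1: "1 \<le> L \<Longrightarrow> 0 \<le> b \<Longrightarrow> L powr (- b) \<le> 1" for L b :: real
  using powr_mono[of "- b" 0 L] by simp

lemma inv_e_le_powr: assumes "1 / exp 1 \<le> t" shows "exp (- a) \<le> t powr a"
proof -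
  have "(1 / exp 1) powr a \<le> t powr a" using assms a by (intro powr_mono2) auto
  then show ?thesis by (simp only: inv_e_powr)
qed

lemma F1_slope_mono: assumes "0 < s" "s \<le> t" shows "F1_slope s \<le> F1_slope t"
proof (cases "t < 1 / exp 1")
  case True
  then have "1 < - ln t" "- ln t \<le> - ln s" "s < 1 / exp 1" using assms less_inv_e_iff[of t] by auto
  then show ?thesis using True a by (simp add: F1_slope_def powr_mono2')
next
  case t: False
  show ?thesis
  proof (cases "s < 1 / exp 1")
    case True
    then have "1 < - ln s" using assms less_inv_e_iff[of s] by auto
    then have "exp (- a) * (- ln s) powr (- a) \<le> exp (- a) * 1"
      using a by (intro mult_left_mono powr_small_le_1) auto
    also have "\<dots> \<le> t powr a" using t inv_e_le_powr[of t] by simp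
    finally show ?thesis using True t by (simp add: F1_slope_def)
  next
    case False
    then show ?thesis using t assms a by (simp add: F1_slope_def powr_mono2)
  qed
qed

lemma F1_deriv_mono: assumes "0 < s" "s \<le> t" shows "F1_deriv s \<le> F1_deriv t"
proof (cases "t < 1 / exp 1")
  case True
  then have "1 < - ln t" "- ln t \<le> - ln s" "s < 1 / exp 1" using assms less_inv_e_iff[of t] by auto
  then have "(- ln s) powr (- a) \<le> (- ln t) powr (- a)" "(- ln s) powr (- a - 1) \<le> (- ln t) powr (- a - 1)"
    using a by (auto intro!: powr_mono2')
  then show ?thesis using True \<open>s < 1 / exp 1\<close> a
    by (simp add: F1_deriv_def add_mono mult_left_mono)
next
  case t: False
  show ?thesis
  proof (cases "s < 1 / exp 1")
    case True
    then have L: "1 < - ln s" using assms less_inv_e_iff[of s] by auto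
    have "(- ln s) powr (- a) \<le> 1" "(- ln s) powr (- (a + 1)) \<le> 1"
      using a L by (auto intro!: powr_small_le_1 simp del: minus_add_distrib)
    moreover have "- a - 1 = - (a + 1)" by simp
    ultimately have "(- ln s) powr (- a) + a * (- ln s) powr (- a - 1) \<le> 1 + a * 1"
      using a by (intro add_mono mult_left_mono) (simp_all only: less_imp_le)
    then have "exp (- a) * ((- ln s) powr (- a) + a * (- ln s) powr (- a - 1)) \<le> exp (- a) * (1 + a)"
      by simp
    also have "\<dots> \<le> t powr a * (1 + a)" using t a inv_e_le_powr[of t] by (intro mult_right_mono) auto
    finally show ?thesis using True t by (simp add: F1_deriv_def mult.commute)
  next
    case False
    then show ?thesis using t assms a by (simp add: F1_deriv_def powr_mono2)
  qed
qed

lemma F1_left_deriv: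
  assumes "0 < t" "t < 1"
  shows "((\<lambda>t. exp (- a) * t * (- ln t) powr (- a)) has_real_derivative
    exp (- a) * ((- ln t) powr (- a) + a * (- ln t) powr (- a - 1))) (at t)"
proof -
  have L: "0 < - ln t" using assms by simp
  show ?thesis
    by (rule derivative_eq_intros refl | use assms L in \<open>simp; fail\<close>)+
      (use assms L in \<open>simp add: field_simps powr_diff\<close>)
qed

lemma F1_right_deriv:
  assumes "0 < t"
  shows "((\<lambda>t. t powr (1 + a)) has_real_derivative (1 + a) * t powr a) (at t)"
  using has_real_derivative_powr[OF assms, of "1 + a"] by simp

lemma F1_has_deriv:
  assumes t: "0 < t"
  shows "(orlicz_F1 a has_real_derivative F1_deriv t) (at t)"
proof -
  let ?P = "\<lambda>t. exp (- a) * t * (- ln t) powr (- a)" and ?Q = "\<lambda>t. t powr (1 + a)"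
  let ?e = "1 / exp 1 :: real"
  have e: "0 < ?e" "?e < 1" by auto
  consider "t < ?e" | "?e < t" | "t = ?e" by linarith
  then show ?thesis
  proof cases
    case 1
    have "(?P has_real_derivative F1_deriv t) (at t)"
      using F1_left_deriv[of t] 1 t e by (simp add: F1_deriv_def)
    then show ?thesis
    proof (rule has_field_derivative_transform_within_open[of _ _ _ "{0<..<?e}"])
      show "?P s = orlicz_F1 a s" if "s \<in> {0<..<?e}" for s using that by (simp add: orlicz_F1_def)
    qed (use 1 t in auto)
  next
    case 2
    have "(?Q has_real_derivative F1_deriv t) (at t)"
      using F1_right_deriv[of t] 2 t by (simp add: F1_deriv_def)
    then show ?thesis
    proof (rule has_field_derivative_transform_within_open[of _ _ _ "{?e<..}"])
      show "?Q s = orlicz_F1 a s" if "s \<in> {?e<..}" for s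
        using that less_trans[OF e(1), of s] by (auto simp: orlicz_F1_def)
    qed (use 2 in auto)
  next
    case 3
    have lne: "- ln ?e = 1" by (simp add: ln_div)
    have P: "(?P has_real_derivative F1_deriv t) (at t)"
      using F1_left_deriv[of t] t e unfolding 3 lne
      by (simp add: F1_deriv_def inv_e_powr mult.commute)
    have Q: "(?Q has_real_derivative F1_deriv t) (at t)"
      using F1_right_deriv[of t] t unfolding 3 by (simp add: F1_deriv_def)
    have Ft: "orlicz_F1 a t = ?Q t" unfolding 3 using e by (simp add: orlicz_F1_def)
    have PQ: "?P t = ?Q t" unfolding 3 lne inv_e_powr by (simp add: exp_add[symmetric] exp_minus field_simps)
    let ?q = "\<lambda>f s. (f s - f t) / (s - t)"
    have "(?q (orlicz_F1 a) \<longlongrightarrow> F1_deriv t) (at_left t)"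
    proof (rule Lim_transform_eventually)
      show "(?q ?P \<longlongrightarrow> F1_deriv t) (at_left t)"
        using P unfolding has_field_derivative_iff by (rule filterlim_mono) (auto intro: at_le)
      have "orlicz_F1 a s = ?P s" if "0 < s" "s < t" for s using that 3 by (simp add: orlicz_F1_def)
      then show "\<forall>\<^sub>F s in at_left t. ?q ?P s = ?q (orlicz_F1 a) s"
        unfolding eventually_at_left[OF t] using t Ft PQ by (intro exI[of _ 0]) auto
    qed
    moreover have "(?q (orlicz_F1 a) \<longlongrightarrow> F1_deriv t) (at_right t)"
    proof (rule Lim_transform_eventually)
      show "(?q ?Q \<longlongrightarrow> F1_deriv t) (at_right t)"
        using Q unfolding has_field_derivative_iff by (rule filterlim_mono) (auto intro: at_le)
      have "orlicz_F1 a s = ?Q s" if "t < s" for s using that 3 less_trans[OF t, of s] by (auto simp: orlicz_F1_def)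
      then show "\<forall>\<^sub>F s in at_right t. ?q ?Q s = ?q (orlicz_F1 a) s"
        unfolding eventually_at_right[OF less_add_one] using Ft by (intro exI[of _ "t + 1"]) auto
    qed
    ultimately show ?thesis
      unfolding has_field_derivative_iff by (rule filterlim_split_at)
  qed
qed

lemma F1_zero: "orlicz_F1 a 0 = 0"
  by (simp add: orlicz_F1_def)

lemma F1_star: "0 < l \<Longrightarrow> l < 1 \<Longrightarrow> 0 < u \<Longrightarrow> orlicz_F1 a (l * u) \<le> l * orlicz_F1 a u"
  using F1_slope_mono[of "l * u" u] by (simp add: F1_eq_slope mult.assoc mult_left_mono)

lemma F1_convex: "convex_on {0..} (orlicz_F1 a)"
proof (rule convex_on_atLeast_0I)
  show "convex_on {0<..} (orlicz_F1 a)"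
    by (rule convex_on_realI[where f' = F1_deriv]) (auto intro: F1_has_deriv F1_deriv_mono)
qed (use F1_zero F1_star in auto)

lemma F1_near_zero: "0 < s \<Longrightarrow> 1 < - ln s \<Longrightarrow> orlicz_F1 a s = exp (- a) * s * (- ln s) powr (- a)"
  using less_inv_e_iff[of s] by (simp add: orlicz_F1_def)

text \<open>
  Dividing a number below \<open>1 / h\<close> by \<open>h\<close> at most doubles its negated logarithm, which costs the factor
  \<open>2 powr (- a)\<close>.
\<close>

lemma F1_almost_linear:
  assumes h: "1 \<le> h"
  shows "\<exists>\<tau>>0. \<forall>s. 0 \<le> s \<and> s \<le> \<tau> \<longrightarrow> 2 powr (- a) * orlicz_F1 a s / h \<le> orlicz_F1 a (s / h)"
proof (intro exI[of _ "exp (- (2 + ln h))"] conjI allI impI)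
  fix s assume s: "0 \<le> s \<and> s \<le> exp (- (2 + ln h))"
  show "2 powr (- a) * orlicz_F1 a s / h \<le> orlicz_F1 a (s / h)"
  proof (cases "s = 0")
    case False
    then have s0: "0 < s" using s by simp
    have "ln s \<le> - (2 + ln h)" using s s0 ln_le_cancel_iff[of s "exp (- (2 + ln h))"] by (simp del: ln_le_cancel_iff)
    then have L: "2 + ln h \<le> - ln s" by simp
    have lh: "0 \<le> ln h" "0 < h" using h by auto
    have L1: "1 < - ln s" using L lh(1) by linarith
    have lsh: "- ln (s / h) = - ln s + ln h" using s0 lh by (simp add: ln_div)
    have "2 powr (- a) * (- ln s) powr (- a) = (2 * (- ln s)) powr (- a)"
      by (rule powr_mult[symmetric])
    also have "\<dots> \<le> (- ln (s / h)) powr (- a)"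
    proof -
      have "0 < - ln s + ln h" using L lh(1) by linarith
      moreover have "- ln s + ln h \<le> 2 * (- ln s)" using L by linarith
      ultimately show ?thesis unfolding lsh using a by (intro powr_mono2') simp_all
    qed
    finally have *: "2 powr (- a) * (- ln s) powr (- a) \<le> (- ln (s / h)) powr (- a)" .
    have "2 powr (- a) * orlicz_F1 a s / h = exp (- a) * (s / h) * (2 powr (- a) * (- ln s) powr (- a))"
      using F1_near_zero[OF s0 L1] by simp
    also have "\<dots> \<le> exp (- a) * (s / h) * (- ln (s / h)) powr (- a)"
      using * s0 lh by (intro mult_left_mono) auto
    also have "\<dots> = orlicz_F1 a (s / h)"
    proof (rule F1_near_zero[symmetric])
      show "1 < - ln (s / h)" unfolding lsh using L1 lh(1) by linarith
    qed (use s0 lh in simp)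
    finally show ?thesis .
  qed (simp add: F1_zero)
qed simp

text \<open>The slope \<open>exp (- a) * (- ln s) powr (- a)\<close> tends to \<open>0\<close>; it is below \<open>\<epsilon>\<close> once \<open>- ln s\<close> exceeds
  \<open>\<epsilon> powr (- 1 / a)\<close>.\<close>

lemma F1_sublinear:
  assumes e: "0 < \<epsilon>"
  shows "\<exists>\<tau>>0. \<forall>s. 0 \<le> s \<and> s \<le> \<tau> \<longrightarrow> orlicz_F1 a s \<le> \<epsilon> * s"
proof -
  define M where "M = max 2 (\<epsilon> powr (- 1 / a))"
  have M: "2 \<le> M" "\<epsilon> powr (- 1 / a) \<le> M" by (auto simp: M_def)
  show ?thesis
  proof (intro exI[of _ "exp (- M)"] conjI allI impI)
    fix s assume s: "0 \<le> s \<and> s \<le> exp (- M)"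
    show "orlicz_F1 a s \<le> \<epsilon> * s"
    proof (cases "s = 0")
      case False
      then have s0: "0 < s" using s by simp
      have "ln s \<le> - M" using s s0 ln_le_cancel_iff[of s "exp (- M)"] by (simp del: ln_le_cancel_iff)
      then have L: "M \<le> - ln s" by simp
      have "(- ln s) powr (- a) \<le> (\<epsilon> powr (- 1 / a)) powr (- a)"
        using L M e a by (intro powr_mono2') auto
      also have "\<dots> = \<epsilon>" using e a by (simp add: powr_powr)
      finally have le: "(- ln s) powr (- a) \<le> \<epsilon>" .
      have "exp (- a) * (- ln s) powr (- a) \<le> 1 * \<epsilon>"
        using le a by (intro mult_mono) auto
      then have "s * (exp (- a) * (- ln s) powr (- a)) \<le> s * \<epsilon>"
        using s0 by (intro mult_left_mono) auto
      then show ?thesis using s0 L M by (simp add: F1_near_zero mult_ac)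
    qed (simp add: F1_zero)
  qed simp
qed

text \<open>With \<open>L = - ln t\<close> the inequality \<open>L / a \<le> exp (L / a)\<close> gives \<open>t * L powr a \<le> a powr a\<close>.\<close>

lemma square_le_F1:
  assumes t: "0 \<le> t" "t \<le> 1"
  shows "t\<^sup>2 \<le> (exp a * max 1 (a powr a)) * orlicz_F1 a t"
proof (cases "t = 0")
  case False
  then have t0: "0 < t" using t by simp
  have "t \<le> (exp a * max 1 (a powr a)) * F1_slope t"
  proof (cases "t < 1 / exp 1")
    case True
    define L where "L = - ln t"
    have L: "1 < L" using less_inv_e_iff[OF t0] True by (simp add: L_def)
    have tL: "t = exp (- L)" using t0 by (simp add: L_def)
    have "L / a \<le> exp (L / a)" using exp_ge_add_one_self[of "L / a"] by linarith
    then have "(L / a) powr a \<le> exp (L / a) powr a" using L a by (intro powr_mono2) auto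
    also have "\<dots> = exp L" using a by (simp add: powr_def)
    finally have "L powr a \<le> a powr a * exp L" using L a by (simp add: powr_divide field_simps)
    then have "exp (- L) * L powr a \<le> a powr a" by (simp add: exp_minus field_simps)
    also have "\<dots> \<le> max 1 (a powr a)" by simp
    finally have "exp (- L) \<le> max 1 (a powr a) * L powr (- a)"
      using L by (simp add: powr_minus field_simps)
    also have "\<dots> = (exp a * max 1 (a powr a)) * F1_slope t"
      using True by (simp add: F1_slope_def L_def exp_minus)
    finally show ?thesis by (simp only: tL[symmetric])
  next
    case False
    have "t * 1 \<le> exp a * t powr a"
    proof -
      have "exp a * exp (- a) \<le> exp a * t powr a" using False inv_e_le_powr[of t] by (intro mult_left_mono) auto
      then show ?thesis using t by (simp add: exp_minus)
    qed
    also have "\<dots> \<le> (exp a * max 1 (a powr a)) * t powr a" by (simp add: mult_right_mono mult_left_mono)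
    finally show ?thesis using False by (simp add: F1_slope_def)
  qed
  then have "t * t \<le> t * ((exp a * max 1 (a powr a)) * F1_slope t)" using t0 by (intro mult_left_mono) auto
  then show ?thesis using t0 by (simp add: F1_eq_slope power2_eq_square mult_ac)
qed (simp add: F1_zero)

lemma F1_near_linear: "near_linear_orlicz (orlicz_F1 a) (2 powr (- a)) (exp a * max 1 (a powr a))"
proof
  show "orlicz_F1 a 1 = 1" by (simp add: orlicz_F1_def)
  show "0 < orlicz_F1 a t" if "0 < t" for t
    using that less_inv_e_iff[of t] by (auto simp: orlicz_F1_def intro!: mult_pos_pos)
qed (use F1_zero F1_convex F1_almost_linear F1_sublinear square_le_F1 in auto)

end

theorem corollary4p8:
  fixes a :: real
  assumes "a > 0"
  shows "has_unique_greedy_basis (orlicz_space (orlicz_F1 a)) (orlicz_norm (orlicz_F1 a))"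
  using F1_near_linear[OF assms] by (rule near_linear_orlicz.unique_greedy_basis)

end
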